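(* Let $T=(N,E)$ be a directed tree with root $0$, let $F=(F_n)_{n\in N}$ be a family of univariate distribution functions, and let $B=(B_e)_{e\in E}$ and $C=(C_e)_{e\in E}$ be families of bivariate copulas. Let $X\sim\mathcal M(F,T,B)$ and $Y\sim\mathcal M(F,T,C)$. Assume for all $e\in E$ that (i) $B_e$ is SI, (ii) $C_e$ is CI, (iii) $B_e\leq_{lo}C_e$ (resp. $B_e\geq_{lo}C_e$). Then $X\leq_{sm}Y$ (resp. $X\geq_{sm}Y$). In particular, $X$ and $Y$ are PSMD.
   Context: Trees. $N=\{0,1,\dots,d\}$ with $d\in\mathbb N$, or $N=\mathbb N_0$. A (directed) tree $T=(N,E)$ with root $0$ has oriented edges $E\subset N\times N$ such that for every $i\in N\setminus\{0\}$ there is a unique directed path from $0$ to $i$. Between any two nodes there is a unique undirected path; the path between $i$ and $j$ is the set of nodes strictly between them. Markov tree distributions. A node $i$ separates disjoint $A,B\subset N$ if for all $a\in A$, $b\in B$ the path between $a$ and $b$ contains $i$. $(X_n)_{n\in N}$ follows a Markov tree distribution with respect to $T$ if for all finite disjoint $A,B\subset N$ and every $i$ separating $A$ and $B$, $(X_j)_{j\in A}$ and $(X_j)_{j\in B}$ are conditionally independent given $X_i$. $X\sim\mathcal M(F,T,B)$ means that $X=(X_n)_{n\in N}$ has the (unique) Markov tree distribution with respect to $T$ such that $X_n$ has distribution function $F_n$ for all $n\in N$ and $B_e$ is a copula of $(X_i,X_j)$ for all $e=(i,j)\in E$, i.e. $P(X_i\le x,X_j\le y)=B_e(F_i(x),F_j(y))$.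 Dependence concepts. "Increasing" means non-decreasing. $V\uparrow_{st}U$ means that $\mathbb E[f(V)\mid U=u]$ is increasing in $u$ outside a $P^U$-null set, for all increasing $f:\mathbb R\to\mathbb R$ such that the expectations exist. A bivariate copula (distribution function) is SI if there is a random vector $(U,V)$ with this distribution function such that $V\uparrow_{st}U$; it is CI if moreover $U\uparrow_{st}V$. $B_e\leq_{lo}C_e$ means $B_e(u,v)\le C_e(u,v)$ for all $(u,v)\in[0,1]^2$. Supermodular order. $f:\mathbb R^m\to\mathbb R$ is supermodular if $f(x)+f(y)\le f(x\wedge y)+f(x\vee y)$ for all $x,y$. A measurable weight function $b:\mathbb R^m\to[1,\infty)$ is fixed (e.g. $b(x)=\max\{1,\|x\|^p\}$); random vectors are assumed $b$-integrable, and test functions are measurable and $b$-bounded ($\sup_x|f(x)|/b(x)<\infty$). $V\leq_{sm}W$ means $\mathbb Ef(V)\le\mathbb Ef(W)$ for all $b$-bounded supermodular $f$; for infinite sequences it means that all finite-dimensional subvectors are so ordered. $V$ is positive supermodular dependent (PSMD) if $V^\perp\leq_{sm}V$, where $V^\perp$ has independent components with the same univariate marginals as $V$. *)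

theory Defs
  imports "HOL-Probability.Probability"
begin

definition index_set :: "nat set \<Rightarrow> bool" where
  "index_set N \<longleftrightarrow> N = UNIV \<or> (\<exists>d\<ge>1. N = {0..d})"

definition directed_path :: "(nat \<times> nat) set \<Rightarrow> nat \<Rightarrow> nat \<Rightarrow> nat list \<Rightarrow> bool" where
  "directed_path E i j p \<longleftrightarrow>
     p \<noteq> [] \<and> hd p = i \<and> last p = j \<and> successively (\<lambda>u v. (u, v) \<in> E) p"

text \<open>
  Directed paths may repeat nodes. This makes the uniqueness requirement exclude directed cycles
  (a node reachable through a cycle is the end of more than one path), hence also edges into
  the root and loops.
\<close>

definition directed_tree :: "nat set \<Rightarrow> (nat \<times> nat) set \<Rightarrow> bool" where
  "directed_tree N E \<longleftrightarrow> E \<subseteq> N \<times> N \<and> (\<forall>i\<in>N - {0}. \<exists>!p. directed_path E 0 i p)"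

definition undirected_path :: "(nat \<times> nat) set \<Rightarrow> nat \<Rightarrow> nat \<Rightarrow> nat list \<Rightarrow> bool" where
  "undirected_path E i j p \<longleftrightarrow>
     p \<noteq> [] \<and> hd p = i \<and> last p = j \<and> distinct p \<and>
     successively (\<lambda>u v. (u, v) \<in> E \<or> (v, u) \<in> E) p"

text \<open>In a tree the undirected path is unique, so the union below ranges over a single path.\<close>

definition between :: "(nat \<times> nat) set \<Rightarrow> nat \<Rightarrow> nat \<Rightarrow> nat set" where
  "between E i j = (\<Union>p \<in> {p. undirected_path E i j p}. set p - {i, j})"

definition separates :: "(nat \<times> nat) set \<Rightarrow> nat \<Rightarrow> nat set \<Rightarrow> nat set \<Rightarrow> bool" where
  "separates E i A B \<longleftrightarrow> (\<forall>a\<in>A. \<forall>b\<in>B. i \<in> between E a b)"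

definition distribution_function :: "(real \<Rightarrow> real) \<Rightarrow> bool" where
  "distribution_function F \<longleftrightarrow> (\<exists>\<mu>. real_distribution \<mu> \<and> F = cdf \<mu>)"

text \<open>Only the values of a copula on the unit square matter.\<close>

definition copula :: "(real \<Rightarrow> real \<Rightarrow> real) \<Rightarrow> bool" where
  "copula C \<longleftrightarrow>
     (\<forall>u\<in>{0..1}. C u 0 = 0 \<and> C 0 u = 0 \<and> C u 1 = u \<and> C 1 u = u) \<and>
     (\<forall>u\<in>{0..1}. \<forall>u'\<in>{0..1}. \<forall>v\<in>{0..1}. \<forall>v'\<in>{0..1}.
        u \<le> u' \<longrightarrow> v \<le> v' \<longrightarrow> 0 \<le> C u' v' - C u' v - C u v' + C u v)"

definition le_lo :: "(real \<Rightarrow> real \<Rightarrow> real) \<Rightarrow> (real \<Rightarrow> real \<Rightarrow> real) \<Rightarrow> bool" where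
  "le_lo B C \<longleftrightarrow> (\<forall>u\<in>{0..1}. \<forall>v\<in>{0..1}. B u v \<le> C u v)"

text \<open>The function \<open>g\<close> is a version of \<open>u \<mapsto> E[Z | U = u]\<close>.\<close>

definition cond_exp_version ::
  "'a measure \<Rightarrow> ('a \<Rightarrow> real) \<Rightarrow> ('a \<Rightarrow> real) \<Rightarrow> (real \<Rightarrow> real) \<Rightarrow> bool" where
  "cond_exp_version M Z U g \<longleftrightarrow>
     g \<in> borel_measurable borel \<and>
     (AE \<omega> in M. real_cond_exp M (vimage_algebra (space M) U borel) Z \<omega> = g (U \<omega>))"

text \<open>
  \<open>st_increasing M V U\<close> is the relation that \<open>V\<close> is stochastically increasing in \<open>U\<close>.
  Two versions of the conditional expectation agree outside a null set of the law of \<open>U\<close>,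
  so the choice of the version is immaterial.
\<close>

definition st_increasing :: "'a measure \<Rightarrow> ('a \<Rightarrow> real) \<Rightarrow> ('a \<Rightarrow> real) \<Rightarrow> bool" where
  "st_increasing M V U \<longleftrightarrow>
     (\<forall>f :: real \<Rightarrow> real. mono f \<longrightarrow> integrable M (\<lambda>\<omega>. f (V \<omega>)) \<longrightarrow>
        (\<exists>g. cond_exp_version M (\<lambda>\<omega>. f (V \<omega>)) U g \<and>
             (\<exists>S \<in> null_sets (distr M borel U). mono_on (- S) g)))"

text \<open>
  A random vector with distribution function \<open>C\<close> is realised on its canonical space, i.e. as the
  coordinate pair \<open>(fst, snd)\<close> under a law on the plane. Stochastic monotonicity only depends
  on this law.
\<close>

definition has_copula_law :: "(real \<times> real) measure \<Rightarrow> (real \<Rightarrow> real \<Rightarrow> real) \<Rightarrow> bool" where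
  "has_copula_law \<mu> C \<longleftrightarrow>
     prob_space \<mu> \<and> sets \<mu> = sets borel \<and>
     (\<forall>u\<in>{0..1}. \<forall>v\<in>{0..1}. measure \<mu> {w \<in> space \<mu>. fst w \<le> u \<and> snd w \<le> v} = C u v)"

definition SI :: "(real \<Rightarrow> real \<Rightarrow> real) \<Rightarrow> bool" where
  "SI C \<longleftrightarrow> (\<exists>\<mu>. has_copula_law \<mu> C \<and> st_increasing \<mu> snd fst)"

definition CI :: "(real \<Rightarrow> real \<Rightarrow> real) \<Rightarrow> bool" where
  "CI C \<longleftrightarrow> (\<exists>\<mu>. has_copula_law \<mu> C \<and> st_increasing \<mu> snd fst \<and> st_increasing \<mu> fst snd)"

definition subvector :: "nat set \<Rightarrow> (nat \<Rightarrow> 'a \<Rightarrow> real) \<Rightarrow> 'a \<Rightarrow> (nat \<Rightarrow> real)" where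
  "subvector I X \<omega> = (\<lambda>i\<in>I. X i \<omega>)"

definition cond_prob_given :: "'a measure \<Rightarrow> ('a \<Rightarrow> real) \<Rightarrow> 'a set \<Rightarrow> 'a \<Rightarrow> real" where
  "cond_prob_given M Z A = real_cond_exp M (vimage_algebra (space M) Z borel) (indicator A)"

definition cond_indep_given ::
  "'a measure \<Rightarrow> (nat \<Rightarrow> 'a \<Rightarrow> real) \<Rightarrow> nat set \<Rightarrow> nat set \<Rightarrow> nat \<Rightarrow> bool" where
  "cond_indep_given M X A B i \<longleftrightarrow>
     (\<forall>S \<in> sets (Pi\<^sub>M A (\<lambda>_. borel)). \<forall>S' \<in> sets (Pi\<^sub>M B (\<lambda>_. borel)).
        let G = subvector A X -` S \<inter> space M; H = subvector B X -` S' \<inter> space M in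
        AE \<omega> in M. cond_prob_given M (X i) (G \<inter> H) \<omega> =
                     cond_prob_given M (X i) G \<omega> * cond_prob_given M (X i) H \<omega>)"

definition markov_tree :: "'a measure \<Rightarrow> (nat \<Rightarrow> 'a \<Rightarrow> real) \<Rightarrow> nat set \<Rightarrow> (nat \<times> nat) set \<Rightarrow> bool" where
  "markov_tree M X N E \<longleftrightarrow>
     (\<forall>A B i. finite A \<longrightarrow> finite B \<longrightarrow> A \<subseteq> N \<longrightarrow> B \<subseteq> N \<longrightarrow> A \<inter> B = {} \<longrightarrow> i \<in> N \<longrightarrow>
        separates E i A B \<longrightarrow> cond_indep_given M X A B i)"

text \<open>
  \<open>has_markov_tree_dist M X F N E B\<close>: the process \<open>X\<close>, defined on the probability space \<open>M\<close>, has the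
  distribution \<open>\<M>(F, T, B)\<close> for the tree \<open>T = (N, E)\<close>.
\<close>

definition has_markov_tree_dist ::
  "'a measure \<Rightarrow> (nat \<Rightarrow> 'a \<Rightarrow> real) \<Rightarrow> (nat \<Rightarrow> real \<Rightarrow> real) \<Rightarrow> nat set \<Rightarrow> (nat \<times> nat) set \<Rightarrow>
   (nat \<times> nat \<Rightarrow> real \<Rightarrow> real \<Rightarrow> real) \<Rightarrow> bool" where
  "has_markov_tree_dist M X F N E B \<longleftrightarrow>
     prob_space M \<and> (\<forall>n\<in>N. X n \<in> borel_measurable M) \<and>
     markov_tree M X N E \<and>
     (\<forall>n\<in>N. cdf (distr M borel (X n)) = F n) \<and>
     (\<forall>(i, j)\<in>E. \<forall>x y.
        measure M {\<omega> \<in> space M. X i \<omega> \<le> x \<and> X j \<omega> \<le> y} = B (i, j) (F i x) (F j y))"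

text \<open>
  The space of real vectors with a finite index set \<open>I\<close> is \<open>\<Pi>\<^sub>E i\<in>I. UNIV\<close>, with the product
  Borel sigma-algebra; \<open>inf\<close> and \<open>sup\<close> are the componentwise minimum and maximum and do not
  leave this space.
\<close>

definition supermodular :: "nat set \<Rightarrow> ((nat \<Rightarrow> real) \<Rightarrow> real) \<Rightarrow> bool" where
  "supermodular I f \<longleftrightarrow>
     (\<forall>x \<in> (\<Pi>\<^sub>E i\<in>I. UNIV). \<forall>y \<in> (\<Pi>\<^sub>E i\<in>I. UNIV). f x + f y \<le> f (inf x y) + f (sup x y))"

definition weight_function :: "nat set \<Rightarrow> ((nat \<Rightarrow> real) \<Rightarrow> real) \<Rightarrow> bool" where
  "weight_function I b \<longleftrightarrow>
     b \<in> borel_measurable (Pi\<^sub>M I (\<lambda>_. borel)) \<and> (\<forall>x \<in> (\<Pi>\<^sub>E i\<in>I. UNIV). 1 \<le> b x)"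

definition b_bounded :: "nat set \<Rightarrow> ((nat \<Rightarrow> real) \<Rightarrow> real) \<Rightarrow> ((nat \<Rightarrow> real) \<Rightarrow> real) \<Rightarrow> bool" where
  "b_bounded I b f \<longleftrightarrow> bdd_above ((\<lambda>x. \<bar>f x\<bar> / b x) ` (\<Pi>\<^sub>E i\<in>I. UNIV))"

text \<open>The order between the laws \<open>P\<close>, \<open>Q\<close> of two \<open>b\<close>-integrable vectors indexed by \<open>I\<close>.\<close>

definition le_sm_vec ::
  "nat set \<Rightarrow> ((nat \<Rightarrow> real) \<Rightarrow> real) \<Rightarrow> (nat \<Rightarrow> real) measure \<Rightarrow> (nat \<Rightarrow> real) measure \<Rightarrow> bool" where
  "le_sm_vec I b P Q \<longleftrightarrow>
     (\<forall>f \<in> borel_measurable (Pi\<^sub>M I (\<lambda>_. borel)).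
        b_bounded I b f \<longrightarrow> supermodular I f \<longrightarrow> (\<integral>x. f x \<partial>P) \<le> (\<integral>x. f x \<partial>Q))"

text \<open>
  The index sets of the vectors to be compared: the whole vector if \<open>N\<close> is finite, all
  finite-dimensional subvectors if \<open>N\<close> is infinite. There is one weight function \<open>b I\<close>
  for each such index set \<open>I\<close>; a weight on \<open>\<real>\<^sup>m\<close> gives one for every \<open>I\<close> with \<open>m\<close> elements.
\<close>

definition vector_indices :: "nat set \<Rightarrow> nat set set" where
  "vector_indices N = (if finite N then {N} else {I. finite I \<and> I \<noteq> {} \<and> I \<subseteq> N})"

type_synonym laws = "nat set \<Rightarrow> (nat \<Rightarrow> real) measure"
type_synonym weights = "nat set \<Rightarrow> (nat \<Rightarrow> real) \<Rightarrow> real"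

definition law :: "'a measure \<Rightarrow> (nat \<Rightarrow> 'a \<Rightarrow> real) \<Rightarrow> laws" where
  "law M X I = distr M (Pi\<^sub>M I (\<lambda>_. borel)) (subvector I X)"

text \<open>The law of the vector with independent components and the univariate marginals of \<open>X\<close>.\<close>

definition indep_law :: "'a measure \<Rightarrow> (nat \<Rightarrow> 'a \<Rightarrow> real) \<Rightarrow> laws" where
  "indep_law M X I = Pi\<^sub>M I (\<lambda>i. distr M borel (X i))"

definition b_integrable :: "nat set \<Rightarrow> weights \<Rightarrow> laws \<Rightarrow> bool" where
  "b_integrable N b L \<longleftrightarrow> (\<forall>I \<in> vector_indices N. integrable (L I) (b I))"

definition le_sm :: "nat set \<Rightarrow> weights \<Rightarrow> laws \<Rightarrow> laws \<Rightarrow> bool" where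
  "le_sm N b L L' \<longleftrightarrow> (\<forall>I \<in> vector_indices N. le_sm_vec I (b I) (L I) (L' I))"

definition PSMD :: "nat set \<Rightarrow> weights \<Rightarrow> 'a measure \<Rightarrow> (nat \<Rightarrow> 'a \<Rightarrow> real) \<Rightarrow> bool" where
  "PSMD N b M X \<longleftrightarrow> le_sm N b (indep_law M X) (law M X)"

end

theory Submission
  imports Defs
begin

text \<open>
  A stochastically increasing copula has concave sections in its first argument, so each edge of
  the tree carries a kernel with a quantile function \<open>q x u\<close> that is increasing in the parent value
  \<open>x\<close>. Integrating out a leaf along such a kernel preserves supermodularity, because
  \<open>x \<mapsto> (x, q x\<^sub>i u)\<close> is a lattice homomorphism. Hence one may build the tree leaf by leaf and, at each
  step, first compare the laws without the new leaf \<open>j\<close> and then exchange the copula of the new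
  edge \<open>(i, j)\<close>. For the exchange, all other copulas are CI, so edges can be reversed and the whole
  vector is, given its coordinate \<open>i\<close>, a random increasing function of that coordinate; this
  reduces the exchange to the fact that the pointwise order of bivariate distribution functions
  with the same marginals implies the supermodular order. Independence is the case of the product
  copula, which is CI and lies below every SI copula.

  The intermediate laws need not integrate the given test function, so all of this is done for
  bounded functions. Markov trees with SI copulas are associated, and association allows the
  passage from truncated to integrable supermodular functions.
\<close>

section \<open>Supermodular functions of two variables\<close>

text \<open>The two hypotheses are used at different places. The kernel that carries a test function
  across the new edge is always that of \<open>B\<close>, from parent to child, so SI suffices
  there. The copula is always exchanged under the law with the copulas \<open>C\<close>, and this
  needs the vector conditioned on an arbitrary node \<open>i\<close>: the edges between
  \<open>i\<close> and the root are then run backwards, which takes monotonicity in both directions.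
  The reversed inequality uses the same two steps in the other order, so no SI edge is ever
  reversed. The obstacle for the kernels is that the marginals may have atoms. The conditional law
  given an atom is an average of left derivatives of the copula over the jump of the distribution
  function, which is why a uniform randomisation enters. A quantile function that is finite for
  every real \<open>u\<close> needs values in a bounded interval; hence the transformation
  \<open>arctan\<close> and the constant 2, which exceeds pi/2. In the final limit the independent
  vector with the same marginals serves a second purpose: its integrability provides the base point
  at which the test function is normalised.\<close>

lemma lower_set_seq:
  fixes L :: "real set"
  assumes "\<And>x y. x \<in> L \<Longrightarrow> y \<le> x \<Longrightarrow> y \<in> L" "L \<noteq> {}"
  shows "\<exists>s. incseq s \<and> L = (\<Union>n. {..s n :: real})"
proof (cases "bdd_above L")
  case False
  have "L = UNIV"
  proof -
    have "y \<in> L" for y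
      using False assms(1) unfolding bdd_above_def by (meson linear)
    then show ?thesis by auto
  qed
  moreover have "(\<Union>n::nat. {..real n}) = UNIV"
    using real_arch_simple by blast
  ultimately show ?thesis by (intro exI[of _ real]) (auto simp: incseq_def)
next
  case True
  define a where "a = Sup L"
  show ?thesis
  proof (cases "a \<in> L")
    case True
    then have "L = (\<Union>n::nat. {..a})"
      using assms(1) \<open>bdd_above L\<close> unfolding a_def by (auto intro: cSup_upper)
    then show ?thesis by (intro exI[of _ "\<lambda>_. a"]) (auto simp: incseq_def)
  next
    case False
    have lt: "x < a" if "x \<in> L" for x
      using that False cSup_upper[OF that \<open>bdd_above L\<close>] unfolding a_def
      by (metis order_le_imp_less_or_eq)
    have "{..<a} = L"
    proof safe
      fix x assume "x < a"
      then obtain y where "y \<in> L" "x < y"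
        unfolding a_def using less_cSup_iff[OF assms(2) \<open>bdd_above L\<close>] by auto
      then show "x \<in> L" using assms(1) by (meson less_imp_le)
    qed (use lt in auto)
    moreover have "{..<a} = (\<Union>n::nat. {..a - 1 / real (Suc n)})"
    proof safe
      fix x assume "x < a"
      then obtain n where "1 / real (Suc n) < a - x"
        using nat_approx_posE[of "a - x"] by auto
      then show "x \<in> (\<Union>n::nat. {..a - 1 / real (Suc n)})" by (auto intro!: exI[of _ n])
    next
      fix x n assume "x \<le> a - 1 / real (Suc n)"
      moreover have "1 / real (Suc n) > 0" by simp
      ultimately show "x < a" by linarith
    qed
    moreover have "incseq (\<lambda>n. a - 1 / real (Suc n))"
      by (auto simp: incseq_def frac_le)
    ultimately show ?thesis by blast
  qed
qed

lemma times_sets_borel: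
  fixes A B :: "real set"
  assumes "A \<in> sets borel" "B \<in> sets borel"
  shows "A \<times> B \<in> sets (borel :: (real \<times> real) measure)"
  using assms by (metis borel_prod pair_measureI)

lemma lower_set_borel:
  fixes L :: "real set"
  assumes "\<And>x y. x \<in> L \<Longrightarrow> y \<le> x \<Longrightarrow> y \<in> L"
  shows "L \<in> sets borel"
proof (cases "L = {}")
  case False
  have "\<exists>s. incseq s \<and> L = (\<Union>n. {..s n})"
    by (rule lower_set_seq) (use assms False in auto)
  then show ?thesis by auto
qed auto

lemma fst_borel [measurable]: "fst \<in> borel_measurable (borel :: (real \<times> real) measure)"
  and snd_borel [measurable]: "snd \<in> borel_measurable (borel :: (real \<times> real) measure)"
  by (simp_all flip: borel_prod)

text \<open>Laws instead of copulas: the pairs compared later have arbitrary marginals, possibly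
  with atoms, and only the equality of the marginals and the order of the joint distribution
  functions enter.\<close>

locale lo_ordered_pair =
  P: prob_space P + Q: prob_space Q for P Q :: "(real \<times> real) measure" +
  assumes sets_P [simp, measurable_cong]: "sets P = sets borel"
    and sets_Q [simp, measurable_cong]: "sets Q = sets borel"
    and fst_eq: "distr P borel fst = distr Q borel fst"
    and snd_eq: "distr P borel snd = distr Q borel snd"
    and cdf_le: "\<And>x y. measure P ({..x} \<times> {..y}) \<le> measure Q ({..x} \<times> {..y})"
begin

lemma space_P [simp]: "space P = UNIV" and space_Q [simp]: "space Q = UNIV"
  using sets_eq_imp_space_eq[OF sets_P] sets_eq_imp_space_eq[OF sets_Q] by auto

lemma integral_fst_eq:
  fixes g :: "real \<Rightarrow> real"
  assumes [measurable]: "g \<in> borel_measurable borel"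
  shows "(\<integral>z. g (fst z) \<partial>P) = (\<integral>z. g (fst z) \<partial>Q)"
proof -
  have "(\<integral>z. g (fst z) \<partial>P) = (\<integral>x. g x \<partial>distr P borel fst)"
    by (subst integral_distr) auto
  also have "\<dots> = (\<integral>z. g (fst z) \<partial>Q)"
    unfolding fst_eq by (subst integral_distr) auto
  finally show ?thesis .
qed

lemma integral_snd_eq:
  fixes g :: "real \<Rightarrow> real"
  assumes [measurable]: "g \<in> borel_measurable borel"
  shows "(\<integral>z. g (snd z) \<partial>P) = (\<integral>z. g (snd z) \<partial>Q)"
proof -
  have "(\<integral>z. g (snd z) \<partial>P) = (\<integral>x. g x \<partial>distr P borel snd)"
    by (subst integral_distr) auto
  also have "\<dots> = (\<integral>z. g (snd z) \<partial>Q)"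
    unfolding snd_eq by (subst integral_distr) auto
  finally show ?thesis .
qed

lemma measure_fst_eq:
  assumes [measurable]: "A \<in> sets borel"
  shows "measure P (A \<times> UNIV) = measure Q (A \<times> UNIV)"
proof -
  have "measure P (A \<times> UNIV) = measure (distr P borel fst) A"
    by (subst measure_distr) (auto intro!: arg_cong[of _ _ "measure P"])
  also have "\<dots> = measure Q (A \<times> UNIV)"
    unfolding fst_eq by (subst measure_distr) (auto intro!: arg_cong[of _ _ "measure Q"])
  finally show ?thesis .
qed

lemma measure_snd_eq:
  assumes [measurable]: "A \<in> sets borel"
  shows "measure P (UNIV \<times> A) = measure Q (UNIV \<times> A)"
proof -
  have "measure P (UNIV \<times> A) = measure (distr P borel snd) A"
    by (subst measure_distr) (auto intro!: arg_cong[of _ _ "measure P"])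
  also have "\<dots> = measure Q (UNIV \<times> A)"
    unfolding snd_eq by (subst measure_distr) (auto intro!: arg_cong[of _ _ "measure Q"])
  finally show ?thesis .
qed

text \<open>Closed quadrants exhaust a product of lower sets, also when these are open rays or the
  whole line, so the order of the distribution functions passes to it by continuity from
  below.\<close>

lemma lower_le:
  assumes "\<And>x y. x \<in> L \<Longrightarrow> y \<le> x \<Longrightarrow> y \<in> L" "\<And>x y. x \<in> L' \<Longrightarrow> y \<le> x \<Longrightarrow> y \<in> L'"
  shows "measure P (L \<times> L') \<le> measure Q (L \<times> L')"
proof (cases "L = {} \<or> L' = {}")
  case False
  have "\<exists>s. incseq s \<and> L = (\<Union>n. {..s n :: real})"
    by (rule lower_set_seq) (use False assms(1) in auto)
  then obtain s where s: "incseq s" "L = (\<Union>n. {..s n :: real})" by blast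
  have "\<exists>s. incseq s \<and> L' = (\<Union>n. {..s n :: real})"
    by (rule lower_set_seq) (use False assms(2) in auto)
  then obtain t where t: "incseq t" "L' = (\<Union>n. {..t n :: real})" by blast
  have inc: "incseq (\<lambda>n. {..s n} \<times> {..t n})"
    unfolding incseq_def
    by (intro allI impI Sigma_mono) (use incseqD[OF s(1)] incseqD[OF t(1)] in auto)
  have U: "L \<times> L' = (\<Union>n. {..s n} \<times> {..t n})"
  proof safe
    fix x y assume "x \<in> L" "y \<in> L'"
    then obtain m n where "x \<le> s m" "y \<le> t n" using s t by auto
    then have "x \<le> s (max m n)" "y \<le> t (max m n)"
      using s(1) t(1) by (meson incseqD max.cobounded1 max.cobounded2 order_trans)+
    then show "(x, y) \<in> (\<Union>n. {..s n} \<times> {..t n})" by auto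
  qed (use s t in auto)
  have "(\<lambda>n. measure P ({..s n} \<times> {..t n})) \<longlonglongrightarrow> measure P (L \<times> L')"
    unfolding U by (intro P.finite_Lim_measure_incseq inc) (auto intro!: times_sets_borel)
  moreover have "(\<lambda>n. measure Q ({..s n} \<times> {..t n})) \<longlonglongrightarrow> measure Q (L \<times> L')"
    unfolding U by (intro Q.finite_Lim_measure_incseq inc) (auto intro!: times_sets_borel)
  ultimately show ?thesis
    by (rule LIMSEQ_le) (use cdf_le in auto)
qed auto

text \<open>Inclusion-exclusion on the complements: the strips depend on the marginals only and
  cancel, so both rectangles \<open>A \<times> B\<close> and \<open>(- A) \<times> (- B)\<close>
  have the same difference of masses under the two laws.\<close>

lemma upper_le:
  assumes "\<And>x y. x \<in> A \<Longrightarrow> x \<le> y \<Longrightarrow> y \<in> A" "\<And>x y. x \<in> B \<Longrightarrow> x \<le> y \<Longrightarrow> y \<in> B"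
  shows "measure P (A \<times> B) \<le> measure Q (A \<times> B)"
proof -
  have A: "x \<in> - A \<Longrightarrow> y \<le> x \<Longrightarrow> y \<in> - A" for x y using assms(1) by blast
  have B: "x \<in> - B \<Longrightarrow> y \<le> x \<Longrightarrow> y \<in> - B" for x y using assms(2) by blast
  have m: "- A \<in> sets borel" "- B \<in> sets borel"
    by (rule lower_set_borel, rule A, assumption+) (rule lower_set_borel, rule B, assumption+)
  have le: "measure P ((- A) \<times> (- B)) \<le> measure Q ((- A) \<times> (- B))"
    by (rule lower_le) (rule A B, assumption+)+
  have m': "A \<in> sets borel" "B \<in> sets borel"
    using m[THEN borel_comp] by auto
  note ts = times_sets_borel[OF m(1) m(2)] times_sets_borel[OF m'] times_sets_borel[OF m(1) m'(2)]
    times_sets_borel[OF m'(1) m(2)]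
  have split: "measure R (A \<times> B) = 1 - measure R ((- A) \<times> UNIV) - measure R (UNIV \<times> (- B))
       + measure R ((- A) \<times> (- B))" if "prob_space R" "sets R = sets borel" for R :: "(real \<times> real) measure"
  proof -
    interpret R: prob_space R by fact
    note that(2)[simp]
    have sp: "space R = UNIV" using sets_eq_imp_space_eq[OF that(2)] by simp
    have add: "measure R (C \<union> D) = measure R C + measure R D"
      if "C \<in> sets borel" "D \<in> sets borel" "C \<inter> D = {}" for C D
      using that by (intro R.finite_measure_Union) auto
    note ts' = times_sets_borel[OF _ m(2), of UNIV] times_sets_borel[OF _ m'(2), of UNIV]
    have "(- A) \<times> UNIV = (- A) \<times> B \<union> (- A) \<times> (- B)" by blast
    then have 1: "measure R ((- A) \<times> UNIV) = measure R ((- A) \<times> B) + measure R ((- A) \<times> (- B))"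
      using add[OF ts(3,1)] by auto
    have "UNIV \<times> (- B) = A \<times> (- B) \<union> (- A) \<times> (- B)" by blast
    then have 2: "measure R (UNIV \<times> (- B)) = measure R (A \<times> (- B)) + measure R ((- A) \<times> (- B))"
      using add[OF ts(4,1)] by auto
    have "UNIV \<times> B = A \<times> B \<union> (- A) \<times> B" by blast
    then have "measure R (UNIV \<times> B) = measure R (A \<times> B) + measure R ((- A) \<times> B)"
      using add[OF ts(2,3)] by auto
    moreover have "UNIV \<times> UNIV = UNIV \<times> B \<union> (UNIV :: real set) \<times> (- B)" by blast
    then have "measure R (UNIV \<times> UNIV) = measure R (UNIV \<times> B) + measure R (UNIV \<times> (- B))"
      using add[OF ts'(2,1)] by auto
    moreover have "measure R (UNIV \<times> UNIV) = 1" using R.prob_space sp by simp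
    ultimately show ?thesis using 1 2 by linarith
  qed
  show ?thesis
    using split[OF P.prob_space_axioms sets_P] split[OF Q.prob_space_axioms sets_Q]
      measure_fst_eq[OF m(1)] measure_snd_eq[OF m(2)] le by linarith
qed

end

text \<open>The discrete derivative along the sorted points of \<open>S\<close>. At the least point
  it is the value itself, so that summation inverts it without a boundary term.\<close>

definition increment :: "real set \<Rightarrow> (real \<Rightarrow> 'b :: ab_group_add) \<Rightarrow> real \<Rightarrow> 'b" where
  "increment S g r = (if r = Min S then g r else g r - g (Max {q \<in> S. q < r}))"

lemma sum_increment:
  assumes "finite S" "s \<in> S"
  shows "(\<Sum>r | r \<in> S \<and> r \<le> s. increment S g r) = g s"
  using assms(2)
proof (induction "card {r \<in> S. r < s}" arbitrary: s rule: less_induct)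
  case less
  show ?case
  proof (cases "s = Min S")
    case True
    then have "{r \<in> S. r \<le> s} = {s}"
      using less.prems Min_le[OF assms(1)] by (auto intro: order.antisym)
    then show ?thesis using True by (simp add: increment_def)
  next
    case False
    define t where "t = Max {q \<in> S. q < s}"
    have ne: "{q \<in> S. q < s} \<noteq> {}"
      using False less.prems Min_le[OF assms(1) less.prems] Min_in[OF assms(1)] by force
    have t: "t \<in> S" "t < s"
      using Max_in[OF _ ne] assms(1) unfolding t_def by auto
    have split: "{r \<in> S. r \<le> s} = insert s {r \<in> S. r \<le> t}"
    proof -
      have "r \<le> t" if "r \<in> S" "r < s" for r
        unfolding t_def using that assms(1) by (intro Max_ge) auto
      then show ?thesis using less.prems t by force
    qed
    have "{r \<in> S. r < t} \<subset> {r \<in> S. r < s}" using t by auto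
    then have "card {r \<in> S. r < t} < card {r \<in> S. r < s}"
      using assms(1) by (intro psubset_card_mono) auto
    from less.hyps[OF this t(1)]
    have "(\<Sum>r | r \<in> S \<and> r \<le> t. increment S g r) = g t" by simp
    then have "(\<Sum>r | r \<in> S \<and> r \<le> s. increment S g r) = increment S g s + g t"
      unfolding split using t assms(1) by (subst sum.insert) auto
    then show ?thesis using False by (simp add: increment_def t_def)
  qed
qed

context lo_ordered_pair
begin

text \<open>Summation by parts in both variables: on the grid, \<open>\<phi>\<close> is a
  combination of indicators of upper rectangles, with its mixed second differences \<open>D\<close>
  as coefficients. Supermodularity makes those in the interior nonnegative. On the boundary of the
  grid the sign is unknown, but there the rectangle is a strip, whose mass is fixed by a
  marginal.\<close>

lemma supermodular_le_finite_range:
  fixes \<phi> :: "real \<Rightarrow> real \<Rightarrow> real"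
  assumes "mono \<rho>" "mono \<rho>'" "finite (range \<rho>)" "finite (range \<rho>')"
    and sm: "\<And>x x' y y'. x \<le> x' \<Longrightarrow> y \<le> y' \<Longrightarrow> \<phi> x y' + \<phi> x' y \<le> \<phi> x y + \<phi> x' y'"
  shows "(\<integral>z. \<phi> (\<rho> (fst z)) (\<rho>' (snd z)) \<partial>P) \<le> (\<integral>z. \<phi> (\<rho> (fst z)) (\<rho>' (snd z)) \<partial>Q)"
proof -
  define S where "S = range \<rho>"
  define S' where "S' = range \<rho>'"
  define A where "A r = {x. r \<le> \<rho> x}" for r
  define A' where "A' r = {x. r \<le> \<rho>' x}" for r
  define D where "D r r' = increment S' (\<lambda>t. increment S (\<lambda>s. \<phi> s t) r) r'" for r r'
  have fin: "finite S" "finite S'" "S \<noteq> {}" "S' \<noteq> {}" using assms by (auto simp: S_def S'_def)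
  have [measurable]: "\<rho> \<in> borel_measurable borel" "\<rho>' \<in> borel_measurable borel"
    using assms by (auto intro: borel_measurable_mono)
  have A_m: "A r \<times> A' r' \<in> sets (borel :: (real \<times> real) measure)" for r r'
    unfolding A_def A'_def by (intro times_sets_borel) measurable
  have rep: "\<phi> (\<rho> x) (\<rho>' y) = (\<Sum>r\<in>S. \<Sum>r'\<in>S'. D r r' * indicator (A r \<times> A' r') (x, y))" for x y
  proof -
    have "\<phi> (\<rho> x) (\<rho>' y) = (\<Sum>r' | r' \<in> S' \<and> r' \<le> \<rho>' y. \<Sum>r | r \<in> S \<and> r \<le> \<rho> x. D r r')"
    proof -
      have "(\<Sum>r | r \<in> S \<and> r \<le> \<rho> x. D r r') = increment S' (\<lambda>t. \<phi> (\<rho> x) t) r'" for r'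
      proof -
        have *: "(\<Sum>r | r \<in> S \<and> r \<le> \<rho> x. increment S (\<lambda>s. \<phi> s t) r) = \<phi> (\<rho> x) t" for t
          using sum_increment[OF fin(1), of "\<rho> x" "\<lambda>s. \<phi> s t"] by (simp add: S_def)
        show ?thesis
          unfolding D_def increment_def[of S'] using * by (simp add: sum_subtractf)
      qed
      then show ?thesis
        using sum_increment[OF fin(2), of "\<rho>' y" "\<lambda>t. \<phi> (\<rho> x) t"] by (simp add: S'_def)
    qed
    also have "\<dots> = (\<Sum>r | r \<in> S \<and> r \<le> \<rho> x. \<Sum>r' | r' \<in> S' \<and> r' \<le> \<rho>' y. D r r')"
      by (rule sum.swap)
    also have "\<dots> = (\<Sum>r\<in>S. \<Sum>r'\<in>S'. D r r' * indicator (A r \<times> A' r') (x, y))"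
      unfolding sum.inter_filter[OF fin(1)] sum.inter_filter[OF fin(2)]
      by (intro sum.cong) (auto simp: A_def A'_def indicator_def intro!: sum.cong)
    finally show ?thesis .
  qed
  have D_le: "D r r' * measure P (A r \<times> A' r') \<le> D r r' * measure Q (A r \<times> A' r')"
    if "r \<in> S" "r' \<in> S'" for r r'
  proof -
    have m: "A r \<in> sets borel" "A' r' \<in> sets borel" unfolding A_def A'_def by measurable
    consider "r = Min S" | "r' = Min S'" | "r \<noteq> Min S" "r' \<noteq> Min S'" by blast
    then show ?thesis
    proof cases
      case 1
      then have "A r = UNIV" using fin unfolding A_def S_def by auto
      then show ?thesis using measure_snd_eq[OF m(2)] by simp
    next
      case 2
      then have "A' r' = UNIV" using fin unfolding A'_def S'_def by auto
      then show ?thesis using measure_fst_eq[OF m(1)] by simp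
    next
      case 3
      have ne: "{q \<in> S. q < r} \<noteq> {}" "{q \<in> S'. q < r'} \<noteq> {}"
        using 3 that Min_le[OF fin(1) that(1)] Min_in[OF fin(1,3)] Min_le[OF fin(2) that(2)]
          Min_in[OF fin(2,4)] by force+
      define p where "p = Max {q \<in> S. q < r}"
      define p' where "p' = Max {q \<in> S'. q < r'}"
      have "p < r" "p' < r'" using Max_in[OF _ ne(1)] Max_in[OF _ ne(2)] fin unfolding p_def p'_def by auto
      then have "D r r' \<ge> 0"
        using sm[of p r p' r'] 3 by (simp add: D_def increment_def p_def[symmetric] p'_def[symmetric])
      moreover have "measure P (A r \<times> A' r') \<le> measure Q (A r \<times> A' r')"
        by (rule upper_le) (use assms(1,2) in \<open>simp add: A_def A'_def; meson monoD order_trans\<close>)+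
      ultimately show ?thesis by (rule mult_left_mono[rotated])
    qed
  qed
  have int: "(\<integral>z. \<phi> (\<rho> (fst z)) (\<rho>' (snd z)) \<partial>R) = (\<Sum>r\<in>S. \<Sum>r'\<in>S'. D r r' * measure R (A r \<times> A' r'))"
    if "prob_space R" "sets R = sets borel" for R :: "(real \<times> real) measure"
  proof -
    interpret R: prob_space R by fact
    have sp: "space R = UNIV" using sets_eq_imp_space_eq[OF that(2)] by simp
    have i: "integrable R (indicator (A r \<times> A' r') :: _ \<Rightarrow> real)" for r r'
      using A_m that(2) by (intro integrable_real_indicator) (auto simp: R.emeasure_eq_measure)
    have "(\<integral>z. indicator (A r \<times> A' r') z \<partial>R) = measure R (A r \<times> A' r')" for r r'
      using A_m that(2) sp by simp
    then have "(\<integral>z. (\<Sum>r\<in>S. \<Sum>r'\<in>S'. D r r' * indicator (A r \<times> A' r') z) \<partial>R)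
        = (\<Sum>r\<in>S. \<Sum>r'\<in>S'. D r r' * measure R (A r \<times> A' r'))"
      using i by (simp add: Bochner_Integration.integral_sum)
    moreover have "\<phi> (\<rho> (fst z)) (\<rho>' (snd z)) = (\<Sum>r\<in>S. \<Sum>r'\<in>S'. D r r' * indicator (A r \<times> A' r') z)" for z
      using rep[of "fst z" "snd z"] by simp
    ultimately show ?thesis by presburger
  qed
  show ?thesis
    unfolding int[OF P.prob_space_axioms sets_P] int[OF Q.prob_space_axioms sets_Q]
    by (intro sum_mono D_le)
qed

end

text \<open>The argument is rounded, not the value: \<open>\<rho>\<close> picks one representative
  from each level set of the floor of \<open>m x / \<epsilon>\<close>. It can therefore be
  substituted into any function whose oscillation is controlled by \<open>m\<close>.\<close>

lemma ex_finite_range_approx: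
  fixes m :: "real \<Rightarrow> real"
  assumes "mono m" "\<And>x. \<bar>m x\<bar> \<le> c" "\<epsilon> > 0"
  shows "\<exists>\<rho>. mono \<rho> \<and> finite (range \<rho>) \<and> (\<forall>x :: real. \<bar>m (\<rho> x) - m x\<bar> \<le> \<epsilon>)"
proof -
  define l where "l x = \<lfloor>m x / \<epsilon>\<rfloor>" for x
  define g where "g k = (SOME r. l r = k)" for k
  have g: "l (g (l x)) = l x" for x
    unfolding g_def by (rule someI) rule
  have l_mono: "l x \<le> l y" if "x \<le> y" for x y
    unfolding l_def using monoD[OF assms(1) that] assms(3) by (intro floor_mono divide_right_mono) auto
  have "mono (\<lambda>x. g (l x))"
  proof
    fix x y :: real assume "x \<le> y"
    show "g (l x) \<le> g (l y)"
    proof (rule ccontr)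
      assume "\<not> g (l x) \<le> g (l y)"
      then have "l (g (l y)) \<le> l (g (l x))" by (intro l_mono) auto
      then have "l x = l y" using g l_mono[OF \<open>x \<le> y\<close>] by force
      then show False using \<open>\<not> g (l x) \<le> g (l y)\<close> by simp
    qed
  qed
  moreover have "finite (range (\<lambda>x. g (l x)))"
  proof -
    have "l x \<in> {\<lfloor>- c / \<epsilon>\<rfloor>..\<lfloor>c / \<epsilon>\<rfloor>}" for x
      unfolding l_def using assms(2)[of x] assms(3) divide_right_mono[of "- c" "m x" \<epsilon>]
      by (auto simp: abs_le_iff intro!: floor_mono divide_right_mono)
    then have "range l \<subseteq> {\<lfloor>- c / \<epsilon>\<rfloor>..\<lfloor>c / \<epsilon>\<rfloor>}" by auto
    then have "finite (g ` range l)" by (meson finite_atLeastAtMost_int finite_imageI finite_subset)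
    then show ?thesis by (simp add: image_image)
  qed
  moreover have "\<bar>m (g (l x)) - m x\<bar> \<le> \<epsilon>" for x
  proof -
    have "\<bar>m (g (l x)) / \<epsilon> - m x / \<epsilon>\<bar> < 1"
      using g[of x] unfolding l_def by linarith
    then have "\<bar>(m (g (l x)) - m x) / \<epsilon>\<bar> < 1" by (simp add: diff_divide_distrib)
    then show ?thesis using assms(3) by (simp add: abs_divide divide_less_eq split: if_splits)
  qed
  ultimately show ?thesis by (intro exI[of _ "\<lambda>x. g (l x)"]) auto
qed

definition clamp_to :: "real \<Rightarrow> real \<Rightarrow> real \<Rightarrow> real" where
  "clamp_to a b x = max a (min b x)"

lemma clamp_to_mono: "x \<le> y \<Longrightarrow> clamp_to a b x \<le> clamp_to a b y"
  by (auto simp: clamp_to_def)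

lemma clamp_to_id: "a \<le> x \<Longrightarrow> x \<le> b \<Longrightarrow> clamp_to a b x = x"
  by (auto simp: clamp_to_def)

lemma clamp_to_idem: "a \<le> b \<Longrightarrow> clamp_to a b (clamp_to a b x) = clamp_to a b x"
  by (auto simp: clamp_to_def)

lemma clamp_to_borel [measurable]: "clamp_to a b \<in> borel_measurable borel"
  unfolding clamp_to_def by measurable

context lo_ordered_pair
begin

lemma integrable_bounded:
  assumes "f \<in> borel_measurable borel" "\<And>z. \<bar>f z :: real\<bar> \<le> c"
  shows "integrable P f" "integrable Q f"
  using assms by (auto intro!: P.integrable_const_bound[of _ c] Q.integrable_const_bound[of _ c])

text \<open>Subtracting the sections through the lower corner leaves \<open>\<psi>\<close>, whose
  increments in \<open>x\<close> are, by supermodularity, between 0 and those of the monotone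
  function \<open>m\<close>, uniformly in \<open>y\<close>; likewise for \<open>m'\<close> in the
  other variable. Hence finite grids approximate \<open>\<psi>\<close> uniformly although
  \<open>\<phi>\<close> need not be continuous. The subtracted sections have equal integrals under
  both laws.\<close>

lemma supermodular_le_box:
  fixes \<phi> :: "real \<Rightarrow> real \<Rightarrow> real"
  assumes [measurable]: "(\<lambda>z. \<phi> (fst z) (snd z)) \<in> borel_measurable borel"
    and bnd: "\<And>x y. \<bar>\<phi> x y\<bar> \<le> c"
    and sm: "\<And>x x' y y'. x \<le> x' \<Longrightarrow> y \<le> y' \<Longrightarrow> \<phi> x y' + \<phi> x' y \<le> \<phi> x y + \<phi> x' y'"
    and clamp: "\<And>x y. \<phi> x y = \<phi> (clamp_to a b x) (clamp_to a b y)" and "a \<le> b"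
  shows "(\<integral>z. \<phi> (fst z) (snd z) \<partial>P) \<le> (\<integral>z. \<phi> (fst z) (snd z) \<partial>Q)"
proof -
  define m where "m x = \<phi> x b - \<phi> x a" for x
  define m' where "m' y = \<phi> b y - \<phi> a y" for y
  define \<psi> where "\<psi> x y = \<phi> x y - \<phi> x a - \<phi> a y" for x y
  have cl: "a \<le> clamp_to a b x" "clamp_to a b x \<le> b" for x
    using \<open>a \<le> b\<close> by (auto simp: clamp_to_def)
  have clab: "clamp_to a b a = a" "clamp_to a b b = b" using \<open>a \<le> b\<close> by (auto simp: clamp_to_def)
  have c1: "\<phi> (clamp_to a b x) y = \<phi> x y" for x y
    using clamp[of x y] clamp[of "clamp_to a b x" y] \<open>a \<le> b\<close> by (simp add: clamp_to_idem)
  have c2: "\<phi> x (clamp_to a b y) = \<phi> x y" for x y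
    using clamp[of x y] clamp[of x "clamp_to a b y"] \<open>a \<le> b\<close> by (simp add: clamp_to_idem)
  have mono: "mono m" "mono m'"
    unfolding m_def m'_def by (rule monoI; use sm \<open>a \<le> b\<close> in \<open>force simp: algebra_simps\<close>)+
  have mb: "\<bar>m x\<bar> \<le> 2 * c" "\<bar>m' x\<bar> \<le> 2 * c" for x
    using bnd[of x b] bnd[of x a] bnd[of a x] bnd[of b x] unfolding m_def m'_def by linarith+
  have d1: "\<bar>\<psi> x y - \<psi> x' y\<bar> \<le> \<bar>m x - m x'\<bar>" for x x' y
  proof (induction x x' rule: linorder_wlog)
    case (le x x')
    then show ?case
      using sm[OF le cl(1)[of y]] sm[OF le cl(2)[of y]] unfolding c2 \<psi>_def m_def by linarith
  qed (simp add: abs_minus_commute)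
  have d2: "\<bar>\<psi> x y - \<psi> x y'\<bar> \<le> \<bar>m' y - m' y'\<bar>" for x y y'
  proof (induction y y' rule: linorder_wlog)
    case (le y y')
    then show ?case
      using sm[OF cl(1)[of x] le] sm[OF cl(2)[of x] le] unfolding c1 \<psi>_def m'_def by linarith
  qed (simp add: abs_minus_commute)
  have m1 [measurable]: "(\<lambda>x. \<phi> x a) \<in> borel_measurable borel"
    using measurable_compose[of "\<lambda>x. (x, a)" borel borel, OF _ assms(1)] by (simp flip: borel_prod)
  have m2 [measurable]: "(\<lambda>x. \<phi> a x) \<in> borel_measurable borel"
    using measurable_compose[of "\<lambda>x. (a, x)" borel borel, OF _ assms(1)] by (simp flip: borel_prod)
  have [measurable]: "(\<lambda>z. \<psi> (fst z) (snd z)) \<in> borel_measurable borel"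
    unfolding \<psi>_def by measurable
  have \<psi>b: "\<bar>\<psi> x y\<bar> \<le> 3 * c" for x y
    using bnd[of x y] bnd[of x a] bnd[of a y] unfolding \<psi>_def by linarith
  have sm\<psi>: "\<psi> x y' + \<psi> x' y \<le> \<psi> x y + \<psi> x' y'" if "x \<le> x'" "y \<le> y'" for x x' y y'
    using sm[OF that] unfolding \<psi>_def by linarith
  \<comment> \<open>Each of the two laws contributes \<open>2 * \<epsilon>\<close>, one
    \<open>\<epsilon>\<close> for each rounded coordinate.\<close>
  have "(\<integral>z. \<psi> (fst z) (snd z) \<partial>P) \<le> (\<integral>z. \<psi> (fst z) (snd z) \<partial>Q) + 4 * \<epsilon>" if "\<epsilon> > 0" for \<epsilon>
  proof -
    obtain \<rho> where \<rho>: "mono \<rho>" "finite (range \<rho>)" "\<And>x. \<bar>m (\<rho> x) - m x\<bar> \<le> \<epsilon>"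
      using ex_finite_range_approx[OF mono(1) mb(1) \<open>\<epsilon> > 0\<close>] by auto
    obtain \<rho>' where \<rho>': "mono \<rho>'" "finite (range \<rho>')" "\<And>x. \<bar>m' (\<rho>' x) - m' x\<bar> \<le> \<epsilon>"
      using ex_finite_range_approx[OF mono(2) mb(2) \<open>\<epsilon> > 0\<close>] by auto
    have [measurable]: "\<rho> \<in> borel_measurable borel" "\<rho>' \<in> borel_measurable borel"
      using \<rho> \<rho>' by (auto intro: borel_measurable_mono)
    have near: "\<bar>\<psi> (\<rho> x) (\<rho>' y) - \<psi> x y\<bar> \<le> 2 * \<epsilon>" for x y
      using d1[of "\<rho> x" "\<rho>' y" x] d2[of x "\<rho>' y" y] \<rho>(3)[of x] \<rho>'(3)[of y] by linarith
    have [measurable]: "(\<lambda>z. (\<rho> (fst z), \<rho>' (snd z))) \<in> borel \<rightarrow>\<^sub>M borel"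
      unfolding borel_prod[symmetric] by measurable
    have [measurable]: "(\<lambda>z. \<psi> (\<rho> (fst z)) (\<rho>' (snd z))) \<in> borel_measurable borel"
      using measurable_compose[of "\<lambda>z. (\<rho> (fst z), \<rho>' (snd z))" borel borel "\<lambda>z. \<psi> (fst z) (snd z)"] by simp
    have I: "integrable P (\<lambda>z. \<psi> (fst z) (snd z))" "integrable Q (\<lambda>z. \<psi> (fst z) (snd z))"
      "integrable P (\<lambda>z. \<psi> (\<rho> (fst z)) (\<rho>' (snd z)))" "integrable Q (\<lambda>z. \<psi> (\<rho> (fst z)) (\<rho>' (snd z)))"
      by (rule integrable_bounded[OF _ \<psi>b]; measurable)+
    have near': "\<psi> x y \<le> \<psi> (\<rho> x) (\<rho>' y) + 2 * \<epsilon>" "\<psi> (\<rho> x) (\<rho>' y) \<le> \<psi> x y + 2 * \<epsilon>" for x y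
      using near[of x y] by linarith+
    have "(\<integral>z. \<psi> (fst z) (snd z) \<partial>P) \<le> (\<integral>z. \<psi> (\<rho> (fst z)) (\<rho>' (snd z)) + 2 * \<epsilon> \<partial>P)"
      by (intro integral_mono Bochner_Integration.integrable_add I P.integrable_const Q.integrable_const near')
    also have "\<dots> = (\<integral>z. \<psi> (\<rho> (fst z)) (\<rho>' (snd z)) \<partial>P) + 2 * \<epsilon>"
      using I P.prob_space by simp
    also have "(\<integral>z. \<psi> (\<rho> (fst z)) (\<rho>' (snd z)) \<partial>P) \<le> (\<integral>z. \<psi> (\<rho> (fst z)) (\<rho>' (snd z)) \<partial>Q)"
      by (rule supermodular_le_finite_range[OF \<rho>(1) \<rho>'(1) \<rho>(2) \<rho>'(2)]) (rule sm\<psi>)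
    also have "\<dots> \<le> (\<integral>z. \<psi> (fst z) (snd z) + 2 * \<epsilon> \<partial>Q)"
      by (intro integral_mono Bochner_Integration.integrable_add I P.integrable_const Q.integrable_const near')
    also have "\<dots> = (\<integral>z. \<psi> (fst z) (snd z) \<partial>Q) + 2 * \<epsilon>"
      using I Q.prob_space by simp
    finally show ?thesis by simp
  qed
  then have "(\<integral>z. \<psi> (fst z) (snd z) \<partial>P) \<le> (\<integral>z. \<psi> (fst z) (snd z) \<partial>Q) + \<epsilon>" if "\<epsilon> > 0" for \<epsilon>
    using that[THEN divide_pos_pos[of _ 4]] by fastforce
  then have le: "(\<integral>z. \<psi> (fst z) (snd z) \<partial>P) \<le> (\<integral>z. \<psi> (fst z) (snd z) \<partial>Q)"
    by (rule field_le_epsilon)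
  have I: "integrable P (\<lambda>z. \<psi> (fst z) (snd z))" "integrable Q (\<lambda>z. \<psi> (fst z) (snd z))"
    by (rule integrable_bounded[OF _ \<psi>b]; measurable)+
  have I': "integrable P (\<lambda>z. \<phi> (fst z) a)" "integrable Q (\<lambda>z. \<phi> (fst z) a)"
    "integrable P (\<lambda>z. \<phi> a (snd z))" "integrable Q (\<lambda>z. \<phi> a (snd z))"
    by (rule integrable_bounded[OF _ bnd]; measurable)+
  have "(\<integral>z. \<phi> (fst z) (snd z) \<partial>R) = (\<integral>z. \<psi> (fst z) (snd z) \<partial>R) + (\<integral>z. \<phi> (fst z) a \<partial>R) + (\<integral>z. \<phi> a (snd z) \<partial>R)"
    if "R = P \<or> R = Q" for R
  proof -
    have "(\<integral>z. \<phi> (fst z) (snd z) \<partial>R) = (\<integral>z. \<psi> (fst z) (snd z) + \<phi> (fst z) a + \<phi> a (snd z) \<partial>R)"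
      by (simp add: \<psi>_def)
    also have "\<dots> = (\<integral>z. \<psi> (fst z) (snd z) \<partial>R) + (\<integral>z. \<phi> (fst z) a \<partial>R) + (\<integral>z. \<phi> a (snd z) \<partial>R)"
      using I I' that by (elim disjE) (simp_all only: Bochner_Integration.integral_add Bochner_Integration.integrable_add)
    finally show ?thesis .
  qed
  then show ?thesis using le integral_fst_eq[OF m1] integral_snd_eq[OF m2] by simp
qed

text \<open>Clamping both coordinates is increasing in each of them, so it keeps the supermodular
  inequality, and it is eventually the identity at every point.\<close>

theorem supermodular_le:
  fixes \<phi> :: "real \<Rightarrow> real \<Rightarrow> real"
  assumes \<phi>_borel: "(\<lambda>z. \<phi> (fst z) (snd z)) \<in> borel_measurable borel"
    and bnd: "\<And>x y. \<bar>\<phi> x y\<bar> \<le> c"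
    and sm: "\<And>x x' y y'. x \<le> x' \<Longrightarrow> y \<le> y' \<Longrightarrow> \<phi> x y' + \<phi> x' y \<le> \<phi> x y + \<phi> x' y'"
  shows "(\<integral>z. \<phi> (fst z) (snd z) \<partial>P) \<le> (\<integral>z. \<phi> (fst z) (snd z) \<partial>Q)"
proof -
  define g where "g n z = \<phi> (clamp_to (- real n) (real n) (fst z)) (clamp_to (- real n) (real n) (snd z))" for n z
  have [measurable]: "g n \<in> borel_measurable borel" for n
  proof -
    have "(\<lambda>z. (clamp_to (- real n) (real n) (fst z), clamp_to (- real n) (real n) (snd z))) \<in> borel \<rightarrow>\<^sub>M borel"
      unfolding borel_prod[symmetric] by measurable
    from measurable_compose[OF this \<phi>_borel] show ?thesis unfolding g_def by simp
  qed
  have lim: "(\<lambda>n. g n z) \<longlonglongrightarrow> \<phi> (fst z) (snd z)" for z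
  proof (rule tendsto_eventually)
    obtain k :: nat where "real k \<ge> \<bar>fst z\<bar> + \<bar>snd z\<bar>" using real_arch_simple by blast
    then have "g n z = \<phi> (fst z) (snd z)" if "n \<ge> k" for n
      using that unfolding g_def by (subst (1 2) clamp_to_id) auto
    then show "\<forall>\<^sub>F n in sequentially. g n z = \<phi> (fst z) (snd z)"
      by (auto simp: eventually_sequentially)
  qed
  have gb: "\<bar>g n z\<bar> \<le> c" for n z
    unfolding g_def by (rule bnd)
  have gP: "(\<lambda>n. \<integral>z. g n z \<partial>P) \<longlonglongrightarrow> (\<integral>z. \<phi> (fst z) (snd z) \<partial>P)"
    by (rule integral_dominated_convergence[of _ _ _ "\<lambda>_. c"])
       (use \<phi>_borel lim gb in auto)
  have gQ: "(\<lambda>n. \<integral>z. g n z \<partial>Q) \<longlonglongrightarrow> (\<integral>z. \<phi> (fst z) (snd z) \<partial>Q)"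
    by (rule integral_dominated_convergence[of _ _ _ "\<lambda>_. c"])
       (use \<phi>_borel lim gb in auto)
  have "(\<integral>z. g n z \<partial>P) \<le> (\<integral>z. g n z \<partial>Q)" for n
    unfolding g_def
    by (rule supermodular_le_box[where c = c and a = "- real n" and b = "real n"])
       (use bnd sm clamp_to_mono in \<open>auto simp: g_def[symmetric] clamp_to_idem\<close>)
  with gP gQ show ?thesis by (intro LIMSEQ_le[OF gP gQ]) auto
qed

end

section \<open>Kernels of stochastically increasing copulas\<close>

definition unif :: "real measure" where
  "unif = uniform_measure lborel {0..1}"

lemma sets_unif [simp, measurable_cong]: "sets unif = sets borel"
  by (simp add: unif_def)

lemma space_unif [simp]: "space unif = UNIV"
  by (simp add: unif_def)

lemma emeasure_unif: "A \<in> sets borel \<Longrightarrow> emeasure unif A = emeasure lborel ({0..1} \<inter> A)"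
  unfolding unif_def by (subst emeasure_uniform_measure) (auto simp: divide_ennreal_def)

interpretation unif: prob_space unif
  by (rule prob_spaceI) (simp add: emeasure_unif)

lemma measure_unif: "A \<in> sets borel \<Longrightarrow> measure unif A = measure lborel ({0..1} \<inter> A)"
  by (simp add: measure_def emeasure_unif)

lemma measure_unif_atMost: "0 \<le> t \<Longrightarrow> t \<le> 1 \<Longrightarrow> measure unif {..t} = t"
  using measure_unif[of "{..t}"] Int_atLeastAtMostR2[of 0 1 t] by (simp add: min_def)

lemma measure_unif_atLeast: "0 \<le> t \<Longrightarrow> t \<le> 1 \<Longrightarrow> measure unif {t..} = 1 - t"
proof -
  assume "0 \<le> t" "t \<le> 1"
  then have "{0..1} \<inter> {t..} = {t..1}" by auto
  then show ?thesis using measure_unif[of "{t..}"] \<open>t \<le> 1\<close> by simp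
qed

lemma measure_unif_Ioc: "0 \<le> s \<Longrightarrow> s \<le> t \<Longrightarrow> t \<le> 1 \<Longrightarrow> measure unif {s<..t} = t - s"
proof -
  assume "0 \<le> s" "s \<le> t" "t \<le> 1"
  then have "{0..1} \<inter> {s<..t} = {s<..t}" by auto
  then show ?thesis using measure_unif[of "{s<..t}"] \<open>s \<le> t\<close> by simp
qed

lemma AE_unif: "AE w in unif. 0 \<le> w \<and> w \<le> 1"
  unfolding unif_def by (rule AE_uniform_measureI) auto

section \<open>Concavity of copula sections from stochastic monotonicity\<close>

text \<open>Chords over disjoint intervals suffice for what follows.\<close>

definition concave_in_fst :: "(real \<Rightarrow> real \<Rightarrow> real) \<Rightarrow> bool" where
  "concave_in_fst C \<longleftrightarrow> (\<forall>v\<in>{0..1}. \<forall>a b c d. 0 \<le> a \<longrightarrow> a < b \<longrightarrow> b \<le> c \<longrightarrow> c < d \<longrightarrow> d \<le> 1 \<longrightarrow>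
     (C d v - C c v) * (b - a) \<le> (C b v - C a v) * (d - c))"

text \<open>An increment of \<open>C\<close> in its first argument over \<open>(s, t]\<close> is the
  integral of P(V <= v | U) over the event that U lies in that interval. Stochastic monotonicity
  makes this probability decreasing in the conditioning value, so its average over an earlier
  interval dominates that over a later one.\<close>

lemma concave_in_fst_of_st_increasing:
  assumes "prob_space M" and [measurable]: "U \<in> borel_measurable M" "V \<in> borel_measurable M"
    and law: "\<And>u v. u \<in> {0..1} \<Longrightarrow> v \<in> {0..1} \<Longrightarrow> measure M {\<omega> \<in> space M. U \<omega> \<le> u \<and> V \<omega> \<le> v} = C u v"
    and C: "copula C" and st: "st_increasing M V U"
  shows "concave_in_fst C"
  unfolding concave_in_fst_def
proof (intro ballI allI impI)
  fix v a b c d :: real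
  assume v: "v \<in> {0..1}" and *: "0 \<le> a" "a < b" "b \<le> c" "c < d" "d \<le> 1"
  interpret M: prob_space M by fact
  \<comment> \<open>The indicator of \<open>V > v\<close> is used because it is the increasing one;
    \<open>V \<le> v\<close> is recovered by complement.\<close>
  define f where "f = (indicator {v<..} :: real \<Rightarrow> real)"
  have [measurable]: "f \<in> borel_measurable borel" unfolding f_def by measurable
  have intf: "integrable M (\<lambda>\<omega>. f (V \<omega>))"
    by (rule M.integrable_const_bound[of _ 1]) (auto simp: f_def)
  have "mono f" by (auto simp: f_def mono_def indicator_def)
  then obtain g S where g: "cond_exp_version M (\<lambda>\<omega>. f (V \<omega>)) U g"
    and S: "S \<in> null_sets (distr M borel U)" "mono_on (- S) g"
    using st intf unfolding st_increasing_def by blast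
  have [measurable]: "g \<in> borel_measurable borel"
    using g by (simp add: cond_exp_version_def)
  let ?F = "vimage_algebra (space M) U borel"
  have sub: "subalgebra M ?F"
    unfolding subalgebra_def by (auto simp: sets_vimage_algebra2)
  interpret F: finite_measure_subalgebra M ?F
    using sub by unfold_locales
  have AES: "AE \<omega> in M. U \<omega> \<notin> S"
    using AE_not_in[OF S(1)] by (subst (asm) AE_distr_iff) (use S(1) in auto)
  \<comment> \<open>The hypothesis gives joint masses on the unit square only.
    \<open>C 1 1 = 1\<close> confines both variables to values at most 1, and this makes the first
    one uniform.\<close>
  have leU: "measure M {\<omega> \<in> space M. U \<omega> \<le> u} = u" if "u \<in> {0..1}" for u
  proof -
    have "measure M {\<omega> \<in> space M. U \<omega> \<le> 1 \<and> V \<omega> \<le> 1} = 1"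
      using law[of 1 1] C by (simp add: copula_def)
    then have "AE \<omega> in M. U \<omega> \<le> 1 \<and> V \<omega> \<le> 1"
      by (subst (asm) M.prob_Collect_eq_1) auto
    then have "measure M {\<omega> \<in> space M. U \<omega> \<le> u} = measure M {\<omega> \<in> space M. U \<omega> \<le> u \<and> V \<omega> \<le> 1}"
      by (intro M.finite_measure_eq_AE) auto
    then show ?thesis using law[of u 1] that C by (simp add: copula_def)
  qed
  have int_g: "integrable M (\<lambda>\<omega>. g (U \<omega>))"
    using F.real_cond_exp_int(1)[OF intf] g unfolding cond_exp_version_def
    by (subst integrable_cong_AE[symmetric]) (auto intro: measurable_from_subalg[OF sub])
  have key: "(\<integral>\<omega>. indicator {s<..t} (U \<omega>) * g (U \<omega>) \<partial>M) = (t - s) - (C t v - C s v)"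
    and len: "measure M {\<omega> \<in> space M. s < U \<omega> \<and> U \<omega> \<le> t} = t - s"
    if "0 \<le> s" "s \<le> t" "t \<le> 1" for s t
  proof -
    define A where "A = U -` {s<..t} \<inter> space M"
    have A: "A \<in> sets ?F" unfolding A_def by (rule in_vimage_algebra) auto
    have [measurable]: "A \<in> sets M" unfolding A_def by measurable
    have sub_eq: "measure M {\<omega> \<in> space M. s < U \<omega> \<and> U \<omega> \<le> t \<and> V \<omega> \<le> y}
        = measure M {\<omega> \<in> space M. U \<omega> \<le> t \<and> V \<omega> \<le> y} - measure M {\<omega> \<in> space M. U \<omega> \<le> s \<and> V \<omega> \<le> y}" for y
      using that by (subst M.finite_measure_Diff[symmetric]) (auto intro!: arg_cong[of _ _ "measure M"])
    show len: "measure M {\<omega> \<in> space M. s < U \<omega> \<and> U \<omega> \<le> t} = t - s"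
    proof -
      have "measure M {\<omega> \<in> space M. s < U \<omega> \<and> U \<omega> \<le> t}
        = measure M {\<omega> \<in> space M. U \<omega> \<le> t} - measure M {\<omega> \<in> space M. U \<omega> \<le> s}"
        using that by (subst M.finite_measure_Diff[symmetric]) (auto intro!: arg_cong[of _ _ "measure M"])
      then show ?thesis using leU[of t] leU[of s] that by simp
    qed
    have "(\<integral>\<omega>. indicator {s<..t} (U \<omega>) * g (U \<omega>) \<partial>M) = (\<integral>\<omega>\<in>A. g (U \<omega>) \<partial>M)"
      unfolding set_lebesgue_integral_def A_def by (intro Bochner_Integration.integral_cong) (auto simp: indicator_def)
    also have "\<dots> = (\<integral>\<omega>\<in>A. real_cond_exp M ?F (\<lambda>\<omega>. f (V \<omega>)) \<omega> \<partial>M)"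
      using g unfolding cond_exp_version_def
      by (intro set_lebesgue_integral_cong_AE) (auto intro: measurable_from_subalg[OF sub])
    also have "\<dots> = (\<integral>\<omega>\<in>A. f (V \<omega>) \<partial>M)"
      by (rule F.real_cond_exp_intA[OF intf A, symmetric])
    also have "\<dots> = (\<integral>\<omega>. indicator {\<omega> \<in> space M. s < U \<omega> \<and> U \<omega> \<le> t} \<omega>
        - indicator {\<omega> \<in> space M. s < U \<omega> \<and> U \<omega> \<le> t \<and> V \<omega> \<le> v} \<omega> \<partial>M)"
      unfolding set_lebesgue_integral_def A_def f_def
      by (intro Bochner_Integration.integral_cong) (auto simp: indicator_def)
    also have "\<dots> = measure M {\<omega> \<in> space M. s < U \<omega> \<and> U \<omega> \<le> t}
        - measure M {\<omega> \<in> space M. s < U \<omega> \<and> U \<omega> \<le> t \<and> V \<omega> \<le> v}"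
      by (subst Bochner_Integration.integral_diff) (auto simp: M.emeasure_eq_measure)
    finally show "(\<integral>\<omega>. indicator {s<..t} (U \<omega>) * g (U \<omega>) \<partial>M) = (t - s) - (C t v - C s v)"
      unfolding len sub_eq using law[of t v] law[of s v] that v by simp
  qed
  \<comment> \<open>Monotonicity of \<open>g\<close> holds off the null set \<open>S\<close> only,
    so every interval used below must contain a point outside \<open>S\<close>.\<close>
  have nonempty: "\<exists>x. s < x \<and> x \<le> t \<and> x \<notin> S" if "0 \<le> s" "s < t" "t \<le> 1" for s t
  proof (rule ccontr)
    assume "\<not> ?thesis"
    then have "AE \<omega> in M. \<not> (s < U \<omega> \<and> U \<omega> \<le> t)" using AES by auto
    then have "measure M {\<omega> \<in> space M. s < U \<omega> \<and> U \<omega> \<le> t} = measure M {}"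
      by (intro M.finite_measure_eq_AE) auto
    then show False using len[of s t] that by simp
  qed
  obtain z where z: "c < z" "z \<le> d" "z \<notin> S" using nonempty[of c d] * by auto
  define G where "G = g ` ({a<..b} - S)"
  have gle: "g x \<le> g y" if "x \<in> {a<..b} - S" "y \<in> {c<..d} - S" for x y
    using S(2) that * by (auto simp: mono_on_def)
  have G: "G \<noteq> {}" "bdd_above G"
    using nonempty[of a b] * gle[of _ z] z unfolding G_def by (auto intro!: bdd_aboveI[of _ "g z"])
  \<comment> \<open>\<open>g\<close> is a version of P(V > v | U). The constant \<open>m\<close>
    lies above its values on the earlier interval and below those on the later one, so each average
    can be compared with a constant.\<close>
  define m where "m = Sup G"
  have m1: "g x \<le> m" if "x \<in> {a<..b} - S" for x
    unfolding m_def using that G by (intro cSup_upper) (auto simp: G_def)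
  have m2: "m \<le> g x" if "x \<in> {c<..d} - S" for x
    unfolding m_def using G gle that by (intro cSup_least) (auto simp: G_def)
  have int_ig: "integrable M (\<lambda>\<omega>. indicator {s<..t} (U \<omega>) * g (U \<omega>))" for s t
    using int_g by (intro Bochner_Integration.integrable_bound[OF int_g]) (auto simp: indicator_def)
  have int_im: "integrable M (\<lambda>\<omega>. indicator {s<..t} (U \<omega>) * m)" for s t
    by (intro M.integrable_const_bound[of _ "\<bar>m\<bar>"]) (auto simp: indicator_def)
  have const: "(\<integral>\<omega>. indicator {s<..t} (U \<omega>) * m \<partial>M) = (t - s) * m" if "0 \<le> s" "s \<le> t" "t \<le> 1" for s t
  proof -
    have "(\<integral>\<omega>. indicator {s<..t} (U \<omega>) \<partial>M) = (\<integral>\<omega>. indicator {\<omega> \<in> space M. s < U \<omega> \<and> U \<omega> \<le> t} \<omega> \<partial>M :: real)"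
      by (intro Bochner_Integration.integral_cong) (auto simp: indicator_def)
    then show ?thesis using len[OF that] by simp
  qed
  have 1: "(b - a) - (C b v - C a v) \<le> (b - a) * m"
    unfolding key[of a b, symmetric, OF *(1) less_imp_le[OF *(2)] order_trans[OF *(3) order_trans[OF less_imp_le[OF *(4)] *(5)]]]
      const[of a b, symmetric, OF *(1) less_imp_le[OF *(2)] order_trans[OF *(3) order_trans[OF less_imp_le[OF *(4)] *(5)]]]
    by (rule integral_mono_AE[OF int_ig int_im]) (use AES m1 in \<open>auto simp: indicator_def\<close>)
  have c0: "0 \<le> c" using * by auto
  have 2: "(d - c) * m \<le> (d - c) - (C d v - C c v)"
    unfolding key[of c d, symmetric, OF c0 less_imp_le[OF *(4)] *(5)]
      const[of c d, symmetric, OF c0 less_imp_le[OF *(4)] *(5)]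
    by (rule integral_mono_AE[OF int_im int_ig]) (use AES m2 in \<open>auto simp: indicator_def\<close>)
  have "((b - a) - (C b v - C a v)) * (d - c) \<le> ((b - a) * m) * (d - c)"
    using 1 * by (intro mult_right_mono) auto
  also have "\<dots> = (b - a) * ((d - c) * m)" by simp
  also have "\<dots> \<le> (b - a) * ((d - c) - (C d v - C c v))"
    using 2 * by (intro mult_left_mono) auto
  finally show "(C d v - C c v) * (b - a) \<le> (C b v - C a v) * (d - c)"
    by (simp add: algebra_simps)
qed

lemma SI_concave: "copula C \<Longrightarrow> SI C \<Longrightarrow> concave_in_fst C"
proof -
  assume C: "copula C" "SI C"
  then obtain \<mu> where \<mu>: "has_copula_law \<mu> C" "st_increasing \<mu> snd fst" unfolding SI_def by auto
  then have [measurable_cong]: "sets \<mu> = sets borel" by (simp add: has_copula_law_def)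
  show ?thesis
    by (rule concave_in_fst_of_st_increasing[of \<mu> fst snd C])
       (use \<mu> C in \<open>auto simp: has_copula_law_def\<close>)
qed

lemma CI_concave: "copula C \<Longrightarrow> CI C \<Longrightarrow> concave_in_fst C \<and> concave_in_fst (\<lambda>u v. C v u)"
proof -
  assume C: "copula C" "CI C"
  then obtain \<mu> where \<mu>: "has_copula_law \<mu> C" "st_increasing \<mu> snd fst" "st_increasing \<mu> fst snd" unfolding CI_def by auto
  then have [measurable_cong]: "sets \<mu> = sets borel" by (simp add: has_copula_law_def)
  have sw: "copula (\<lambda>u v. C v u)" using C(1) unfolding copula_def
    by (simp add: algebra_simps)
  have "concave_in_fst (\<lambda>u v. C v u)"
    by (rule concave_in_fst_of_st_increasing[of \<mu> snd fst])
       (use \<mu> sw in \<open>auto simp: has_copula_law_def conj_commute\<close>)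
  then show ?thesis using SI_concave[OF C(1)] \<mu> unfolding SI_def by auto
qed

lemma copula_diff:
  assumes "copula C" "v \<in> {0..1}" "0 \<le> a" "a \<le> b" "b \<le> 1"
  shows "0 \<le> C b v - C a v" "C b v - C a v \<le> b - a"
    "w \<in> {0..1} \<Longrightarrow> v \<le> w \<Longrightarrow> C b v - C a v \<le> C b w - C a w"
proof -
  have m: "0 \<le> C b w - C b v - C a w + C a v" if "v \<le> w" "v \<in> {0..1}" "w \<in> {0..1}" for v w
    using assms(1,3-5) that unfolding copula_def by (meson atLeastAtMost_iff order_trans)
  have e: "C b 0 = 0" "C a 0 = 0" "C b 1 = b" "C a 1 = a"
    using assms unfolding copula_def by auto
  show "0 \<le> C b v - C a v" using m[of 0 v] e assms by auto
  show "C b v - C a v \<le> b - a" using m[of v 1] e assms by auto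
  show "w \<in> {0..1} \<Longrightarrow> v \<le> w \<Longrightarrow> C b v - C a v \<le> C b w - C a w" using m[of v w] assms by auto
qed

section \<open>The conditional distribution function of a copula\<close>

definition slopes :: "(real \<Rightarrow> real \<Rightarrow> real) \<Rightarrow> real \<Rightarrow> real \<Rightarrow> real set" where
  "slopes C v u = {(C b v - C a v) / (b - a) | a b. 0 \<le> a \<and> a < b \<and> b \<le> u \<and> b \<le> 1}"

text \<open>
  For a concave section this is the left derivative of \<open>C\<close> in the first argument, i.e. the
  conditional probability of \<open>V \<le> v\<close> given \<open>U = u\<close>. The element 1 only matters for \<open>u \<le> 0\<close>,
  where there are no chords.
\<close>

definition copula_kernel :: "(real \<Rightarrow> real \<Rightarrow> real) \<Rightarrow> real \<Rightarrow> real \<Rightarrow> real" where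
  "copula_kernel C u v = Inf (insert 1 (slopes C v u))"

context
  fixes C :: "real \<Rightarrow> real \<Rightarrow> real"
  assumes C: "copula C"
begin

lemma slopes_bounds: "v \<in> {0..1} \<Longrightarrow> s \<in> slopes C v u \<Longrightarrow> 0 \<le> s \<and> s \<le> 1"
  unfolding slopes_def using copula_diff(1,2)[OF C, of v] by (force simp: divide_le_eq)

lemma slopes_bdd: "v \<in> {0..1} \<Longrightarrow> bdd_below (insert 1 (slopes C v u))"
  by (rule bdd_belowI[of _ 0]) (metis insert_iff slopes_bounds zero_le_one)

lemma copula_kernel_bounds:
  assumes "v \<in> {0..1}"
  shows "0 \<le> copula_kernel C u v" "copula_kernel C u v \<le> 1"
proof -
  show "0 \<le> copula_kernel C u v"
    unfolding copula_kernel_def by (rule cInf_greatest, simp) (metis insert_iff slopes_bounds[OF assms] zero_le_one)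
  show "copula_kernel C u v \<le> 1"
    unfolding copula_kernel_def by (rule cInf_lower[OF _ slopes_bdd[OF assms]]) auto
qed

lemma copula_kernel_antimono:
  assumes "v \<in> {0..1}" "u \<le> u'"
  shows "copula_kernel C u' v \<le> copula_kernel C u v"
  unfolding copula_kernel_def
proof (rule cInf_superset_mono)
  show "insert 1 (slopes C v u) \<subseteq> insert 1 (slopes C v u')"
    using assms(2) unfolding slopes_def by fastforce
qed (use slopes_bdd[OF assms(1)] in simp)+

lemma copula_kernel_mono:
  assumes "v \<in> {0..1}" "v' \<in> {0..1}" "v \<le> v'"
  shows "copula_kernel C u v \<le> copula_kernel C u v'"
  unfolding copula_kernel_def
proof (rule cInf_mono)
  fix s assume "s \<in> insert 1 (slopes C v' u)"
  then consider "s = 1" | a b where "s = (C b v' - C a v') / (b - a)" "0 \<le> a" "a < b" "b \<le> u" "b \<le> 1"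
    unfolding slopes_def by auto
  then show "\<exists>r\<in>insert 1 (slopes C v u). r \<le> s"
  proof cases
    case 2
    then have "(C b v - C a v) / (b - a) \<le> s"
      using copula_diff(3)[OF C assms(1), of a b v'] assms by (auto intro!: divide_right_mono)
    moreover have "(C b v - C a v) / (b - a) \<in> slopes C v u" using 2 unfolding slopes_def by auto
    ultimately show ?thesis by blast
  qed auto
qed (use slopes_bdd[OF assms(1)] in simp)+

lemma copula_kernel_1: "copula_kernel C u 1 = 1"
proof -
  have "s = 1" if "s \<in> slopes C 1 u" for s
    using that C unfolding slopes_def copula_def by auto
  then have "insert 1 (slopes C 1 u) = {1}" by blast
  then show ?thesis unfolding copula_kernel_def by (metis cInf_singleton)
qed

lemma copula_kernel_borel:
  assumes "v \<in> {0..1}"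
  shows "(\<lambda>u. copula_kernel C u v) \<in> borel_measurable borel"
proof -
  have "(\<lambda>u. - copula_kernel C u v) \<in> borel_measurable borel"
    using copula_kernel_antimono[OF assms] by (intro borel_measurable_mono) (auto simp: mono_def)
  from borel_measurable_uminus[OF this] show ?thesis by simp
qed

text \<open>No differentiability is involved: on \<open>(a, b]\<close> both the increment of
  \<open>C\<close> and the integral of the kernel lie between \<open>b - a\<close> times the kernel
  at \<open>b\<close> and \<open>b - a\<close> times the kernel at \<open>a\<close>. Over
  \<open>n\<close> equal steps the errors telescope to at most \<open>t / n\<close>, because the
  kernel is monotone with values in [0, 1].\<close>

lemma integral_copula_kernel:
  assumes conc: "concave_in_fst C" and v: "v \<in> {0..1}" and t: "0 \<le> t" "t \<le> 1"
  shows "(\<integral>u. indicator {..t} u * copula_kernel C u v \<partial>unif) = C t v"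
proof -
  define K where "K u = copula_kernel C u v" for u
  note [measurable] = copula_kernel_borel[OF v, folded K_def]
  have Kb: "0 \<le> K u" "K u \<le> 1" for u using copula_kernel_bounds[OF v] by (auto simp: K_def)
  have Kanti: "u \<le> u' \<Longrightarrow> K u' \<le> K u" for u u' using copula_kernel_antimono[OF v] by (auto simp: K_def)
  have int: "integrable unif (\<lambda>u. indicator A u * K u)" if "A \<in> sets borel" for A
    using that Kb by (intro unif.integrable_const_bound[of _ 1]) (auto simp: indicator_def)
  define \<delta> where "\<delta> s = C s v - (\<integral>u. indicator {..s} u * K u \<partial>unif)" for s
  have step: "\<bar>\<delta> b - \<delta> a\<bar> \<le> (b - a) * (K a - K b)" if ab: "0 \<le> a" "a < b" "b \<le> 1" for a b
  proof -
    have "(C b v - C a v) / (b - a) \<in> slopes C v b" using ab unfolding slopes_def by auto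
    then have "K b \<le> (C b v - C a v) / (b - a)"
      unfolding K_def copula_kernel_def by (intro cInf_lower slopes_bdd v) auto
    then have 1: "(b - a) * K b \<le> C b v - C a v" using ab by (simp add: field_simps)
    \<comment> \<open>Concavity enters here: the interval from \<open>a\<close> to \<open>b\<close>
      lies to the right of all chords that define \<open>K a\<close>, so its slope is at most each
      of theirs. The adjoined 1 is covered by the Lipschitz bound for copulas.\<close>
    have "(C b v - C a v) / (b - a) \<le> K a"
      unfolding K_def copula_kernel_def
    proof (rule cInf_greatest)
      fix s assume "s \<in> insert 1 (slopes C v a)"
      then consider "s = 1" | c d where "s = (C d v - C c v) / (d - c)" "0 \<le> c" "c < d" "d \<le> a"
        unfolding slopes_def by auto
      then show "(C b v - C a v) / (b - a) \<le> s"
      proof cases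
        case 1
        then show ?thesis using copula_diff(2)[OF C v, of a b] ab by (simp add: divide_le_eq)
      next
        case 2
        then have "(C b v - C a v) * (d - c) \<le> (C d v - C c v) * (b - a)"
          using conc v ab unfolding concave_in_fst_def by blast
        then have "C b v - C a v \<le> (C d v - C c v) * (b - a) / (d - c)"
          using 2 by (simp add: pos_le_divide_eq)
        then show ?thesis using 2 ab by (simp add: pos_divide_le_eq)
      qed
    qed auto
    then have 2: "C b v - C a v \<le> (b - a) * K a" using ab by (simp add: field_simps)
    have "(\<integral>u. indicator {..b} u * K u \<partial>unif) - (\<integral>u. indicator {..a} u * K u \<partial>unif)
        = (\<integral>u. indicator {..b} u * K u - indicator {..a} u * K u \<partial>unif)"
      by (subst Bochner_Integration.integral_diff) (auto intro!: int)
    also have "\<dots> = (\<integral>u. indicator {a<..b} u * K u \<partial>unif)"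
      using ab by (intro Bochner_Integration.integral_cong) (auto simp: indicator_def)
    finally have 3: "(\<integral>u. indicator {..b} u * K u \<partial>unif) - (\<integral>u. indicator {..a} u * K u \<partial>unif)
        = (\<integral>u. indicator {a<..b} u * K u \<partial>unif)" .
    have cst: "(\<integral>u. indicator {a<..b} u * k \<partial>unif) = (b - a) * k" for k
      using measure_unif_Ioc[of a b] ab by simp
    have intc: "integrable unif (\<lambda>u. indicator {a<..b} u * k)" for k :: real
      by (intro unif.integrable_const_bound[of _ "\<bar>k\<bar>"]) (auto simp: indicator_def)
    have 4: "(b - a) * K b \<le> (\<integral>u. indicator {a<..b} u * K u \<partial>unif)"
      unfolding cst[symmetric]
      by (rule integral_mono[OF intc int]) (auto simp: indicator_def Kanti)
    have 5: "(\<integral>u. indicator {a<..b} u * K u \<partial>unif) \<le> (b - a) * K a"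
      unfolding cst[symmetric]
      by (rule integral_mono[OF int intc]) (auto simp: indicator_def Kanti)
    have "\<delta> b - \<delta> a = (C b v - C a v) - (\<integral>u. indicator {a<..b} u * K u \<partial>unif)"
      unfolding \<delta>_def 3[symmetric] by simp
    then show ?thesis using 1 2 4 5 unfolding right_diff_distrib abs_le_iff by linarith
  qed
  have "\<delta> 0 = 0"
  proof -
    have "AE u in unif. indicator {..0} u * K u = 0"
    proof -
      have "measure unif {..0} = 0" using measure_unif_atMost[of 0] by simp
      then have "emeasure unif {..0} = 0" by (simp add: unif.emeasure_eq_measure)
      then have "{..0} \<in> null_sets unif" by auto
      then show ?thesis by (auto dest!: AE_not_in elim!: eventually_mono simp: indicator_def)
    qed
    then have "(\<integral>u. indicator {..0} u * K u \<partial>unif) = (\<integral>u. 0 \<partial>unif)" by (intro integral_cong_AE) auto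
    moreover have "C 0 v = 0" using C v by (simp add: copula_def)
    ultimately show ?thesis by (simp add: \<delta>_def)
  qed
  have bound: "\<bar>\<delta> t\<bar> \<le> t / real n" if "n > 0" "t > 0" for n
  proof -
    define p where "p r = t * real r / real n" for r
    have p: "0 \<le> p r" "p r < p (Suc r)" "p (Suc r) - p r = t / real n" for r
      using that unfolding p_def by (auto simp: field_simps)
    have p1: "p r \<le> t" if "r \<le> n" for r
      unfolding p_def using that \<open>n > 0\<close> \<open>t > 0\<close> by (simp add: field_simps)
    have "\<bar>\<delta> (p r)\<bar> \<le> t / real n * (K 0 - K (p r))" if "r \<le> n" for r
      using that
    proof (induction r)
      case 0
      then show ?case using \<open>\<delta> 0 = 0\<close> by (simp add: p_def)
    next
      case (Suc r)
      have "\<bar>\<delta> (p (Suc r)) - \<delta> (p r)\<bar> \<le> t / real n * (K (p r) - K (p (Suc r)))"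
        using step[of "p r" "p (Suc r)"] p[of r] p1[OF Suc.prems] t by simp
      moreover have "\<bar>\<delta> (p r)\<bar> \<le> t / real n * (K 0 - K (p r))" using Suc by simp
      ultimately show ?case unfolding right_diff_distrib by linarith
    qed
    from this[of n] have "\<bar>\<delta> t\<bar> \<le> t / real n * (K 0 - K t)"
      using that by (simp add: p_def)
    also have "\<dots> \<le> t / real n * 1"
      using Kb[of 0] Kb[of t] t by (intro mult_left_mono) auto
    finally show ?thesis by simp
  qed
  have "\<delta> t = 0"
  proof (cases "t = 0")
    case False
    have "(\<lambda>n. t / real (Suc n)) \<longlonglongrightarrow> 0"
      using LIMSEQ_Suc[OF lim_const_over_n[of t]] by simp
    then have "\<bar>\<delta> t\<bar> \<le> 0"
      using bound[of "Suc n" for n] False t by (intro LIMSEQ_le_const) auto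
    then show ?thesis by simp
  qed (use \<open>\<delta> 0 = 0\<close> in simp)
  then show ?thesis by (simp add: \<delta>_def K_def)
qed

end

section \<open>The distributional transform\<close>

text \<open>
  The distributional transform: the randomisation \<open>w\<close> spreads the atom at \<open>x\<close> uniformly over the
  jump of the distribution function, which makes the transformed variable exactly uniform.
\<close>

definition dist_transform :: "real measure \<Rightarrow> real \<Rightarrow> real \<Rightarrow> real" where
  "dist_transform \<mu> x w = measure \<mu> {..<x} + w * (cdf \<mu> x - measure \<mu> {..<x})"

context real_distribution
begin

lemma measure_lessThan_le_cdf: "measure M {..<x} \<le> cdf M x"
  unfolding cdf_def by (rule finite_measure_mono) auto

lemma cdf_le_measure_lessThan: "x < y \<Longrightarrow> cdf M x \<le> measure M {..<y}"
  unfolding cdf_def by (rule finite_measure_mono) auto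

lemma dist_transform_le: "w \<le> 1 \<Longrightarrow> dist_transform M x w \<le> cdf M x"
  using mult_right_mono[of w 1 "cdf M x - measure M {..<x}"] measure_lessThan_le_cdf[of x]
  by (simp add: dist_transform_def)

lemma dist_transform_ge: "0 \<le> w \<Longrightarrow> measure M {..<x} \<le> dist_transform M x w"
  using measure_lessThan_le_cdf[of x] by (simp add: dist_transform_def)

lemma dist_transform_mono:
  "0 \<le> w \<Longrightarrow> w \<le> 1 \<Longrightarrow> x \<le> y \<Longrightarrow> dist_transform M x w \<le> dist_transform M y w"
  using dist_transform_le[of w x] dist_transform_ge[of w y] cdf_le_measure_lessThan[of x y]
  by (cases "x = y") auto

lemma lessThan_borel [measurable]: "(\<lambda>x. measure M {..<x}) \<in> borel_measurable borel"
  by (rule borel_measurable_mono) (auto simp: mono_def intro!: finite_measure_mono)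

lemma cdf_borel [measurable]: "cdf M \<in> borel_measurable borel"
  by (rule borel_measurable_mono) (auto simp: mono_def cdf_nondecreasing)

lemma dist_transform_borel [measurable]:
  "(\<lambda>(x, w). dist_transform M x w) \<in> borel_measurable (borel \<Otimes>\<^sub>M borel)"
  unfolding dist_transform_def by measurable

sublocale pu: pair_prob_space M unif ..

lemma dist_transform_borel' [measurable]:
  "(\<lambda>z. dist_transform M (fst z) (snd z)) \<in> borel_measurable (M \<Otimes>\<^sub>M unif)"
  using dist_transform_borel by (simp add: case_prod_beta cong: measurable_cong_sets)

text \<open>Let \<open>x\<close> be the quantile of level \<open>t\<close>. The points to the left
  of \<open>x\<close>, together with the part \<open>w \<le> s\<close> of the fibre over
  \<open>x\<close>, have mass exactly \<open>t\<close> and lie in the sublevel set; what lies on the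
  other side has mass \<open>1 - t\<close> and lies in the superlevel set. Two inequalities suffice,
  so flat stretches of the distribution function need no separate treatment.\<close>

lemma dist_transform_bounds:
  assumes t: "0 < t" "t < 1"
  shows "t \<le> measure (M \<Otimes>\<^sub>M unif) {z. dist_transform M (fst z) (snd z) \<le> t}" (is "_ \<le> measure _ ?A")
    and "1 - t \<le> measure (M \<Otimes>\<^sub>M unif) {z. t \<le> dist_transform M (fst z) (snd z)}" (is "_ \<le> measure _ ?B")
proof -
  interpret c: cdf_distribution M ..
  define x where "x = c.I t"
  have x_iff: "t \<le> cdf M y \<longleftrightarrow> x \<le> y" for y
    unfolding x_def using t by (rule c.pseudoinverse)
  define F where "F = cdf M x"
  define G where "G = measure M {..<x}"
  have "t \<le> F" using x_iff[of x] by (simp add: F_def)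
  have "G \<le> t"
  proof -
    have "(\<lambda>n. cdf M (x - 1 / real (Suc n))) \<longlonglongrightarrow> G"
    proof -
      have "(\<lambda>n. measure M {..x - 1 / real (Suc n)}) \<longlonglongrightarrow> measure M (\<Union>n. {..x - 1 / real (Suc n)})"
        by (intro finite_Lim_measure_incseq) (auto simp: incseq_def frac_le)
      moreover have "(\<Union>n. {..x - 1 / real (Suc n)}) = {..<x}"
      proof safe
        fix y assume "y < x"
        then obtain n where "1 / real (Suc n) < x - y" using nat_approx_posE[of "x - y"] by auto
        then show "y \<in> (\<Union>n. {..x - 1 / real (Suc n)})" by (auto intro!: exI[of _ n])
      next
        fix y n assume "y \<le> x - 1 / real (Suc n)"
        moreover have "1 / real (Suc n) > 0" by simp
        ultimately show "y < x" by linarith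
      qed
      ultimately show ?thesis by (simp add: cdf_def G_def)
    qed
    moreover have "cdf M (x - 1 / real (Suc n)) \<le> t" for n
      using x_iff[of "x - 1 / real (Suc n)"] by (simp add: not_le[symmetric])
    ultimately show ?thesis by (intro LIMSEQ_le_const2) auto
  qed
  define D where "D = F - G"
  have D0: "0 \<le> D" using \<open>t \<le> F\<close> \<open>G \<le> t\<close> by (simp add: D_def)
  have mx: "measure M {x} = D"
  proof -
    have "{x} = {..x} - {..<x}" by auto
    then show ?thesis
      unfolding D_def F_def G_def cdf_def by (simp add: finite_measure_Diff subset_eq)
  qed
  \<comment> \<open>\<open>s\<close> is chosen so that the transform at \<open>(x, s)\<close> equals
    \<open>t\<close>. Without a jump at \<open>x\<close> one has \<open>G = t\<close> already, and 0
    does.\<close>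
  define s where "s = (if D = 0 then 0 else (t - G) / D)"
  have s: "0 \<le> s" "s \<le> 1" "s * D = t - G"
    using \<open>t \<le> F\<close> \<open>G \<le> t\<close> D0 by (auto simp: s_def D_def divide_le_eq)
  have prod: "measure (M \<Otimes>\<^sub>M unif) (A \<times> B) = measure M A * measure unif B"
    if "A \<in> sets borel" "B \<in> sets borel" for A B
    using that unif.emeasure_pair_measure_Times[of A M B]
    by (simp add: measure_def enn2real_mult)
  have mA: "?A \<in> sets (M \<Otimes>\<^sub>M unif)" "?B \<in> sets (M \<Otimes>\<^sub>M unif)"
    using measurable_sets[OF dist_transform_borel', of "{..t}"] measurable_sets[OF dist_transform_borel', of "{t..}"]
    by (auto simp: vimage_def space_pair_measure)
  have msets: "A \<times> B \<in> sets (M \<Otimes>\<^sub>M unif)" if "A \<in> sets borel" "B \<in> sets borel" for A B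
    using that by (intro pair_measureI) auto
  have "t = measure (M \<Otimes>\<^sub>M unif) ({..<x} \<times> {..1}) + measure (M \<Otimes>\<^sub>M unif) ({x} \<times> {..s})"
    using s by (simp add: prod mx measure_unif_atMost G_def[symmetric] algebra_simps)
  also have "\<dots> = measure (M \<Otimes>\<^sub>M unif) ({..<x} \<times> {..1} \<union> {x} \<times> {..s})"
    by (rule pu.P.finite_measure_Union[symmetric]) (auto intro!: msets)
  also have "\<dots> \<le> measure (M \<Otimes>\<^sub>M unif) ?A"
  proof (rule pu.P.finite_measure_mono[OF _ mA(1)])
    have "dist_transform M y w \<le> t" if "y < x" "w \<le> 1" for y w
      using dist_transform_le[OF that(2), of y] x_iff[of y] that(1) by auto
    moreover have "dist_transform M x w \<le> t" if "w \<le> s" for w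
      using mult_right_mono[OF that D0] s(3) unfolding dist_transform_def F_def[symmetric] G_def[symmetric] D_def[symmetric] by simp
    ultimately show "{..<x} \<times> {..1} \<union> {x} \<times> {..s} \<subseteq> ?A" by auto
  qed
  finally show "t \<le> measure (M \<Otimes>\<^sub>M unif) ?A" .
  have Mx: "measure M {x<..} = 1 - F"
  proof -
    have "{x<..} = UNIV - {..x}" by auto
    then show ?thesis unfolding F_def cdf_def using prob_compl[of "{..x}"] by simp
  qed
  have "1 - t = measure (M \<Otimes>\<^sub>M unif) ({x<..} \<times> {0..}) + measure (M \<Otimes>\<^sub>M unif) ({x} \<times> {s..})"
  proof -
    have "D * s = t - G" using s(3) by (simp only: mult.commute)
    then have "D * (1 - s) = F - t" using D_def unfolding right_diff_distrib by linarith
    then show ?thesis using s Mx by (simp add: prod mx measure_unif_atLeast)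
  qed
  also have "\<dots> = measure (M \<Otimes>\<^sub>M unif) ({x<..} \<times> {0..} \<union> {x} \<times> {s..})"
    by (rule pu.P.finite_measure_Union[symmetric]) (auto intro!: msets)
  also have "\<dots> \<le> measure (M \<Otimes>\<^sub>M unif) ?B"
  proof (rule pu.P.finite_measure_mono[OF _ mA(2)])
    have "t \<le> dist_transform M y w" if "x < y" "0 \<le> w" for y w
      using dist_transform_ge[OF that(2), of y] cdf_le_measure_lessThan[OF that(1)] \<open>t \<le> F\<close> unfolding F_def by linarith
    moreover have "t \<le> dist_transform M x w" if "s \<le> w" for w
      using mult_right_mono[OF that D0] s(3) unfolding dist_transform_def F_def[symmetric] G_def[symmetric] D_def[symmetric] by simp
    ultimately show "{x<..} \<times> {0..} \<union> {x} \<times> {s..} \<subseteq> ?B" by auto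
  qed
  finally show "1 - t \<le> measure (M \<Otimes>\<^sub>M unif) ?B" .
qed

text \<open>The two bounds say P(T < t) <= t <= P(T <= t) for \<open>t\<close> in (0, 1). Applying
  the first one to levels decreasing to \<open>t\<close> turns it into P(T <= t) <= t; the endpoints
  follow by monotonicity.\<close>

lemma dist_transform_unif: "distr (M \<Otimes>\<^sub>M unif) borel (\<lambda>z. dist_transform M (fst z) (snd z)) = unif" (is "?D = _")
proof -
  interpret D: real_distribution ?D
    by (intro real_distribution.intro pu.P.prob_space_distr real_distribution_axioms.intro) auto
  interpret un: real_distribution unif by unfold_locales auto
  have sp: "space (M \<Otimes>\<^sub>M unif) = UNIV" by (simp add: space_pair_measure)
  have A: "measure ?D {..t} = measure (M \<Otimes>\<^sub>M unif) {z. dist_transform M (fst z) (snd z) \<le> t}"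
    and B: "measure ?D {t..} = measure (M \<Otimes>\<^sub>M unif) {z. t \<le> dist_transform M (fst z) (snd z)}" for t
    by (subst measure_distr; auto simp: sp vimage_def)+
  have lb: "t \<le> measure ?D {..t}" and ub: "measure ?D {..<t} \<le> t" if "0 < t" "t < 1" for t
  proof -
    show "t \<le> measure ?D {..t}" unfolding A by (rule dist_transform_bounds[OF that])
    have "measure ?D {..<t} = 1 - measure ?D {t..}"
      using D.prob_compl[of "{t..}"] by (simp add: Compl_eq_Diff_UNIV[symmetric])
    then show "measure ?D {..<t} \<le> t" using dist_transform_bounds(2)[OF that] unfolding B by simp
  qed
  have ub': "measure ?D {..t} \<le> t" if "0 \<le> t" "t < 1" for t
  proof (rule dense_ge_bounded[OF that(2)])
    fix s assume "t < s" "s < 1"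
    then have "measure ?D {..t} \<le> measure ?D {..<s}" by (intro D.finite_measure_mono) auto
    also have "\<dots> \<le> s" using ub[of s] \<open>t < s\<close> \<open>s < 1\<close> that by simp
    finally show "measure ?D {..t} \<le> s" .
  qed
  have "cdf ?D t = cdf unif t" for t
  proof -
    consider "t < 0" | "t = 0" | "0 < t" "t < 1" | "1 \<le> t" by linarith
    then show ?thesis
    proof cases
      case 1
      have "measure unif {..t} \<le> measure unif {..0}" "measure ?D {..t} \<le> measure ?D {..0}"
        using 1 by (auto intro!: unif.finite_measure_mono D.finite_measure_mono)
      then show ?thesis using ub'[of 0] measure_unif_atMost[of 0] unfolding cdf_def
        by (simp add: measure_le_0_iff)
    next
      case 2
      then show ?thesis using ub'[of 0] measure_unif_atMost[of 0] unfolding cdf_def by (simp add: measure_le_0_iff)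
    next
      case 3
      then show ?thesis using ub'[of t] lb[of t] measure_unif_atMost[of t] unfolding cdf_def by simp
    next
      case 4
      have "1 \<le> measure ?D {..t}"
      proof (rule dense_le_bounded[of 0])
        fix s :: real assume "0 < s" "s < 1"
        then have "s \<le> measure ?D {..s}" using lb by simp
        also have "\<dots> \<le> measure ?D {..t}" using \<open>s < 1\<close> 4 by (intro D.finite_measure_mono) auto
        finally show "s \<le> measure ?D {..t}" .
      qed simp
      moreover have "measure unif {..1} \<le> measure unif {..t}" using 4 by (intro unif.finite_measure_mono) auto
      ultimately show ?thesis using measure_unif_atMost[of 1] D.prob_le_1[of "{..t}"] unif.prob_le_1[of "{..t}"]
        unfolding cdf_def by simp
    qed
  qed
  then show ?thesis
    using cdf_unique[OF D.real_distribution_axioms un.real_distribution_axioms] by (auto simp: fun_eq_iff)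
qed

text \<open>The events that the point is at most \<open>a\<close> and that its transform is at most
  \<open>cdf M a\<close> can differ only where the transform equals \<open>cdf M a\<close>, a single
  value that the uniform law does not charge.\<close>

lemma integral_dist_transform:
  assumes [measurable]: "k \<in> borel_measurable borel" and kb: "\<And>u. \<bar>k u\<bar> \<le> (1 :: real)"
  shows "(\<integral>z. indicator {..a} (fst z) * k (dist_transform M (fst z) (snd z)) \<partial>(M \<Otimes>\<^sub>M unif))
    = (\<integral>u. indicator {..cdf M a} u * k u \<partial>unif)"
proof -
  let ?T = "\<lambda>z. dist_transform M (fst z) (snd z)"
  have "AE u in unif. u \<noteq> cdf M a"
  proof -
    have "emeasure unif {cdf M a} = 0"
      by (simp add: emeasure_unif emeasure_lborel_singleton Int_insert_right)
    then have "{cdf M a} \<in> null_sets unif" by auto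
    from AE_not_in[OF this] show ?thesis by simp
  qed
  then have "AE u in distr (M \<Otimes>\<^sub>M unif) borel ?T. u \<noteq> cdf M a"
    by (simp only: dist_transform_unif)
  then have "AE z in M \<Otimes>\<^sub>M unif. ?T z \<noteq> cdf M a"
    by (subst (asm) AE_distr_iff) auto
  moreover have "AE z in M \<Otimes>\<^sub>M unif. 0 \<le> snd z \<and> snd z \<le> 1"
  proof -
    have "{z \<in> space (M \<Otimes>\<^sub>M unif). 0 \<le> snd z \<and> snd z \<le> 1} \<in> sets (M \<Otimes>\<^sub>M unif)"
      by measurable
    moreover have "AE x in M. AE w in unif. 0 \<le> w \<and> w \<le> 1" using AE_unif by simp
    ultimately show ?thesis by (intro pu.AE_pair_measure) auto
  qed
  ultimately have "AE z in M \<Otimes>\<^sub>M unif. indicator {..a} (fst z) * k (?T z) = indicator {..cdf M a} (?T z) * k (?T z)"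
  proof eventually_elim
    case (elim z)
    have "fst z \<le> a \<longleftrightarrow> ?T z \<le> cdf M a"
    proof
      assume "fst z \<le> a"
      then have "cdf M (fst z) \<le> cdf M a" by (rule cdf_nondecreasing)
      then show "?T z \<le> cdf M a" using dist_transform_le[of "snd z" "fst z"] elim by simp
    next
      assume "?T z \<le> cdf M a"
      then show "fst z \<le> a"
        using dist_transform_ge[of "snd z" "fst z"] elim cdf_le_measure_lessThan[of a "fst z"] by force
    qed
    then show ?case by (simp add: indicator_def)
  qed
  then have "(\<integral>z. indicator {..a} (fst z) * k (?T z) \<partial>(M \<Otimes>\<^sub>M unif))
      = (\<integral>z. indicator {..cdf M a} (?T z) * k (?T z) \<partial>(M \<Otimes>\<^sub>M unif))"
    by (intro integral_cong_AE) auto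
  also have "\<dots> = (\<integral>u. indicator {..cdf M a} u * k u \<partial>distr (M \<Otimes>\<^sub>M unif) borel ?T)"
    by (subst integral_distr) auto
  also have "\<dots> = (\<integral>u. indicator {..cdf M a} u * k u \<partial>unif)"
    by (simp only: dist_transform_unif)
  finally show ?thesis .
qed

end

section \<open>Monotone quantile kernels\<close>

lemma prob_eq_of_cdf2:
  fixes P Q :: "(real \<times> real) measure"
  assumes "prob_space P" "prob_space Q" and sets: "sets P = sets borel" "sets Q = sets borel"
    and eq: "\<And>x y. measure P ({..x} \<times> {..y}) = measure Q ({..x} \<times> {..y})"
  shows "P = Q"
proof -
  interpret P: prob_space P by fact
  interpret Q: prob_space Q by fact
  have Times: "{..z} = {..fst z} \<times> {..snd z}" for z :: "real \<times> real"
    by (auto simp: less_eq_prod_def)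
  show ?thesis
  proof (rule measure_eqI_generator_eq[where \<Omega> = UNIV and E = "range (\<lambda>a :: real \<times> real. {..a})"
        and A = "\<lambda>n. {..(real n, real n)}"])
    show "Int_stable (range (\<lambda>a :: real \<times> real. {..a}))"
    proof (rule Int_stableI)
      fix A B :: "(real \<times> real) set" assume "A \<in> range (\<lambda>a. {..a})" "B \<in> range (\<lambda>a. {..a})"
      then obtain a b where "A = {..a}" "B = {..b}" by auto
      then have "A \<inter> B = {..(min (fst a) (fst b), min (snd a) (snd b))}"
        by (auto simp: less_eq_prod_def)
      then show "A \<inter> B \<in> range (\<lambda>a. {..a})" by blast
    qed
    fix X assume "X \<in> range (\<lambda>a :: real \<times> real. {..a})"
    then obtain a where "X = {..a}" by auto
    then show "emeasure P X = emeasure Q X"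
      using eq[of "fst a" "snd a"] unfolding P.emeasure_eq_measure Q.emeasure_eq_measure by (simp only: Times)
  next
    show "sets P = sigma_sets UNIV (range (\<lambda>a. {..a}))" "sets Q = sigma_sets UNIV (range (\<lambda>a. {..a}))"
      unfolding sets by (simp_all add: borel_eq_atMost)
    show "(\<Union>n. {..(real n, real n)}) = UNIV"
    proof (intro equalityI subsetI)
      fix z :: "real \<times> real"
      obtain n :: nat where "\<bar>fst z\<bar> + \<bar>snd z\<bar> \<le> real n" using real_arch_simple by blast
      then have "z \<le> (real n, real n)" by (auto simp: less_eq_prod_def)
      then show "z \<in> (\<Union>n. {..(real n, real n)})" by auto
    qed simp
  qed auto
qed

text \<open>A Markov kernel, realised by a quantile function that is monotone in the conditioning variable.\<close>

definition mono_kernel :: "(real \<times> real) measure \<Rightarrow> (real \<Rightarrow> real \<Rightarrow> real) \<Rightarrow> bool" where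
  "mono_kernel \<nu> q \<longleftrightarrow>
     (\<lambda>(x, u). q x u) \<in> borel_measurable (borel \<Otimes>\<^sub>M borel) \<and>
     (\<forall>x x' u. x \<le> x' \<longrightarrow> q x u \<le> q x' u) \<and> (\<forall>x u u'. u \<le> u' \<longrightarrow> q x u \<le> q x u') \<and>
     \<nu> = distr (distr \<nu> borel fst \<Otimes>\<^sub>M unif) borel (\<lambda>(x, u). (x, q x u))"

text \<open>Averaging \<open>copula_kernel\<close> over the randomised value of the first coordinate
  gives \<open>KX x y\<close>, the conditional probability of a second coordinate at most
  \<open>y\<close>. It decreases in \<open>x\<close>, because the transform increases and the copula
  kernel decreases in its conditioning argument; hence its generalised inverse \<open>q\<close> in
  \<open>y\<close> increases in \<open>x\<close>.\<close>

lemma ex_mono_kernel: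
  fixes \<nu> :: "(real \<times> real) measure"
  assumes "prob_space \<nu>" and sets[simp, measurable_cong]: "sets \<nu> = sets borel"
    and C: "copula C" and conc: "concave_in_fst C"
    and joint: "\<And>x y. measure \<nu> ({..x} \<times> {..y}) = C (cdf (distr \<nu> borel fst) x) (cdf (distr \<nu> borel snd) y)"
    and bnd: "\<And>y. y < - 2 \<Longrightarrow> cdf (distr \<nu> borel snd) y = 0" "cdf (distr \<nu> borel snd) 2 = 1"
  shows "\<exists>q. mono_kernel \<nu> q"
proof -
  interpret \<nu>: prob_space \<nu> by fact
  define \<mu> where "\<mu> = distr \<nu> borel fst"
  define G where "G = cdf (distr \<nu> borel snd)"
  interpret \<mu>: real_distribution \<mu>
    unfolding \<mu>_def by (intro real_distribution.intro \<nu>.prob_space_distr real_distribution_axioms.intro) auto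
  interpret snd: real_distribution "distr \<nu> borel snd"
    by (intro real_distribution.intro \<nu>.prob_space_distr real_distribution_axioms.intro) auto
  have G01: "G y \<in> {0..1}" for y
    unfolding G_def using snd.cdf_nonneg snd.cdf_bounded_prob by auto
  have Gmono: "y \<le> y' \<Longrightarrow> G y \<le> G y'" for y y' unfolding G_def by (rule snd.cdf_nondecreasing)
  have F01: "0 \<le> cdf \<mu> x" "cdf \<mu> x \<le> 1" for x
    using \<mu>.cdf_nonneg \<mu>.cdf_bounded_prob by auto
  define k where "k y u = copula_kernel C u (G y)" for y u
  have [measurable]: "k y \<in> borel_measurable borel" for y
    unfolding k_def by (rule copula_kernel_borel[OF C G01])
  have kb: "0 \<le> k y u" "k y u \<le> 1" for y u
    unfolding k_def using copula_kernel_bounds[OF C G01] by auto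
  define KX where "KX x y = (\<integral>w. k y (dist_transform \<mu> x w) \<partial>unif)" for x y
  have [measurable]: "(\<lambda>z. k y (dist_transform \<mu> (fst z) (snd z))) \<in> borel_measurable (\<mu> \<Otimes>\<^sub>M unif)" for y
    by measurable
  have T_borel: "dist_transform \<mu> x \<in> borel_measurable borel" for x
    unfolding dist_transform_def by measurable
  note [measurable] = T_borel
  have intk: "integrable unif (\<lambda>w. k y (dist_transform \<mu> x w))" for x y
    using kb by (intro unif.integrable_const_bound[of _ 1]) auto
  have KX_bounds: "0 \<le> KX x y" "KX x y \<le> 1" for x y
  proof -
    show "0 \<le> KX x y" unfolding KX_def using kb by simp
    have "KX x y \<le> (\<integral>w. 1 \<partial>unif)" unfolding KX_def by (intro integral_mono intk) (auto simp: kb)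
    then show "KX x y \<le> 1" using unif.prob_space by simp
  qed
  have KX_anti: "KX x' y \<le> KX x y" if "x \<le> x'" for x x' y
    unfolding KX_def
  proof (rule integral_mono_AE[OF intk intk])
    show "AE w in unif. k y (dist_transform \<mu> x' w) \<le> k y (dist_transform \<mu> x w)"
      using AE_unif
    proof eventually_elim
      case (elim w)
      then show ?case unfolding k_def
        by (intro copula_kernel_antimono[OF C G01] \<mu>.dist_transform_mono) (use that in auto)
    qed
  qed
  have KX_mono: "KX x y \<le> KX x y'" if "y \<le> y'" for x y y'
    unfolding KX_def
    by (intro integral_mono intk) (auto simp: k_def intro!: copula_kernel_mono[OF C G01 G01] Gmono that)
  have KX_2: "KX x 2 = 1" for x
    using bnd(2) unif.prob_space by (simp add: KX_def k_def G_def[symmetric] copula_kernel_1[OF C])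
  have KX_borel [measurable]: "(\<lambda>x. KX x y) \<in> borel_measurable borel" for y
  proof -
    have "(\<lambda>x. - KX x y) \<in> borel_measurable borel"
      using KX_anti by (intro borel_measurable_mono) (auto simp: mono_def)
    from borel_measurable_uminus[OF this] show ?thesis by simp
  qed
  have int_KX: "(\<integral>x. indicator {..a} x * KX x y \<partial>\<mu>) = C (cdf \<mu> a) (G y)" for a y
  proof -
    have "(\<integral>x. indicator {..a} x * KX x y \<partial>\<mu>)
        = (\<integral>x. (\<integral>w. indicator {..a} x * k y (dist_transform \<mu> x w) \<partial>unif) \<partial>\<mu>)"
      unfolding KX_def by simp
    also have "\<dots> = (\<integral>z. indicator {..a} (fst z) * k y (dist_transform \<mu> (fst z) (snd z)) \<partial>(\<mu> \<Otimes>\<^sub>M unif))"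
      by (subst \<mu>.pu.integral_fst'[symmetric])
         (auto intro!: \<mu>.pu.P.integrable_const_bound[of _ 1] simp: kb indicator_def case_prod_beta)
    also have "\<dots> = (\<integral>u. indicator {..cdf \<mu> a} u * k y u \<partial>unif)"
      by (rule \<mu>.integral_dist_transform) (auto simp: kb)
    also have "\<dots> = C (cdf \<mu> a) (G y)"
      unfolding k_def by (rule integral_copula_kernel[OF C conc G01 F01])
    finally show ?thesis .
  qed
  \<comment> \<open>The adjoined 2 keeps the set nonempty for \<open>u > 1\<close>, and the
    restriction to \<open>[-2, 2]\<close> bounds it below for \<open>u \<le> 0\<close>, so
    \<open>q\<close> is a real-valued function on the whole plane.\<close>
  define S where "S x u = insert 2 {y \<in> {-2..2}. u \<le> KX x y}" for x u
  define q where "q x u = Inf (S x u)" for x u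
  have Sb: "bdd_below (S x u)" for x u unfolding S_def by (intro bdd_belowI[of _ "-2"]) auto
  have Sn: "S x u \<noteq> {}" for x u unfolding S_def by auto
  have q_low: "- 2 \<le> q x u" for x u
    unfolding q_def by (rule cInf_greatest[OF Sn]) (auto simp: S_def)
  have q_le: "q x u \<le> y" if "y \<in> S x u" for x u y
    unfolding q_def by (rule cInf_lower[OF that Sb])
  have q_mono1: "q x u \<le> q x' u" if "x \<le> x'" for x x' u
    unfolding q_def using KX_anti[OF that] by (intro cInf_superset_mono Sn Sb) (auto simp: S_def intro: order_trans)
  have q_mono2: "q x u \<le> q x u'" if "u \<le> u'" for x u u'
    unfolding q_def using that by (intro cInf_superset_mono Sn Sb) (auto simp: S_def)
  \<comment> \<open>Rational witnesses turn the strict sublevel sets into countable unions, which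
    gives joint measurability of \<open>q\<close> although \<open>KX\<close> is known to be
    measurable only for each fixed \<open>y\<close>.\<close>
  have q_less: "q x u < y \<longleftrightarrow> (\<exists>r\<in>\<rat>. r < y \<and> (2 \<le> r \<or> (- 2 \<le> r \<and> u \<le> KX x r)))" for x u y
  proof
    assume "q x u < y"
    then obtain s where s: "s \<in> S x u" "s < y"
      unfolding q_def using cInf_less_iff[OF Sn Sb] by blast
    obtain r where r: "r \<in> \<rat>" "s < r" "r < y" using Rats_dense_in_real[OF s(2)] by auto
    have "2 \<le> r \<or> (- 2 \<le> r \<and> u \<le> KX x r)"
      using s r KX_mono[of s r x] unfolding S_def by auto
    then show "\<exists>r\<in>\<rat>. r < y \<and> (2 \<le> r \<or> (- 2 \<le> r \<and> u \<le> KX x r))" using r by auto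
  next
    assume "\<exists>r\<in>\<rat>. r < y \<and> (2 \<le> r \<or> (- 2 \<le> r \<and> u \<le> KX x r))"
    then obtain r where r: "r < y" "2 \<le> r \<or> (- 2 \<le> r \<and> u \<le> KX x r)" by auto
    then have "min r 2 \<in> S x u" by (auto simp: S_def min_def)
    from q_le[OF this] show "q x u < y" using r by auto
  qed
  have q_borel [measurable]: "(\<lambda>(x, u). q x u) \<in> borel_measurable (borel \<Otimes>\<^sub>M borel)"
  proof (rule borel_measurableI_less)
    fix y :: real
    have "{w \<in> space (borel \<Otimes>\<^sub>M borel). (case w of (x, u) \<Rightarrow> q x u) < y}
      = (\<Union>r\<in>\<rat> \<inter> {..<y}. {w \<in> space (borel \<Otimes>\<^sub>M borel). 2 \<le> r \<or> (- 2 \<le> r \<and> snd w \<le> KX (fst w) r)})"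
      by (auto simp: q_less)
    also have "\<dots> \<in> sets (borel \<Otimes>\<^sub>M borel)"
      by (intro sets.countable_UN' countable_subset[OF _ countable_rat]) (auto, measurable)
    finally show "{w \<in> space (borel \<Otimes>\<^sub>M borel). (case w of (x, u) \<Rightarrow> q x u) < y} \<in> sets (borel \<Otimes>\<^sub>M borel)" .
  qed
  have pair_borel [measurable]: "(\<lambda>(x, u). (x, q x u)) \<in> \<mu> \<Otimes>\<^sub>M unif \<rightarrow>\<^sub>M borel"
    unfolding borel_prod[symmetric] by measurable
  have sp: "space (\<mu> \<Otimes>\<^sub>M unif) = UNIV" by (simp add: space_pair_measure)
  have meas_K: "measure (\<mu> \<Otimes>\<^sub>M unif) {z. fst z \<le> a \<and> snd z \<le> KX (fst z) y} = C (cdf \<mu> a) (G y)" for a y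
  proof -
    let ?A = "{z. fst z \<le> a \<and> snd z \<le> KX (fst z) y}"
    have "{z \<in> space (\<mu> \<Otimes>\<^sub>M unif). fst z \<le> a \<and> snd z \<le> KX (fst z) y} \<in> sets (\<mu> \<Otimes>\<^sub>M unif)"
      by measurable
    then have A: "?A \<in> sets (\<mu> \<Otimes>\<^sub>M unif)" by (simp add: sp)
    have "emeasure (\<mu> \<Otimes>\<^sub>M unif) ?A = (\<integral>\<^sup>+x. emeasure unif (Pair x -` ?A) \<partial>\<mu>)"
      by (rule unif.emeasure_pair_measure_alt[OF A])
    also have "\<dots> = (\<integral>\<^sup>+x. ennreal (indicator {..a} x * KX x y) \<partial>\<mu>)"
    proof (rule nn_integral_cong)
      fix x
      have "Pair x -` ?A = (if x \<le> a then {..KX x y} else {})" by auto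
      then show "emeasure unif (Pair x -` ?A) = ennreal (indicator {..a} x * KX x y)"
        using KX_bounds measure_unif_atMost by (simp add: unif.emeasure_eq_measure)
    qed
    also have "\<dots> = ennreal (\<integral>x. indicator {..a} x * KX x y \<partial>\<mu>)"
      using KX_bounds by (intro nn_integral_eq_integral \<mu>.integrable_const_bound[of _ 1]) (auto simp: indicator_def)
    also have "\<dots> = ennreal (C (cdf \<mu> a) (G y))" by (simp add: int_KX)
    finally have "measure (\<mu> \<Otimes>\<^sub>M unif) ?A = enn2real (ennreal (C (cdf \<mu> a) (G y)))"
      by (simp add: measure_def)
    moreover have "0 \<le> C (cdf \<mu> a) (G y)"
      unfolding int_KX[symmetric] using KX_bounds by simp
    ultimately show ?thesis by simp
  qed
  have C_v1: "C (cdf \<mu> a) 1 = cdf \<mu> a" and C_v0: "C (cdf \<mu> a) 0 = 0" for a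
    using C F01 by (auto simp: copula_def)
  have m_sets: "{z. fst z \<le> a \<and> q (fst z) (snd z) \<le> y} \<in> sets (\<mu> \<Otimes>\<^sub>M unif)" for a y
  proof -
    have "{z \<in> space (\<mu> \<Otimes>\<^sub>M unif). fst z \<le> a \<and> (case z of (x, u) \<Rightarrow> q x u) \<le> y} \<in> sets (\<mu> \<Otimes>\<^sub>M unif)"
      by measurable
    then show ?thesis by (simp add: sp case_prod_beta)
  qed
  have K_sets: "{z. fst z \<le> a \<and> snd z \<le> KX (fst z) y} \<in> sets (\<mu> \<Otimes>\<^sub>M unif)" for a y
  proof -
    have "{z \<in> space (\<mu> \<Otimes>\<^sub>M unif). fst z \<le> a \<and> snd z \<le> KX (fst z) y} \<in> sets (\<mu> \<Otimes>\<^sub>M unif)"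
      by measurable
    then show ?thesis by (simp add: sp)
  qed
  have main: "measure (\<mu> \<Otimes>\<^sub>M unif) {z. fst z \<le> a \<and> q (fst z) (snd z) \<le> y} = C (cdf \<mu> a) (G y)" for a y
  proof (cases "y < - 2")
    case True
    have "\<not> q x u \<le> y" for x u using q_low[of x u] True by linarith
    then have e: "{z. fst z \<le> a \<and> q (fst z) (snd z) \<le> y} = {}" by blast
    show ?thesis unfolding e using bnd(1)[OF True] C_v0 by (simp add: G_def)
  next
    case False
    have lower: "C (cdf \<mu> a) (G y) \<le> measure (\<mu> \<Otimes>\<^sub>M unif) {z. fst z \<le> a \<and> q (fst z) (snd z) \<le> y}"
      if "y \<le> 2"
      unfolding meas_K[symmetric]
      by (rule \<mu>.pu.P.finite_measure_mono[OF _ m_sets]) (use False that q_le in \<open>auto simp: S_def\<close>)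
    show ?thesis
    proof (cases "y < 2")
      case True
      \<comment> \<open>\<open>KX\<close> need not be right continuous in \<open>y\<close>, so
        \<open>q x u \<le> y\<close> only yields \<open>u \<le> KX x y'\<close> for
        \<open>y' > y\<close>. Right continuity of \<open>G\<close> and the Lipschitz bound of
        \<open>C\<close> absorb the difference.\<close>
      have "measure (\<mu> \<Otimes>\<^sub>M unif) {z. fst z \<le> a \<and> q (fst z) (snd z) \<le> y} \<le> C (cdf \<mu> a) (G y + e)" 
        if "0 < e" "G y + e \<le> 1" for e
      proof -
        have "\<exists>y'. y < y' \<and> y' < 2 \<and> G y' \<le> G y + e"
        proof -
          have "continuous (at_right y) G" unfolding G_def by (rule snd.cdf_is_right_cont)
          then have "\<forall>\<^sub>F t in at_right y. G t < G y + e"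
            using that by (intro order_tendstoD(2)[of G "G y"]) (auto simp: continuous_within)
          then obtain b where b: "b > y" "\<And>t. y < t \<Longrightarrow> t < b \<Longrightarrow> G t < G y + e"
            unfolding eventually_at_right_field by auto
          obtain t where "y < t" "t < min b 2" using dense[of y "min b 2"] b(1) True by auto
          then show ?thesis using b(2)[of t] by (intro exI[of _ t]) auto
        qed
        then obtain y' where y': "y < y'" "y' < 2" "G y' \<le> G y + e" by auto
        have "measure (\<mu> \<Otimes>\<^sub>M unif) {z. fst z \<le> a \<and> q (fst z) (snd z) \<le> y} \<le> C (cdf \<mu> a) (G y')"
          unfolding meas_K[symmetric]
        proof (rule \<mu>.pu.P.finite_measure_mono[OF _ K_sets], safe)
          fix x u assume "q (fst (x, u)) (snd (x, u)) \<le> y"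
          then have "q x u < y'" using y' by simp
          then obtain r where "r < y'" "2 \<le> r \<or> (- 2 \<le> r \<and> u \<le> KX x r)" using q_less by auto
          then have "u \<le> KX x r" "r < y'" using y' by auto
          then show "snd (x, u) \<le> KX (fst (x, u)) y'" using KX_mono[of r y' x] by simp
        qed
        also have "\<dots> \<le> C (cdf \<mu> a) (G y + e)"
        proof -
          have "0 \<le> C (cdf \<mu> a) (G y + e) - C (cdf \<mu> a) (G y') - C 0 (G y + e) + C 0 (G y')"
            using C F01 G01[of y'] y' that G01[of y] unfolding copula_def by (meson atLeastAtMost_iff add_nonneg_nonneg less_imp_le order_refl zero_le_one)
          moreover have "C 0 (G y + e) = 0" "C 0 (G y') = 0" using C G01[of y'] G01[of y] that unfolding copula_def by auto
          ultimately show ?thesis by simp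
        qed
        finally show ?thesis .
      qed
      moreover have "C (cdf \<mu> a) (G y + e) \<le> C (cdf \<mu> a) (G y) + e" if "0 < e" "G y + e \<le> 1" for e
      proof -
        have "0 \<le> C 1 (G y + e) - C 1 (G y) - C (cdf \<mu> a) (G y + e) + C (cdf \<mu> a) (G y)"
          using C F01 that G01[of y] unfolding copula_def by (meson atLeastAtMost_iff add_nonneg_nonneg less_imp_le order_refl zero_le_one less_add_same_cancel1)
        moreover have "C 1 (G y + e) = G y + e" "C 1 (G y) = G y" using C G01[of y] that unfolding copula_def by auto
        ultimately show ?thesis by simp
      qed
      ultimately have up: "measure (\<mu> \<Otimes>\<^sub>M unif) {z. fst z \<le> a \<and> q (fst z) (snd z) \<le> y} \<le> C (cdf \<mu> a) (G y) + e"
        if "0 < e" "G y + e \<le> 1" for e using that by (meson order_trans)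
      have "measure (\<mu> \<Otimes>\<^sub>M unif) {z. fst z \<le> a \<and> q (fst z) (snd z) \<le> y} \<le> C (cdf \<mu> a) (G y)"
      proof (cases "G y = 1")
        \<comment> \<open>Here there is no room for a positive \<open>e\<close>, but the mass of the
          whole strip over \<open>{..a}\<close> is already the claimed value.\<close>
        case True
        have "measure (\<mu> \<Otimes>\<^sub>M unif) {z. fst z \<le> a \<and> q (fst z) (snd z) \<le> y} \<le> measure (\<mu> \<Otimes>\<^sub>M unif) ({..a} \<times> UNIV)"
          by (rule \<mu>.pu.P.finite_measure_mono) auto
        also have "\<dots> = cdf \<mu> a"
          using unif.emeasure_pair_measure_Times[of "{..a}" \<mu> UNIV] unif.emeasure_space_1
          by (simp add: measure_def cdf_def)
        finally show ?thesis using True C_v1 by simp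
      next
        case False
        show ?thesis
        proof (rule field_le_epsilon)
          fix e :: real assume "0 < e"
          define d where "d = min e (1 - G y)"
          have d: "0 < d" "G y + d \<le> 1" "d \<le> e" using False G01[of y] \<open>0 < e\<close> by (auto simp: d_def)
          show "measure (\<mu> \<Otimes>\<^sub>M unif) {z. fst z \<le> a \<and> q (fst z) (snd z) \<le> y} \<le> C (cdf \<mu> a) (G y) + e"
            using up[OF d(1,2)] d(3) by linarith
        qed
      qed
      then show ?thesis using lower True by simp
    next
      case False
      have "q x u \<le> y" for x u using q_le[of 2 x u] False by (simp add: S_def)
      then have "{z. fst z \<le> a \<and> q (fst z) (snd z) \<le> y} = {..a} \<times> UNIV" by auto
      moreover have "measure (\<mu> \<Otimes>\<^sub>M unif) ({..a} \<times> UNIV) = cdf \<mu> a"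
        using unif.emeasure_pair_measure_Times[of "{..a}" \<mu> UNIV] unif.emeasure_space_1
        by (simp add: measure_def cdf_def)
      moreover have "G y = 1" using False bnd(2) Gmono[of 2 y] G01[of y] by (simp add: G_def)
      ultimately show ?thesis using C_v1 by simp
    qed
  qed
  have "\<nu> = distr (\<mu> \<Otimes>\<^sub>M unif) borel (\<lambda>(x, u). (x, q x u))"
  proof (rule prob_eq_of_cdf2)
    show "prob_space (distr (\<mu> \<Otimes>\<^sub>M unif) borel (\<lambda>(x, u). (x, q x u)))"
      by (rule \<mu>.pu.P.prob_space_distr) measurable
    show "measure \<nu> ({..x} \<times> {..y}) = measure (distr (\<mu> \<Otimes>\<^sub>M unif) borel (\<lambda>(x, u). (x, q x u))) ({..x} \<times> {..y})" for x y
    proof -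
      have "(\<lambda>(x, u). (x, q x u)) -` ({..x} \<times> {..y}) = {z. fst z \<le> x \<and> q (fst z) (snd z) \<le> y}" by auto
      then show ?thesis
        using main[of x y] joint[of x y] by (subst measure_distr) (auto simp: times_sets_borel sp[unfolded \<mu>_def] \<mu>_def G_def)
    qed
  qed (use assms in auto)
  then show ?thesis
    unfolding mono_kernel_def \<mu>_def[symmetric] using q_mono1 q_mono2 q_borel by blast
qed

section \<open>Adding a leaf to a Markov tree\<close>

lemma subvector_measurable:
  assumes "\<And>n. n \<in> I \<Longrightarrow> X n \<in> borel_measurable M"
  shows "subvector I X \<in> M \<rightarrow>\<^sub>M Pi\<^sub>M I (\<lambda>_. borel)"
  unfolding subvector_def using assms by (rule measurable_restrict)

text \<open>The Markov property concerns disjoint sets separated by \<open>i\<close>, so it is used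
  for \<open>W - {i}\<close> and \<open>{j}\<close>. The constraint on coordinate \<open>i\<close>
  is an event of the conditioning sigma-algebra, over which conditional expectations may be
  integrated. By \<open>kT\<close>, \<open>k (X i \<omega>)\<close> is a version of the conditional
  probability of \<open>X j\<close> lying in \<open>T\<close>.\<close>

lemma cond_indep_box:
  assumes "prob_space M" and fin: "finite W" and iW: "i \<in> W" and jW: "j \<notin> W"
    and X: "\<And>n. n \<in> insert j W \<Longrightarrow> X n \<in> borel_measurable M"
    and ci: "cond_indep_given M X (W - {i}) {j} i"
    and A: "\<And>l. l \<in> W \<Longrightarrow> A l \<in> sets borel" and T: "T \<in> sets borel"
    and k [measurable]: "k \<in> borel_measurable borel" and kb: "\<And>x. 0 \<le> k x \<and> k x \<le> (1 :: real)"
    and kT: "\<And>B. B \<in> sets borel \<Longrightarrow>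
      measure M {\<omega> \<in> space M. X i \<omega> \<in> B \<and> X j \<omega> \<in> T} = (\<integral>\<omega>. indicator B (X i \<omega>) * k (X i \<omega>) \<partial>M)"
  shows "measure M {\<omega> \<in> space M. (\<forall>l\<in>W. X l \<omega> \<in> A l) \<and> X j \<omega> \<in> T}
    = (\<integral>\<omega>. indicator {\<omega> \<in> space M. \<forall>l\<in>W. X l \<omega> \<in> A l} \<omega> * k (X i \<omega>) \<partial>M)"
proof -
  interpret M: prob_space M by fact
  have [measurable]: "X i \<in> borel_measurable M" "X j \<in> borel_measurable M" using X iW by auto
  let ?F = "vimage_algebra (space M) (X i) borel"
  have sub: "subalgebra M ?F"
    unfolding subalgebra_def by (auto simp: sets_vimage_algebra2)
  interpret F: finite_measure_subalgebra M ?F using sub by unfold_locales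
  have Xi_F [measurable]: "X i \<in> ?F \<rightarrow>\<^sub>M borel" by (rule measurable_vimage_algebra1) auto
  note [measurable] = A[OF iW] T
  define G where "G = subvector (W - {i}) X -` (Pi\<^sub>E (W - {i}) A) \<inter> space M"
  define H where "H = subvector {j} X -` (Pi\<^sub>E {j} (\<lambda>_. T)) \<inter> space M"
  have boxG: "Pi\<^sub>E (W - {i}) A \<in> sets (Pi\<^sub>M (W - {i}) (\<lambda>_. borel))"
    using A fin by (intro sets_PiM_I_finite) auto
  have boxH: "Pi\<^sub>E {j} (\<lambda>_. T) \<in> sets (Pi\<^sub>M {j} (\<lambda>_. borel))"
    using T by (intro sets_PiM_I_finite) auto
  have [measurable]: "G \<in> sets M"
    unfolding G_def by (rule measurable_sets[OF subvector_measurable boxG]) (use X in auto)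
  have G_eq: "G = {\<omega> \<in> space M. \<forall>l\<in>W - {i}. X l \<omega> \<in> A l}"
    unfolding G_def subvector_def vimage_def by (auto simp only: restrict_PiE_iff)
  have H_eq: "H = {\<omega> \<in> space M. X j \<omega> \<in> T}"
    unfolding H_def subvector_def vimage_def by (auto simp only: restrict_PiE_iff)
  have [measurable]: "H \<in> sets M" unfolding H_eq by measurable
  have ci': "AE \<omega> in M. real_cond_exp M ?F (indicator (G \<inter> H)) \<omega>
      = real_cond_exp M ?F (indicator G) \<omega> * real_cond_exp M ?F (indicator H) \<omega>"
    using ci boxG boxH unfolding cond_indep_given_def cond_prob_given_def G_def H_def Let_def by blast
  have int_ind: "integrable M (indicator B :: _ \<Rightarrow> real)" if "B \<in> sets M" for B
    using that by (intro integrable_real_indicator) (auto simp: M.emeasure_eq_measure)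
  have int_k: "integrable M (\<lambda>\<omega>. k (X i \<omega>))"
    using kb by (intro M.integrable_const_bound[of _ 1]) auto
  have cH: "AE \<omega> in M. real_cond_exp M ?F (indicator H) \<omega> = k (X i \<omega>)"
  proof (rule F.real_cond_exp_charact)
    fix B assume "B \<in> sets ?F"
    then obtain B' where B': "B' \<in> sets borel" "B = X i -` B' \<inter> space M"
      by (auto simp: sets_vimage_algebra2)
    have [measurable]: "B \<in> sets M" unfolding B'(2) using B'(1) by measurable
    have "(\<integral>\<omega>\<in>B. indicator H \<omega> \<partial>M) = (\<integral>\<omega>. indicator (B \<inter> H) \<omega> \<partial>M)"
      unfolding set_lebesgue_integral_def
      by (intro Bochner_Integration.integral_cong) (auto simp: indicator_def)
    also have "\<dots> = measure M (B \<inter> H)" by simp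
    also have "B \<inter> H = {\<omega> \<in> space M. X i \<omega> \<in> B' \<and> X j \<omega> \<in> T}" unfolding B'(2) H_eq by auto
    also have "measure M \<dots> = (\<integral>\<omega>. indicator B' (X i \<omega>) * k (X i \<omega>) \<partial>M)" by (rule kT[OF B'(1)])
    also have "\<dots> = (\<integral>\<omega>\<in>B. k (X i \<omega>) \<partial>M)"
      unfolding set_lebesgue_integral_def B'(2) by (intro Bochner_Integration.integral_cong) (auto simp: indicator_def)
    finally show "(\<integral>\<omega>\<in>B. indicator H \<omega> \<partial>M) = (\<integral>\<omega>\<in>B. k (X i \<omega>) \<partial>M)" .
  qed (auto intro!: int_ind int_k)
  define I where "I = X i -` A i \<inter> space M"
  have I [measurable]: "I \<in> sets ?F" "I \<in> sets M"
    unfolding I_def by (auto intro: in_vimage_algebra)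
  have "measure M {\<omega> \<in> space M. (\<forall>l\<in>W. X l \<omega> \<in> A l) \<and> X j \<omega> \<in> T} = measure M (I \<inter> (G \<inter> H))"
    using iW by (intro arg_cong[of _ _ "measure M"]) (auto simp: I_def G_eq H_eq)
  also have "\<dots> = (\<integral>\<omega>\<in>I. indicator (G \<inter> H) \<omega> \<partial>M)"
  proof -
    have "measure M (I \<inter> (G \<inter> H)) = (\<integral>\<omega>. indicator (I \<inter> (G \<inter> H)) \<omega> \<partial>M)" by simp
    also have "\<dots> = (\<integral>\<omega>\<in>I. indicator (G \<inter> H) \<omega> \<partial>M)"
      unfolding set_lebesgue_integral_def
      by (intro Bochner_Integration.integral_cong) (auto simp: indicator_def)
    finally show ?thesis .
  qed
  also have "\<dots> = (\<integral>\<omega>\<in>I. real_cond_exp M ?F (indicator (G \<inter> H)) \<omega> \<partial>M)"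
    by (rule F.real_cond_exp_intA) (auto intro!: int_ind I)
  also have "\<dots> = (\<integral>\<omega>. (indicator I \<omega> * k (X i \<omega>)) * real_cond_exp M ?F (indicator G) \<omega> \<partial>M)"
    unfolding set_lebesgue_integral_def
    by (intro integral_cong_AE) (use ci' cH in \<open>auto intro: measurable_from_subalg[OF sub]\<close>)
  also have "\<dots> = (\<integral>\<omega>. (indicator I \<omega> * k (X i \<omega>)) * indicator G \<omega> \<partial>M)"
  proof (rule F.real_cond_exp_intg(2))
    show "integrable M (\<lambda>\<omega>. indicator I \<omega> * k (X i \<omega>) * indicator G \<omega>)"
      using kb by (intro M.integrable_const_bound[of _ 1]) (auto simp: indicator_def)
    show "(\<lambda>\<omega>. indicator I \<omega> * k (X i \<omega>)) \<in> borel_measurable ?F"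
      using I(1) Xi_F by (intro borel_measurable_times borel_measurable_indicator measurable_compose[OF _ k])
  qed auto
  also have "\<dots> = (\<integral>\<omega>. indicator {\<omega> \<in> space M. \<forall>l\<in>W. X l \<omega> \<in> A l} \<omega> * k (X i \<omega>) \<partial>M)"
    using iW by (intro Bochner_Integration.integral_cong) (auto simp: I_def G_eq indicator_def)
  finally show ?thesis .
qed

text \<open>
  The law \<open>P'\<close> on the indices \<open>insert j W\<close> extends the law \<open>P\<close> on \<open>W\<close> by a new coordinate \<open>j\<close>
  which, given all the others, depends only on the coordinate \<open>i\<close>, the pair \<open>(i, j)\<close> having law \<open>\<nu>\<close>.
\<close>

definition leaf_extension ::
  "nat set \<Rightarrow> nat \<Rightarrow> nat \<Rightarrow> (real \<times> real) measure \<Rightarrow> (nat \<Rightarrow> real) measure \<Rightarrow> (nat \<Rightarrow> real) measure \<Rightarrow> bool" where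
  "leaf_extension W i j \<nu> P P' \<longleftrightarrow>
     (\<forall>A T k. (\<forall>l\<in>W. A l \<in> sets borel) \<longrightarrow> T \<in> sets borel \<longrightarrow> k \<in> borel_measurable borel \<longrightarrow>
        (\<forall>x. 0 \<le> k x \<and> k x \<le> (1 :: real)) \<longrightarrow>
        (\<forall>B\<in>sets borel. measure \<nu> (B \<times> T) = (\<integral>x. indicator B x * k x \<partial>distr \<nu> borel fst)) \<longrightarrow>
        measure P' (Pi\<^sub>E (insert j W) (A(j := T))) = (\<integral>x. indicator (Pi\<^sub>E W A) x * k (x i) \<partial>P))"

lemma kernel_update_measurable:
  assumes [measurable]: "(\<lambda>(x, u). q x u) \<in> borel_measurable (borel \<Otimes>\<^sub>M borel)" and iW: "i \<in> W"
  shows "(\<lambda>(x, u). x(j := q (x i) u)) \<in> Pi\<^sub>M W (\<lambda>_. borel) \<Otimes>\<^sub>M unif \<rightarrow>\<^sub>M Pi\<^sub>M (insert j W) (\<lambda>_. borel :: real measure)"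
proof -
  have snd_borel: "snd \<in> borel_measurable (Pi\<^sub>M W (\<lambda>_. borel :: real measure) \<Otimes>\<^sub>M unif)"
    using measurable_snd[of "Pi\<^sub>M W (\<lambda>_. borel :: real measure)" unif] by (simp cong: measurable_cong_sets)
  have fst_i_borel: "(\<lambda>w. fst w i) \<in> borel_measurable (Pi\<^sub>M W (\<lambda>_. borel :: real measure) \<Otimes>\<^sub>M unif)"
    by (rule measurable_compose[OF measurable_fst measurable_component_singleton[OF iW]])
  note [measurable] = measurable_Pair[OF fst_i_borel snd_borel]
  have qi: "(\<lambda>w. q (fst w i) (snd w)) \<in> borel_measurable (Pi\<^sub>M W (\<lambda>_. borel) \<Otimes>\<^sub>M unif)"
    using measurable_compose[of "\<lambda>w. (fst w i, snd w)" _ "borel \<Otimes>\<^sub>M borel" "\<lambda>(x, u). q x u" borel] by simp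
  have "(\<lambda>w. (fst w)(j := q (fst w i) (snd w))) \<in> Pi\<^sub>M W (\<lambda>_. borel) \<Otimes>\<^sub>M unif \<rightarrow>\<^sub>M Pi\<^sub>M (insert j W) (\<lambda>_. borel)"
    by (rule measurable_fun_upd[of _ W]) (auto simp: qi)
  then show ?thesis by (simp add: case_prod_beta)
qed

text \<open>The probability \<open>k x\<close> that \<open>q x u\<close> lies in \<open>T\<close>
  meets the condition imposed on \<open>k\<close> in \<open>leaf_extension\<close>, because
  \<open>q\<close> realises \<open>\<nu>\<close>. Hence both laws agree on boxes, which determine a
  law on a finite product.\<close>

lemma leaf_extension_kernel:
  fixes P P' :: "(nat \<Rightarrow> real) measure"
  assumes "prob_space P" "prob_space P'"
    and sets [simp, measurable_cong]: "sets P = sets (Pi\<^sub>M W (\<lambda>_. borel))" "sets P' = sets (Pi\<^sub>M (insert j W) (\<lambda>_. borel))"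
    and fin: "finite W" and iW: "i \<in> W" and jW: "j \<notin> W"
    and "prob_space \<nu>" and [simp, measurable_cong]: "sets \<nu> = sets borel"
    and ext: "leaf_extension W i j \<nu> P P'" and q: "mono_kernel \<nu> q"
  shows "P' = distr (P \<Otimes>\<^sub>M unif) (Pi\<^sub>M (insert j W) (\<lambda>_. borel)) (\<lambda>(x, u). x(j := q (x i) u))"
proof -
  interpret P: prob_space P by fact
  interpret P': prob_space P' by fact
  interpret \<nu>: prob_space \<nu> by fact
  interpret \<mu>: prob_space "distr \<nu> borel fst" by (rule \<nu>.prob_space_distr) auto
  interpret Pu: pair_prob_space P unif ..
  interpret \<mu>u: pair_prob_space "distr \<nu> borel fst" unif ..
  have [measurable]: "(\<lambda>(x, u). q x u) \<in> borel_measurable (borel \<Otimes>\<^sub>M borel)" using q by (simp add: mono_kernel_def)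
  have q': "q x \<in> borel_measurable borel" for x
    using measurable_compose[of "\<lambda>u. (x, u)" borel "borel \<Otimes>\<^sub>M borel" "\<lambda>(x, u). q x u" borel] by simp
  note [measurable] = q'
  have [measurable]: "(\<lambda>x. x l) \<in> borel_measurable P" if "l \<in> W" for l
    using measurable_component_singleton[OF that, of "\<lambda>_. borel"] by (simp cong: measurable_cong_sets)
  have meas: "(\<lambda>(x, u). x(j := q (x i) u)) \<in> P \<Otimes>\<^sub>M unif \<rightarrow>\<^sub>M Pi\<^sub>M (insert j W) (\<lambda>_. borel)"
    using kernel_update_measurable[of q i W j] q iW
    by (simp add: mono_kernel_def cong: measurable_cong_sets)
  let ?R = "distr (P \<Otimes>\<^sub>M unif) (Pi\<^sub>M (insert j W) (\<lambda>_. borel)) (\<lambda>(x, u). x(j := q (x i) u))"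
  interpret R: prob_space ?R by (rule Pu.P.prob_space_distr[OF meas])
  show "P' = ?R"
  proof (rule measure_eqI_PiM_finite[of "insert j W" _ "\<lambda>_. borel" _ "\<lambda>_. Pi\<^sub>E (insert j W) (\<lambda>_. UNIV)"])
    fix A :: "nat \<Rightarrow> real set" assume A: "\<And>l. l \<in> insert j W \<Longrightarrow> A l \<in> sets borel"
    define T where "T = A j"
    have [measurable]: "T \<in> sets borel" using A by (simp add: T_def)
    define k where "k x = measure unif {u. q x u \<in> T}" for x
    have Tsets: "{u. q x u \<in> T} \<in> sets borel" for x
      using measurable_sets[OF q'[of x], of T] by (simp add: vimage_def)
    have k_borel [measurable]: "k \<in> borel_measurable borel"
    proof -
      have "(\<lambda>(x, u). q x u) \<in> borel_measurable (borel \<Otimes>\<^sub>M unif)" by measurable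
      from measurable_sets[OF this \<open>T \<in> sets borel\<close>]
      have "(\<lambda>(x, u). q x u) -` T \<inter> space (borel \<Otimes>\<^sub>M unif) \<in> sets (borel \<Otimes>\<^sub>M unif)" .
      then have "(\<lambda>x. emeasure unif (Pair x -` ((\<lambda>(x, u). q x u) -` T \<inter> space (borel \<Otimes>\<^sub>M unif)))) \<in> borel_measurable borel"
        by (rule unif.measurable_emeasure_Pair)
      then have "(\<lambda>x. emeasure unif {u. q x u \<in> T}) \<in> borel_measurable borel"
        by (simp add: vimage_def space_pair_measure)
      from borel_measurable_enn2real[OF this] show ?thesis unfolding k_def measure_def .
    qed
    have kb: "0 \<le> k x \<and> k x \<le> 1" for x unfolding k_def by simp
    \<comment> \<open>Stated for a general base \<open>Q\<close> because it serves twice: for the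
      pair law, where it shows that \<open>k\<close> is admissible, and for the vector law
      \<open>P\<close>.\<close>
    have nn: "emeasure (Q \<Otimes>\<^sub>M unif) {w \<in> space (Q \<Otimes>\<^sub>M unif). fst w \<in> D \<and> q (g (fst w)) (snd w) \<in> T}
        = ennreal (\<integral>x. indicator D x * k (g x) \<partial>Q)"
      if Q: "prob_space Q" and D: "D \<in> sets Q" and g[measurable]: "g \<in> borel_measurable Q"
      for Q :: "'z measure" and D g
    proof -
      interpret Q: prob_space Q by fact
      have m1: "(\<lambda>w. q (g (fst w)) (snd w)) \<in> borel_measurable (Q \<Otimes>\<^sub>M unif)"
      proof -
        have [measurable]: "(\<lambda>w. (g (fst w), snd w)) \<in> Q \<Otimes>\<^sub>M unif \<rightarrow>\<^sub>M borel \<Otimes>\<^sub>M borel" by measurable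
        show ?thesis using measurable_compose[of "\<lambda>w. (g (fst w), snd w)" _ "borel \<Otimes>\<^sub>M borel" "\<lambda>(x, u). q x u" borel] by simp
      qed
      note [measurable] = m1 D
      have S: "{w \<in> space (Q \<Otimes>\<^sub>M unif). fst w \<in> D \<and> q (g (fst w)) (snd w) \<in> T} \<in> sets (Q \<Otimes>\<^sub>M unif)"
        by measurable
      have "emeasure (Q \<Otimes>\<^sub>M unif) {w \<in> space (Q \<Otimes>\<^sub>M unif). fst w \<in> D \<and> q (g (fst w)) (snd w) \<in> T}
        = (\<integral>\<^sup>+x. emeasure unif (Pair x -` {w \<in> space (Q \<Otimes>\<^sub>M unif). fst w \<in> D \<and> q (g (fst w)) (snd w) \<in> T}) \<partial>Q)"
        by (rule unif.emeasure_pair_measure_alt[OF S])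
      also have "\<dots> = (\<integral>\<^sup>+x. ennreal (indicator D x * k (g x)) \<partial>Q)"
      proof (rule nn_integral_cong)
        fix x assume "x \<in> space Q"
        then have "Pair x -` {w \<in> space (Q \<Otimes>\<^sub>M unif). fst w \<in> D \<and> q (g (fst w)) (snd w) \<in> T}
          = (if x \<in> D then {u. q (g x) u \<in> T} else {})"
          by (auto simp: space_pair_measure)
        then show "emeasure unif (Pair x -` {w \<in> space (Q \<Otimes>\<^sub>M unif). fst w \<in> D \<and> q (g (fst w)) (snd w) \<in> T})
          = ennreal (indicator D x * k (g x))"
          by (simp add: k_def unif.emeasure_eq_measure)
      qed
      also have "\<dots> = ennreal (\<integral>x. indicator D x * k (g x) \<partial>Q)"
        using kb by (intro nn_integral_eq_integral Q.integrable_const_bound[of _ 1]) (auto simp: indicator_def)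
      finally show ?thesis .
    qed
    have kT: "measure \<nu> (B \<times> T) = (\<integral>x. indicator B x * k x \<partial>distr \<nu> borel fst)" if B: "B \<in> sets borel" for B
    proof -
      have m2: "(\<lambda>(x, u). (x, q x u)) \<in> distr \<nu> borel fst \<Otimes>\<^sub>M unif \<rightarrow>\<^sub>M borel"
        unfolding borel_prod[symmetric] by measurable
      have "emeasure \<nu> (B \<times> T) = emeasure (distr (distr \<nu> borel fst \<Otimes>\<^sub>M unif) borel (\<lambda>(x, u). (x, q x u))) (B \<times> T)"
        using q unfolding mono_kernel_def by metis
      also have "\<dots> = emeasure (distr \<nu> borel fst \<Otimes>\<^sub>M unif) ((\<lambda>(x, u). (x, q x u)) -` (B \<times> T) \<inter> space (distr \<nu> borel fst \<Otimes>\<^sub>M unif))"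
        using B by (intro emeasure_distr m2 times_sets_borel) auto
      also have "(\<lambda>(x, u). (x, q x u)) -` (B \<times> T) \<inter> space (distr \<nu> borel fst \<Otimes>\<^sub>M unif)
          = {w \<in> space (distr \<nu> borel fst \<Otimes>\<^sub>M unif). fst w \<in> B \<and> q (fst w) (snd w) \<in> T}" by auto
      also have "emeasure (distr \<nu> borel fst \<Otimes>\<^sub>M unif) \<dots> = ennreal (\<integral>x. indicator B x * k x \<partial>distr \<nu> borel fst)"
        using nn[OF \<mu>.prob_space_axioms, of B "\<lambda>x. x"] B by simp
      finally show ?thesis using kb by (simp add: \<nu>.emeasure_eq_measure)
    qed
    have "measure P' (Pi\<^sub>E (insert j W) (A(j := T))) = (\<integral>x. indicator (Pi\<^sub>E W A) x * k (x i) \<partial>P)"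
      using ext A kT kb \<open>T \<in> sets borel\<close> unfolding leaf_extension_def by auto
    moreover have "A(j := T) = A" by (simp add: T_def)
    ultimately have 1: "emeasure P' (Pi\<^sub>E (insert j W) A) = ennreal (\<integral>x. indicator (Pi\<^sub>E W A) x * k (x i) \<partial>P)"
      by (simp add: P'.emeasure_eq_measure)
    have box: "Pi\<^sub>E W A \<in> sets P" using A fin by (auto intro!: sets_PiM_I_finite)
    have "emeasure ?R (Pi\<^sub>E (insert j W) A) = emeasure (P \<Otimes>\<^sub>M unif)
        ((\<lambda>(x, u). x(j := q (x i) u)) -` (Pi\<^sub>E (insert j W) A) \<inter> space (P \<Otimes>\<^sub>M unif))"
      using A fin by (intro emeasure_distr meas sets_PiM_I_finite) auto
    also have "(\<lambda>(x, u). x(j := q (x i) u)) -` (Pi\<^sub>E (insert j W) A) \<inter> space (P \<Otimes>\<^sub>M unif)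
        = {w \<in> space (P \<Otimes>\<^sub>M unif). fst w \<in> Pi\<^sub>E W A \<and> q (fst w i) (snd w) \<in> T}"
    proof -
      have "x(j := t) \<in> Pi\<^sub>E (insert j W) A \<longleftrightarrow> x \<in> Pi\<^sub>E W A \<and> t \<in> T" if "x \<in> space P" for x t
      proof -
        have "x \<in> extensional W"
          using that sets_eq_imp_space_eq[OF sets(1)] by (simp add: space_PiM PiE_def)
        then have "x \<in> Pi\<^sub>E W A \<longleftrightarrow> (\<forall>l\<in>W. x l \<in> A l)" "x(j := t) \<in> extensional (insert j W)"
          by (auto simp: PiE_iff extensional_def)
        then show ?thesis using jW unfolding PiE_iff T_def by auto
      qed
      then show ?thesis by (auto simp: space_pair_measure)
    qed
    also have "emeasure (P \<Otimes>\<^sub>M unif) \<dots> = ennreal (\<integral>x. indicator (Pi\<^sub>E W A) x * k (x i) \<partial>P)"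
      by (rule nn[OF P.prob_space_axioms box, of "\<lambda>x. x i"]) (use iW in measurable)
    finally show "emeasure P' (Pi\<^sub>E (insert j W) A) = emeasure ?R (Pi\<^sub>E (insert j W) A)" using 1 by (simp only:)
  next
    show "range (\<lambda>_. Pi\<^sub>E (insert j W) (\<lambda>_. UNIV)) \<subseteq> prod_algebra (insert j W) (\<lambda>_. borel :: real measure)"
      using fin by (auto intro!: prod_algebraI_finite)
  qed (use fin in \<open>auto simp: space_PiM P'.emeasure_eq_measure\<close>)
qed

lemma integral_bounded_const:
  assumes "prob_space M" "\<And>x. \<bar>f x\<bar> \<le> (c :: real)" "f \<in> borel_measurable M"
  shows "integrable M f" "\<bar>\<integral>x. f x \<partial>M\<bar> \<le> c"
proof -
  interpret prob_space M by fact
  show i: "integrable M f" using assms by (intro integrable_const_bound[of _ c]) auto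
  have "\<bar>\<integral>x. f x \<partial>M\<bar> \<le> (\<integral>x. \<bar>f x\<bar> \<partial>M)" by (rule integral_abs_bound)
  also have "\<dots> \<le> (\<integral>x. c \<partial>M)" using i assms(2) by (intro integral_mono) auto
  finally show "\<bar>\<integral>x. f x \<partial>M\<bar> \<le> c" using prob_space by simp
qed

lemma update_PiE: "x \<in> (\<Pi>\<^sub>E l\<in>W. UNIV) \<Longrightarrow> x(j := t) \<in> (\<Pi>\<^sub>E l\<in>insert j W. UNIV :: real set)"
  by (auto simp: PiE_iff extensional_def)

text \<open>The conditional expectation of \<open>f\<close> given the coordinates other than
  \<open>j\<close>, when \<open>j\<close> is attached to \<open>i\<close> by the kernel
  \<open>q\<close>.\<close>

definition leaf_integral :: "(real \<Rightarrow> real \<Rightarrow> real) \<Rightarrow> nat \<Rightarrow> nat \<Rightarrow> ((nat \<Rightarrow> real) \<Rightarrow> real) \<Rightarrow> (nat \<Rightarrow> real) \<Rightarrow> real" where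
  "leaf_integral q i j f x = (\<integral>u. f (x(j := q (x i) u)) \<partial>unif)"

context
  fixes q :: "real \<Rightarrow> real \<Rightarrow> real" and W :: "nat set" and i j :: nat and f :: "(nat \<Rightarrow> real) \<Rightarrow> real" and c :: real
  assumes q_borel: "(\<lambda>(x, u). q x u) \<in> borel_measurable (borel \<Otimes>\<^sub>M borel)"
    and iW: "i \<in> W" and jW: "j \<notin> W"
    and f_borel: "f \<in> borel_measurable (Pi\<^sub>M (insert j W) (\<lambda>_. borel))"
    and f_bound: "\<And>x. \<bar>f x\<bar> \<le> c"
begin

lemma update_borel: "(\<lambda>w. f ((fst w)(j := q (fst w i) (snd w)))) \<in> borel_measurable (Pi\<^sub>M W (\<lambda>_. borel) \<Otimes>\<^sub>M unif)"
  using measurable_compose[OF kernel_update_measurable[OF q_borel iW, of j] f_borel] by (simp add: case_prod_beta)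

lemma section_borel:
  assumes "x \<in> (\<Pi>\<^sub>E l\<in>W. UNIV)"
  shows "(\<lambda>u. f (x(j := q (x i) u))) \<in> borel_measurable unif"
proof -
  have "Pair x \<in> unif \<rightarrow>\<^sub>M Pi\<^sub>M W (\<lambda>_. borel) \<Otimes>\<^sub>M unif"
    using assms by (intro measurable_Pair1') (simp add: space_PiM)
  from measurable_compose[OF this update_borel] show ?thesis by simp
qed

lemma leaf_integral_borel: "leaf_integral q i j f \<in> borel_measurable (Pi\<^sub>M W (\<lambda>_. borel))"
  unfolding leaf_integral_def
  using update_borel by (intro unif.borel_measurable_lebesgue_integral) (simp add: case_prod_beta)

lemma leaf_integral_bound: "\<bar>leaf_integral q i j f x\<bar> \<le> c"
proof (cases "(\<lambda>u. f (x(j := q (x i) u))) \<in> borel_measurable unif")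
  case True
  then show ?thesis unfolding leaf_integral_def
    by (intro integral_bounded_const(2)) (auto intro: f_bound unif.prob_space_axioms)
next
  case False
  \<comment> \<open>For arguments outside the function space on \<open>W\<close> the section may
    fail to be measurable; the integral then has its default value 0, which keeps the bound valid
    everywhere.\<close>
  then have "\<not> integrable unif (\<lambda>u. f (x(j := q (x i) u)))" by auto
  then have "leaf_integral q i j f x = 0" unfolding leaf_integral_def by (rule not_integrable_integral_eq)
  then show ?thesis using f_bound[of x] by simp
qed

lemma section_integrable:
  assumes "x \<in> (\<Pi>\<^sub>E l\<in>W. UNIV)"
  shows "integrable unif (\<lambda>u. f (x(j := q (x i) u)))"
  using assms by (intro integral_bounded_const(1)[OF unif.prob_space_axioms f_bound] section_borel)

lemma leaf_integral_supermodular: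
  assumes sm: "supermodular (insert j W) f" and q_mono: "\<And>x x' u. x \<le> x' \<Longrightarrow> q x u \<le> q x' u"
  shows "supermodular W (leaf_integral q i j f)"
  unfolding supermodular_def
proof (intro ballI)
  fix x y :: "nat \<Rightarrow> real" assume xy: "x \<in> (\<Pi>\<^sub>E l\<in>W. UNIV)" "y \<in> (\<Pi>\<^sub>E l\<in>W. UNIV)"
  let ?u = "\<lambda>x u. x(j := q (x i) u)"
  have lat: "inf x y \<in> (\<Pi>\<^sub>E l\<in>W. UNIV)" "sup x y \<in> (\<Pi>\<^sub>E l\<in>W. UNIV)"
    using xy by (auto simp: PiE_iff extensional_def)
  have m: "q (min a b) u = min (q a u) (q b u)" "q (max a b) u = max (q a u) (q b u)" for a b u
    using q_mono[of a b u] q_mono[of b a u] by (auto simp: min_def max_def)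
  have "f (?u x u) + f (?u y u) \<le> f (?u (inf x y) u) + f (?u (sup x y) u)" for u
  proof -
    have "inf (?u x u) (?u y u) = ?u (inf x y) u" "sup (?u x u) (?u y u) = ?u (sup x y) u"
      by (auto simp: fun_eq_iff m inf_real_def sup_real_def)
    then show ?thesis
      using sm update_PiE[OF xy(1), of j "q (x i) u"] update_PiE[OF xy(2), of j "q (y i) u"]
      unfolding supermodular_def by metis
  qed
  then have "(\<integral>u. f (?u x u) + f (?u y u) \<partial>unif) \<le> (\<integral>u. f (?u (inf x y) u) + f (?u (sup x y) u) \<partial>unif)"
    by (intro integral_mono Bochner_Integration.integrable_add section_integrable xy lat)
  then show "leaf_integral q i j f x + leaf_integral q i j f y
      \<le> leaf_integral q i j f (inf x y) + leaf_integral q i j f (sup x y)"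
    unfolding leaf_integral_def
      Bochner_Integration.integral_add[OF section_integrable[OF xy(1)] section_integrable[OF xy(2)], symmetric]
      Bochner_Integration.integral_add[OF section_integrable[OF lat(1)] section_integrable[OF lat(2)], symmetric] .
qed

lemma leaf_integral_mono:
  assumes mono: "mono_on (\<Pi>\<^sub>E l\<in>insert j W. UNIV) f" and q_mono: "\<And>x x' u. x \<le> x' \<Longrightarrow> q x u \<le> q x' u"
  shows "mono_on (\<Pi>\<^sub>E l\<in>W. UNIV) (leaf_integral q i j f)"
proof (rule mono_onI)
  fix x y :: "nat \<Rightarrow> real" assume xy: "x \<in> (\<Pi>\<^sub>E l\<in>W. UNIV)" "y \<in> (\<Pi>\<^sub>E l\<in>W. UNIV)" "x \<le> y"
  show "leaf_integral q i j f x \<le> leaf_integral q i j f y"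
    unfolding leaf_integral_def
  proof (intro integral_mono section_integrable xy)
    show "f (x(j := q (x i) u)) \<le> f (y(j := q (y i) u))" for u
      using xy q_mono[of "x i" "y i" u] by (intro mono_onD[OF mono] update_PiE) (auto simp: le_fun_def)
  qed
qed

lemma integral_leaf:
  assumes "prob_space P" and sets [measurable_cong]: "sets P = sets (Pi\<^sub>M W (\<lambda>_. borel))"
  shows "(\<integral>x. f x \<partial>distr (P \<Otimes>\<^sub>M unif) (Pi\<^sub>M (insert j W) (\<lambda>_. borel)) (\<lambda>(x, u). x(j := q (x i) u)))
    = (\<integral>x. leaf_integral q i j f x \<partial>P)"
proof -
  interpret P: prob_space P by fact
  interpret Pu: pair_prob_space P unif ..
  have meas: "(\<lambda>(x, u). x(j := q (x i) u)) \<in> P \<Otimes>\<^sub>M unif \<rightarrow>\<^sub>M Pi\<^sub>M (insert j W) (\<lambda>_. borel)"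
    using kernel_update_measurable[OF q_borel iW, of j] by (simp add: sets cong: measurable_cong_sets)
  have ub: "(\<lambda>w. f ((fst w)(j := q (fst w i) (snd w)))) \<in> borel_measurable (P \<Otimes>\<^sub>M unif)"
    using measurable_compose[OF meas f_borel] by (simp add: case_prod_beta)
  show ?thesis
    unfolding leaf_integral_def
    by (subst integral_distr[OF meas f_borel], subst Pu.integral_fst'[symmetric])
       (use ub in \<open>auto simp: case_prod_beta intro!: integral_bounded_const(1)[OF Pu.P.prob_space_axioms f_bound]\<close>)
qed

end

section \<open>Comparison of tree laws for bounded functions\<close>

text \<open>The finite node sets that can be grown from the root along edges, presented by
  successive leaves. The induction therefore also serves infinite trees, whose finite-dimensional
  laws are marginals of laws on such sets.\<close>

inductive subtree :: "(nat \<times> nat) set \<Rightarrow> nat set \<Rightarrow> bool" for E where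
  root: "subtree E {0}"
| leaf: "subtree E W \<Longrightarrow> i \<in> W \<Longrightarrow> (i, j) \<in> E \<Longrightarrow> j \<notin> W \<Longrightarrow> subtree E (insert j W)"

lemma subtree_finite: "subtree E W \<Longrightarrow> finite W"
  by (induction rule: subtree.induct) auto

section \<open>Association, and laws built leaf by leaf\<close>

text \<open>A threshold \<open>m\<close> for \<open>h\<close> on \<open>{g \<le> a}\<close>, \<open>a\<close> the mean of \<open>g\<close>, makes \<open>(g - a) (h - m)\<close> nonnegative.\<close>

lemma chebyshev:
  fixes g h :: "real \<Rightarrow> real"
  assumes "prob_space M" and sets [measurable_cong]: "sets M = sets borel"
    and mono: "mono g" "mono h" and bnd: "\<And>x. \<bar>g x\<bar> \<le> c" "\<And>x. \<bar>h x\<bar> \<le> c"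
  shows "(\<integral>x. g x \<partial>M) * (\<integral>x. h x \<partial>M) \<le> (\<integral>x. g x * h x \<partial>M)"
proof -
  interpret prob_space M by fact
  have [measurable]: "g \<in> borel_measurable borel" "h \<in> borel_measurable borel"
    using mono by (auto intro: borel_measurable_mono)
  have c0: "0 \<le> c" using bnd(1)[of 0] by linarith
  have int: "integrable M g" "integrable M h" "integrable M (\<lambda>x. g x * h x)"
  proof -
    show "integrable M g" "integrable M h" using bnd by (auto intro!: integrable_const_bound[of _ c])
    have "\<bar>g x * h x\<bar> \<le> c * c" for x
      unfolding abs_mult using bnd[of x] c0 by (intro mult_mono) auto
    then show "integrable M (\<lambda>x. g x * h x)" by (auto intro!: integrable_const_bound[of _ "c * c"])
  qed
  define a where "a = (\<integral>x. g x \<partial>M)"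
  \<comment> \<open>The lower bound \<open>- c\<close> of \<open>h\<close> makes the supremum
    meaningful without first showing that \<open>g\<close> attains values at most its mean.\<close>
  define H where "H = insert (- c) (h ` {x. g x \<le> a})"
  define m where "m = Sup H"
  have low: "- c \<le> h x" for x using bnd(2)[of x] by linarith
  have H: "H \<noteq> {}" "bdd_above H"
    using bnd(2) c0 unfolding H_def by (auto intro!: bdd_aboveI[of _ c] simp: abs_le_iff)
  have "0 \<le> (g x - a) * (h x - m)" for x
  proof (cases "g x \<le> a")
    case True
    then have "h x \<le> m" unfolding m_def using H by (intro cSup_upper) (auto simp: H_def)
    then show ?thesis using True by (intro mult_nonpos_nonpos) auto
  next
    case False
    have "h y \<le> h x" if "g y \<le> a" for y
      using False that monoD[OF mono(1), of x y] monoD[OF mono(2), of y x] by force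
    then have "m \<le> h x" unfolding m_def using H low by (intro cSup_least) (auto simp: H_def)
    then show ?thesis using False by (intro mult_nonneg_nonneg) auto
  qed
  then have "0 \<le> (\<integral>x. (g x - a) * (h x - m) \<partial>M)" by simp
  also have "\<dots> = (\<integral>x. g x * h x - a * h x - m * g x + a * m \<partial>M)"
    by (simp add: algebra_simps)
  also have "\<dots> = (\<integral>x. g x * h x \<partial>M) - a * (\<integral>x. h x \<partial>M) - m * a + a * m"
    using int prob_space by (simp add: a_def)
  finally show ?thesis by (simp add: a_def)
qed

text \<open>Bounded test functions keep integrability out of the definition; unbounded ones are
  reached later by truncation.\<close>

definition associated :: "nat set \<Rightarrow> (nat \<Rightarrow> real) measure \<Rightarrow> bool" where
  "associated I P \<longleftrightarrow>
     (\<forall>(g :: (nat \<Rightarrow> real) \<Rightarrow> real) (h :: (nat \<Rightarrow> real) \<Rightarrow> real) c. g \<in> borel_measurable (Pi\<^sub>M I (\<lambda>_. borel)) \<longrightarrow> h \<in> borel_measurable (Pi\<^sub>M I (\<lambda>_. borel)) \<longrightarrow>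
        (\<forall>x. \<bar>g x\<bar> \<le> c \<and> \<bar>h x\<bar> \<le> c) \<longrightarrow>
        mono_on (\<Pi>\<^sub>E i\<in>I. UNIV) g \<longrightarrow> mono_on (\<Pi>\<^sub>E i\<in>I. UNIV) h \<longrightarrow>
        (\<integral>x. g x \<partial>P) * (\<integral>x. h x \<partial>P) \<le> (\<integral>x. g x * h x \<partial>P))"

text \<open>Given its coordinate \<open>i\<close>, the vector is a random increasing function \<open>\<Psi>\<close> of that coordinate.\<close>

definition mono_disintegration ::
  "nat set \<Rightarrow> nat \<Rightarrow> real measure \<Rightarrow> (nat \<Rightarrow> real) measure \<Rightarrow> (real \<Rightarrow> (nat \<Rightarrow> real) \<Rightarrow> nat \<Rightarrow> real) \<Rightarrow> bool" where
  "mono_disintegration W i \<mu> P \<Psi> \<longleftrightarrow>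
     (\<lambda>(x, \<omega>). \<Psi> x \<omega>) \<in> borel \<Otimes>\<^sub>M Pi\<^sub>M W (\<lambda>_. unif) \<rightarrow>\<^sub>M Pi\<^sub>M W (\<lambda>_. borel) \<and>
     (\<forall>\<omega> x x'. x \<le> x' \<longrightarrow> \<Psi> x \<omega> \<le> \<Psi> x' \<omega>) \<and> (\<forall>\<omega> x. \<Psi> x \<omega> i = x) \<and>
     (\<forall>f\<in>borel_measurable (Pi\<^sub>M W (\<lambda>_. borel)).
        (\<integral>\<^sup>+x. f x \<partial>P) = (\<integral>\<^sup>+x. \<integral>\<^sup>+\<omega>. f (\<Psi> x \<omega>) \<partial>Pi\<^sub>M W (\<lambda>_. unif) \<partial>\<mu>))"

lemma mono_disintegration_facts:
  assumes "mono_disintegration W i \<mu> P \<Psi>"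
  shows "(\<lambda>(x, \<omega>). \<Psi> x \<omega>) \<in> borel \<Otimes>\<^sub>M Pi\<^sub>M W (\<lambda>_. unif) \<rightarrow>\<^sub>M Pi\<^sub>M W (\<lambda>_. borel)"
    "\<And>\<omega> x x'. x \<le> x' \<Longrightarrow> \<Psi> x \<omega> \<le> \<Psi> x' \<omega>" "\<And>\<omega> x. \<Psi> x \<omega> i = x"
    "\<And>f. f \<in> borel_measurable (Pi\<^sub>M W (\<lambda>_. borel)) \<Longrightarrow>
       (\<integral>\<^sup>+x. f x \<partial>P) = (\<integral>\<^sup>+x. \<integral>\<^sup>+\<omega>. f (\<Psi> x \<omega>) \<partial>Pi\<^sub>M W (\<lambda>_. unif) \<partial>\<mu>)"
  using assms unfolding mono_disintegration_def by blast+

interpretation unif_product: product_prob_space "\<lambda>_ :: nat. unif" UNIV ..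

lemma mono_kernel_facts:
  assumes "mono_kernel \<nu> q"
  shows "(\<lambda>(x, u). q x u) \<in> borel_measurable (borel \<Otimes>\<^sub>M borel)"
    and "\<And>x x' u. x \<le> x' \<Longrightarrow> q x u \<le> q x' u" and "\<And>x u u'. u \<le> u' \<Longrightarrow> q x u \<le> q x u'"
    and "\<nu> = distr (distr \<nu> borel fst \<Otimes>\<^sub>M unif) borel (\<lambda>(x, u). (x, q x u))"
  using assms unfolding mono_kernel_def by blast+

text \<open>Only the pair laws of the edges and the laws on subtrees are kept, and the SI condition
  survives as the existence of monotone kernels. Both Markov tree processes and product laws are
  instances.\<close>

locale tree_law =
  fixes E :: "(nat \<times> nat) set" and \<mu> :: "nat \<Rightarrow> real measure"
    and \<nu> :: "nat \<times> nat \<Rightarrow> (real \<times> real) measure" and P :: "nat set \<Rightarrow> (nat \<Rightarrow> real) measure"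
  assumes \<mu>_prob: "prob_space (\<mu> n)" and \<mu>_sets: "sets (\<mu> n) = sets borel"
    and \<nu>_prob: "e \<in> E \<Longrightarrow> prob_space (\<nu> e)" and \<nu>_sets: "e \<in> E \<Longrightarrow> sets (\<nu> e) = sets borel"
    and \<nu>_fst: "(i, j) \<in> E \<Longrightarrow> distr (\<nu> (i, j)) borel fst = \<mu> i"
    and \<nu>_snd: "(i, j) \<in> E \<Longrightarrow> distr (\<nu> (i, j)) borel snd = \<mu> j"
    and P_prob: "subtree E W \<Longrightarrow> prob_space (P W)"
    and P_sets: "subtree E W \<Longrightarrow> sets (P W) = sets (Pi\<^sub>M W (\<lambda>_. borel))"
    and P_root: "P {0} = distr (\<mu> 0) (Pi\<^sub>M {0} (\<lambda>_. borel)) (\<lambda>t. \<lambda>l\<in>{0}. t)"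
    and P_leaf: "subtree E W \<Longrightarrow> i \<in> W \<Longrightarrow> (i, j) \<in> E \<Longrightarrow> j \<notin> W \<Longrightarrow>
      leaf_extension W i j (\<nu> (i, j)) (P W) (P (insert j W))"
    and kernel: "e \<in> E \<Longrightarrow> \<exists>q. mono_kernel (\<nu> e) q"
begin

lemma P_insert:
  assumes "subtree E W" "i \<in> W" "(i, j) \<in> E" "j \<notin> W" "mono_kernel (\<nu> (i, j)) q"
  shows "P (insert j W) = distr (P W \<Otimes>\<^sub>M unif) (Pi\<^sub>M (insert j W) (\<lambda>_. borel)) (\<lambda>(x, u). x(j := q (x i) u))"
  using assms subtree.leaf[OF assms(1-4)]
  by (intro leaf_extension_kernel[where \<nu> = "\<nu> (i, j)"] P_prob P_sets subtree_finite P_leaf \<nu>_prob \<nu>_sets)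

lemma integral_insert:
  assumes W: "subtree E W" "i \<in> W" "(i, j) \<in> E" "j \<notin> W" and q: "mono_kernel (\<nu> (i, j)) q"
    and f: "f \<in> borel_measurable (Pi\<^sub>M (insert j W) (\<lambda>_. borel))" "\<And>x. \<bar>f x\<bar> \<le> c"
  shows "(\<integral>x. f x \<partial>P (insert j W)) = (\<integral>x. leaf_integral q i j f x \<partial>P W)"
  unfolding P_insert[OF W q]
  by (rule integral_leaf[OF mono_kernel_facts(1)[OF q] W(2,4) f P_prob[OF W(1)] P_sets[OF W(1)]])

lemma integral_root:
  fixes f :: "(nat \<Rightarrow> real) \<Rightarrow> real"
  assumes "f \<in> borel_measurable (Pi\<^sub>M {0} (\<lambda>_. borel))"
  shows "(\<integral>x. f x \<partial>P {0}) = (\<integral>t. f (\<lambda>l\<in>{0}. t) \<partial>\<mu> 0)"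
proof -
  note [measurable_cong] = \<mu>_sets
  have "(\<lambda>t. \<lambda>l\<in>{0}. t) \<in> \<mu> 0 \<rightarrow>\<^sub>M Pi\<^sub>M {0 :: nat} (\<lambda>_. borel :: real measure)"
    by (rule measurable_restrict) measurable
  then show ?thesis unfolding P_root by (simp add: integral_distr assms)
qed

text \<open>The two monotonicities of \<open>q\<close> play different parts in the leaf step. Since
  \<open>q\<close> increases in \<open>u\<close>, \<open>chebyshev\<close> applied to the uniform
  variable bounds the product of the conditional means by the conditional mean of the product. Since
  \<open>q\<close> increases in \<open>x\<close>, these conditional means are increasing functions
  on \<open>W\<close>, to which the induction hypothesis applies.\<close>

lemma associated_P:
  assumes "subtree E W"
  shows "associated W (P W)"
  using assms
proof (induction rule: subtree.induct)
  case root
  show ?case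
    unfolding associated_def
  proof (intro allI impI)
    fix g h :: "(nat \<Rightarrow> real) \<Rightarrow> real" and c
    assume m: "g \<in> borel_measurable (Pi\<^sub>M {0} (\<lambda>_. borel))" "h \<in> borel_measurable (Pi\<^sub>M {0} (\<lambda>_. borel))"
      and b: "\<forall>x. \<bar>g x\<bar> \<le> c \<and> \<bar>h x\<bar> \<le> c"
      and mono: "mono_on (\<Pi>\<^sub>E i\<in>{0}. UNIV) g" "mono_on (\<Pi>\<^sub>E i\<in>{0}. UNIV) h"
    have r: "(\<lambda>l\<in>{0}. s) \<le> (\<lambda>l\<in>{0 :: nat}. t)" if "s \<le> t" for s t :: real
      using that by (auto simp: le_fun_def)
    have "mono (\<lambda>t. g (\<lambda>l\<in>{0}. t))" "mono (\<lambda>t. h (\<lambda>l\<in>{0}. t))"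
      by (rule monoI, rule mono_onD[OF mono(1)], simp, simp, rule r, assumption)
         (rule monoI, rule mono_onD[OF mono(2)], simp, simp, rule r, assumption)
    then show "(\<integral>x. g x \<partial>P {0}) * (\<integral>x. h x \<partial>P {0}) \<le> (\<integral>x. g x * h x \<partial>P {0})"
      using integral_root[OF m(1)] integral_root[OF m(2)]
        integral_root[OF borel_measurable_times[OF m]] b chebyshev[OF \<mu>_prob \<mu>_sets, of _ _ c] by simp
  qed
next
  case (leaf W i j)
  obtain q where q: "mono_kernel (\<nu> (i, j)) q" using kernel leaf by blast
  note qf = mono_kernel_facts[OF q]
  interpret PW: prob_space "P W" by (rule P_prob[OF leaf(1)])
  show ?case
    unfolding associated_def
  proof (intro allI impI)
    fix g h :: "(nat \<Rightarrow> real) \<Rightarrow> real" and c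
    assume m: "g \<in> borel_measurable (Pi\<^sub>M (insert j W) (\<lambda>_. borel))" "h \<in> borel_measurable (Pi\<^sub>M (insert j W) (\<lambda>_. borel))"
      and b: "\<forall>x. \<bar>g x\<bar> \<le> c \<and> \<bar>h x\<bar> \<le> c"
      and mono: "mono_on (\<Pi>\<^sub>E i\<in>insert j W. UNIV) g" "mono_on (\<Pi>\<^sub>E i\<in>insert j W. UNIV) h"
    have bg: "\<bar>g x\<bar> \<le> c" and bh: "\<bar>h x\<bar> \<le> c" for x using b by auto
    have c0: "0 \<le> c" using bg[of undefined] by linarith
    have bgh: "\<bar>g x * h x\<bar> \<le> c * c" for x
      unfolding abs_mult using bg[of x] bh[of x] c0 by (intro mult_mono) auto
    have mgh: "(\<lambda>x. g x * h x) \<in> borel_measurable (Pi\<^sub>M (insert j W) (\<lambda>_. borel))"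
      using m by (rule borel_measurable_times)
    note I = integral_insert[OF leaf(1-4) q]
    let ?S = "leaf_integral q i j"
    note Sb = leaf_integral_borel[OF qf(1) leaf(2,4)] and Sbd = leaf_integral_bound[OF qf(1) leaf(2,4)]
    note Sm = leaf_integral_mono[OF qf(1) leaf(2,4)]
    note PWc = P_sets[OF leaf(1)]
    have "(\<integral>x. g x \<partial>P (insert j W)) * (\<integral>x. h x \<partial>P (insert j W)) = (\<integral>x. ?S g x \<partial>P W) * (\<integral>x. ?S h x \<partial>P W)"
      using I[OF m(1) bg] I[OF m(2) bh] by simp
    also have "\<dots> \<le> (\<integral>x. ?S g x * ?S h x \<partial>P W)"
      using leaf.IH Sb[OF m(1) bg] Sb[OF m(2) bh] Sbd[OF m(1) bg] Sbd[OF m(2) bh]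
        Sm[OF m(1) bg mono(1) qf(2)] Sm[OF m(2) bh mono(2) qf(2)]
      unfolding associated_def by blast
    also have "\<dots> \<le> (\<integral>x. ?S (\<lambda>x. g x * h x) x \<partial>P W)"
    proof (rule integral_mono)
      have "?S g \<in> borel_measurable (P W)" "?S h \<in> borel_measurable (P W)" "?S (\<lambda>x. g x * h x) \<in> borel_measurable (P W)"
        using Sb[OF m(1) bg] Sb[OF m(2) bh] Sb[OF mgh bgh] by (simp_all add: PWc cong: measurable_cong_sets)
      moreover have "\<bar>?S g x * ?S h x\<bar> \<le> c * c" for x
        unfolding abs_mult using Sbd[OF m(1) bg, of x] Sbd[OF m(2) bh, of x] c0 by (intro mult_mono) auto
      ultimately show "integrable (P W) (\<lambda>x. ?S g x * ?S h x)" "integrable (P W) (?S (\<lambda>x. g x * h x))"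
        using Sbd[OF mgh bgh] by (auto intro!: integral_bounded_const(1)[OF PW.prob_space_axioms])
      fix x assume "x \<in> space (P W)"
      then have x: "x \<in> (\<Pi>\<^sub>E l\<in>W. UNIV)" using sets_eq_imp_space_eq[OF PWc] by (simp add: space_PiM)
      have le: "x(j := q (x i) u) \<le> x(j := q (x i) u')" if "u \<le> u'" for u u'
        using qf(3)[OF that] by (auto simp: le_fun_def)
      note up = update_PiE[OF x]
      have "mono (\<lambda>u. g (x(j := q (x i) u)))" "mono (\<lambda>u. h (x(j := q (x i) u)))"
        by (rule monoI, rule mono_onD[OF mono(1) up up le], assumption)
           (rule monoI, rule mono_onD[OF mono(2) up up le], assumption)
      then show "?S g x * ?S h x \<le> ?S (\<lambda>x. g x * h x) x"
        unfolding leaf_integral_def by (rule chebyshev[OF unif.prob_space_axioms sets_unif _ _ bg bh])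
    qed
    also have "\<dots> = (\<integral>x. g x * h x \<partial>P (insert j W))" using I[OF mgh bgh] by simp
    finally show "(\<integral>x. g x \<partial>P (insert j W)) * (\<integral>x. h x \<partial>P (insert j W)) \<le> (\<integral>x. g x * h x \<partial>P (insert j W))" .
  qed
qed

lemma nn_integral_insert:
  fixes f :: "(nat \<Rightarrow> real) \<Rightarrow> ennreal"
  assumes W: "subtree E W" "i \<in> W" "(i, j) \<in> E" "j \<notin> W" and q: "mono_kernel (\<nu> (i, j)) q"
    and f: "f \<in> borel_measurable (Pi\<^sub>M (insert j W) (\<lambda>_. borel))"
  shows "(\<integral>\<^sup>+x. f x \<partial>P (insert j W)) = (\<integral>\<^sup>+x. \<integral>\<^sup>+u. f (x(j := q (x i) u)) \<partial>unif \<partial>P W)"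
proof -
  have meas: "(\<lambda>(x, u). x(j := q (x i) u)) \<in> P W \<Otimes>\<^sub>M unif \<rightarrow>\<^sub>M Pi\<^sub>M (insert j W) (\<lambda>_. borel)"
    using kernel_update_measurable[OF mono_kernel_facts(1)[OF q] W(2), of j]
    by (simp add: P_sets[OF W(1)] cong: measurable_cong_sets)
  show ?thesis
    unfolding P_insert[OF W q]
    by (subst nn_integral_distr[OF meas], simp add: f, subst unif.nn_integral_fst[symmetric])
       (use measurable_compose[OF meas f] in \<open>auto simp: case_prod_beta\<close>)
qed

end

section \<open>Increasing disintegrations with respect to a node\<close>

lemma Pi_unif_insert:
  fixes f :: "(nat \<Rightarrow> real) \<Rightarrow> ennreal"
  assumes "finite W" "j \<notin> W" "f \<in> borel_measurable (Pi\<^sub>M (insert j W) (\<lambda>_. unif))"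
  shows "(\<integral>\<^sup>+\<omega>. f \<omega> \<partial>Pi\<^sub>M (insert j W) (\<lambda>_. unif)) = (\<integral>\<^sup>+w. (\<integral>\<^sup>+u. f (w(j := u)) \<partial>unif) \<partial>(Pi\<^sub>M W (\<lambda>_. unif)))"
  using assms by (rule unif_product.product_nn_integral_insert)

text \<open>For fixed \<open>\<omega>\<close>, the extended vector is a function of the pair of
  coordinates \<open>i\<close> and \<open>j\<close> alone, so integrating out the leaf means
  integrating this function over the pair law \<open>\<nu>\<close>. Exchanging the copula of the
  edge thereby becomes a two-dimensional question for each \<open>\<omega>\<close>.\<close>

lemma leaf_disintegration:
  fixes f :: "(nat \<Rightarrow> real) \<Rightarrow> ennreal"
  assumes dis: "mono_disintegration W i \<mu> P \<Psi>"
    and \<nu>: "prob_space \<nu>" "sets \<nu> = sets borel" "distr \<nu> borel fst = \<mu>" and q: "mono_kernel \<nu> q"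
    and W: "finite W" "i \<in> W" "j \<notin> W"
    and f: "f \<in> borel_measurable (Pi\<^sub>M (insert j W) (\<lambda>_. borel))"
  shows "(\<integral>\<^sup>+x. \<integral>\<^sup>+u. f (x(j := q (x i) u)) \<partial>unif \<partial>P)
    = (\<integral>\<^sup>+\<omega>. \<integral>\<^sup>+z. f ((\<Psi> (fst z) \<omega>)(j := snd z)) \<partial>\<nu> \<partial>Pi\<^sub>M W (\<lambda>_. unif))"
    and "(\<lambda>w. f ((\<Psi> (fst (fst w)) (snd w))(j := snd (fst w))))
      \<in> borel_measurable ((borel \<Otimes>\<^sub>M borel) \<Otimes>\<^sub>M Pi\<^sub>M W (\<lambda>_. unif))"
proof -
  note \<Psi> = mono_disintegration_facts(1,3)[OF dis] and P = mono_disintegration_facts(4)[OF dis]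
  let ?\<Omega> = "Pi\<^sub>M W (\<lambda>_ :: nat. unif)"
  interpret \<nu>: prob_space \<nu> by fact
  note qf = mono_kernel_facts[OF q]
  note [measurable] = qf(1)
  have \<mu>: "prob_space \<mu>" "sets \<mu> = sets borel"
  proof -
    note [measurable_cong] = \<nu>(2)
    show "prob_space \<mu>" "sets \<mu> = sets borel"
      unfolding \<nu>(3)[symmetric] by (auto intro!: \<nu>.prob_space_distr)
  qed
  note [measurable_cong] = \<mu>(2)
  interpret \<mu>: prob_space \<mu> by fact
  interpret \<Omega>: prob_space ?\<Omega> by (rule prob_space_PiM) (rule unif.prob_space_axioms)
  interpret \<mu>\<Omega>: pair_sigma_finite \<mu> ?\<Omega> ..
  let ?B = "borel :: real measure"
  have 1: "(\<lambda>w. \<Psi> (fst (fst w)) (snd w)) \<in> (?B \<Otimes>\<^sub>M ?B) \<Otimes>\<^sub>M ?\<Omega> \<rightarrow>\<^sub>M Pi\<^sub>M W (\<lambda>_. borel)"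
  proof -
    have "(\<lambda>w. (fst (fst w), snd w)) \<in> (?B \<Otimes>\<^sub>M ?B) \<Otimes>\<^sub>M ?\<Omega> \<rightarrow>\<^sub>M borel \<Otimes>\<^sub>M ?\<Omega>" by measurable
    from measurable_compose[OF this \<Psi>(1)] show ?thesis by simp
  qed
  have "(\<lambda>w. (\<Psi> (fst (fst w)) (snd w))(j := snd (fst w))) \<in> (?B \<Otimes>\<^sub>M ?B) \<Otimes>\<^sub>M ?\<Omega> \<rightarrow>\<^sub>M Pi\<^sub>M (insert j W) (\<lambda>_. borel)"
    by (rule measurable_fun_upd[OF _ 1]) auto
  from measurable_compose[OF this f]
  have h: "(\<lambda>w. f ((\<Psi> (fst (fst w)) (snd w))(j := snd (fst w)))) \<in> borel_measurable ((?B \<Otimes>\<^sub>M ?B) \<Otimes>\<^sub>M ?\<Omega>)" .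
  then show "(\<lambda>w. f ((\<Psi> (fst (fst w)) (snd w))(j := snd (fst w))))
      \<in> borel_measurable ((borel \<Otimes>\<^sub>M borel) \<Otimes>\<^sub>M Pi\<^sub>M W (\<lambda>_. unif))" .
  have sect: "(\<lambda>z. f ((\<Psi> (fst z) \<omega>)(j := snd z))) \<in> borel_measurable (borel \<Otimes>\<^sub>M borel)" if "\<omega> \<in> space ?\<Omega>" for \<omega>
  proof -
    have "(\<lambda>z. (z, \<omega>)) \<in> borel \<Otimes>\<^sub>M borel \<rightarrow>\<^sub>M (?B \<Otimes>\<^sub>M ?B) \<Otimes>\<^sub>M ?\<Omega>" using that by measurable
    from measurable_compose[OF this h] show ?thesis by simp
  qed
  have F: "(\<lambda>x. \<integral>\<^sup>+u. f (x(j := q (x i) u)) \<partial>unif) \<in> borel_measurable (Pi\<^sub>M W (\<lambda>_. borel))"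
    using measurable_compose[OF kernel_update_measurable[OF qf(1) W(2), of j] f]
    by (intro unif.borel_measurable_nn_integral) (simp add: case_prod_beta)
  have "(\<integral>\<^sup>+x. \<integral>\<^sup>+u. f (x(j := q (x i) u)) \<partial>unif \<partial>P)
      = (\<integral>\<^sup>+x. \<integral>\<^sup>+\<omega>. \<integral>\<^sup>+u. f ((\<Psi> x \<omega>)(j := q x u)) \<partial>unif \<partial>?\<Omega> \<partial>\<mu>)"
    unfolding P[OF F] by (simp add: \<Psi>(2))
  also have "\<dots> = (\<integral>\<^sup>+\<omega>. \<integral>\<^sup>+x. \<integral>\<^sup>+u. f ((\<Psi> x \<omega>)(j := q x u)) \<partial>unif \<partial>\<mu> \<partial>?\<Omega>)"
  proof (rule \<mu>\<Omega>.Fubini'[symmetric])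
    have "(\<lambda>w. ((fst (fst w), q (fst (fst w)) (snd w)), snd (fst w))) \<in> (\<mu> \<Otimes>\<^sub>M ?\<Omega>) \<Otimes>\<^sub>M unif \<rightarrow>\<^sub>M (?B \<Otimes>\<^sub>M ?B) \<Otimes>\<^sub>M ?\<Omega>"
    proof -
      have "(\<lambda>w. (fst (fst w), snd w)) \<in> (\<mu> \<Otimes>\<^sub>M ?\<Omega>) \<Otimes>\<^sub>M unif \<rightarrow>\<^sub>M ?B \<Otimes>\<^sub>M ?B" by measurable
      from measurable_compose[OF this qf(1)]
      have [measurable]: "(\<lambda>w. q (fst (fst w)) (snd w)) \<in> borel_measurable ((\<mu> \<Otimes>\<^sub>M ?\<Omega>) \<Otimes>\<^sub>M unif)" by simp
      show ?thesis by measurable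
    qed
    from measurable_compose[OF this h]
    show "(\<lambda>(x, \<omega>). \<integral>\<^sup>+u. f ((\<Psi> x \<omega>)(j := q x u)) \<partial>unif) \<in> borel_measurable (\<mu> \<Otimes>\<^sub>M ?\<Omega>)"
      unfolding case_prod_beta by (intro unif.borel_measurable_nn_integral) (simp add: case_prod_beta)
  qed
  also have "\<dots> = (\<integral>\<^sup>+\<omega>. \<integral>\<^sup>+z. f ((\<Psi> (fst z) \<omega>)(j := snd z)) \<partial>\<nu> \<partial>?\<Omega>)"
  proof (rule nn_integral_cong)
    fix \<omega> assume \<omega>: "\<omega> \<in> space ?\<Omega>"
    have m: "(\<lambda>(x, u). (x, q x u)) \<in> \<mu> \<Otimes>\<^sub>M unif \<rightarrow>\<^sub>M borel"
      unfolding borel_prod[symmetric] by measurable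
    have s: "(\<lambda>z. f ((\<Psi> (fst z) \<omega>)(j := snd z))) \<in> borel_measurable borel"
      using sect[OF \<omega>] by (simp add: borel_prod)
    have "(\<integral>\<^sup>+z. f ((\<Psi> (fst z) \<omega>)(j := snd z)) \<partial>\<nu>)
        = (\<integral>\<^sup>+z. f ((\<Psi> (fst z) \<omega>)(j := snd z)) \<partial>distr (\<mu> \<Otimes>\<^sub>M unif) borel (\<lambda>(x, u). (x, q x u)))"
      using qf(4) unfolding \<nu>(3) by simp
    also have "\<dots> = (\<integral>\<^sup>+w. f ((\<Psi> (fst w) \<omega>)(j := q (fst w) (snd w))) \<partial>(\<mu> \<Otimes>\<^sub>M unif))"
      using s by (subst nn_integral_distr[OF m]) (simp_all add: case_prod_beta)
    also have "\<dots> = (\<integral>\<^sup>+x. \<integral>\<^sup>+u. f ((\<Psi> x \<omega>)(j := q x u)) \<partial>unif \<partial>\<mu>)"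
      by (subst unif.nn_integral_fst[symmetric])
         (use measurable_compose[OF m s] in \<open>auto simp: case_prod_beta\<close>)
    finally show "(\<integral>\<^sup>+x. \<integral>\<^sup>+u. f ((\<Psi> x \<omega>)(j := q x u)) \<partial>unif \<partial>\<mu>) = (\<integral>\<^sup>+z. f ((\<Psi> (fst z) \<omega>)(j := snd z)) \<partial>\<nu>)" by simp
  qed
  finally show "(\<integral>\<^sup>+x. \<integral>\<^sup>+u. f (x(j := q (x i) u)) \<partial>unif \<partial>P)
    = (\<integral>\<^sup>+\<omega>. \<integral>\<^sup>+z. f ((\<Psi> (fst z) \<omega>)(j := snd z)) \<partial>\<nu> \<partial>Pi\<^sub>M W (\<lambda>_. unif))" .
qed

text \<open>Adding the bound \<open>c\<close> moves a bounded real integrand to the nonnegative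
  integrals in which disintegrations are stated.\<close>

lemma nn_integral_shift:
  assumes "prob_space R" "f \<in> borel_measurable R" "\<And>x. \<bar>f x\<bar> \<le> (c :: real)"
  shows "(\<integral>\<^sup>+x. ennreal (f x + c) \<partial>R) = ennreal ((\<integral>x. f x \<partial>R) + c)" "0 \<le> (\<integral>x. f x \<partial>R) + c"
proof -
  interpret prob_space R by fact
  have i: "integrable R f" by (rule integral_bounded_const(1)[OF assms(1,3,2)])
  have pos: "0 \<le> f x + c" for x using assms(3)[of x] by linarith
  have "(\<integral>\<^sup>+x. ennreal (f x + c) \<partial>R) = ennreal (\<integral>x. f x + c \<partial>R)"
    using i pos by (intro nn_integral_eq_integral) auto
  then show "(\<integral>\<^sup>+x. ennreal (f x + c) \<partial>R) = ennreal ((\<integral>x. f x \<partial>R) + c)"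
    using i prob_space by simp
  show "0 \<le> (\<integral>x. f x \<partial>R) + c"
    using integral_bounded_const(2)[OF assms(1,3,2)] by linarith
qed

text \<open>For fixed \<open>\<omega>\<close>, the function
  \<open>\<phi> x y = f ((\<Psi> x \<omega>)(j := y))\<close> is supermodular on the plane: as
  \<open>\<Psi>\<close> increases in \<open>x\<close>, the two mixed points have the two aligned
  points as meet and join. So \<open>supermodular_le\<close> applies for every
  \<open>\<omega>\<close>, and the inequality is integrated over \<open>\<omega>\<close>.\<close>

lemma leaf_integral_le:
  assumes dis: "mono_disintegration W i \<mu> P \<Psi>" and P: "prob_space P" "sets P = sets (Pi\<^sub>M W (\<lambda>_. borel))"
    and pair: "lo_ordered_pair \<nu> \<nu>'" and marg: "distr \<nu> borel fst = \<mu>" "distr \<nu>' borel fst = \<mu>"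
    and q: "mono_kernel \<nu> q" "mono_kernel \<nu>' q'"
    and W: "finite W" "i \<in> W" "j \<notin> W"
    and f: "f \<in> borel_measurable (Pi\<^sub>M (insert j W) (\<lambda>_. borel))" "\<And>x. \<bar>f x\<bar> \<le> c"
    and sm: "supermodular (insert j W) f"
  shows "(\<integral>x. leaf_integral q i j f x \<partial>P) \<le> (\<integral>x. leaf_integral q' i j f x \<partial>P)"
proof -
  interpret lo_ordered_pair \<nu> \<nu>' by fact
  note \<Psi> = mono_disintegration_facts[OF dis]
  define F where "F x = ennreal (f x + c)" for x
  have F: "F \<in> borel_measurable (Pi\<^sub>M (insert j W) (\<lambda>_. borel))"
    unfolding F_def using f(1) by measurable
  interpret PP: prob_space P by fact
  have eq: "(\<integral>\<^sup>+x. \<integral>\<^sup>+u. F (x(j := r (x i) u)) \<partial>unif \<partial>P) = ennreal ((\<integral>x. leaf_integral r i j f x \<partial>P) + c)"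
    if r: "(\<lambda>(x, u). r x u) \<in> borel_measurable (borel \<Otimes>\<^sub>M borel)" for r
  proof -
    have "(\<integral>\<^sup>+u. F (x(j := r (x i) u)) \<partial>unif) = ennreal (leaf_integral r i j f x + c)" if "x \<in> space P" for x
    proof -
      have x: "x \<in> (\<Pi>\<^sub>E l\<in>W. UNIV)" using that sets_eq_imp_space_eq[OF P(2)] by (simp add: space_PiM)
      show ?thesis
        unfolding F_def leaf_integral_def
        by (rule nn_integral_shift(1)[OF unif.prob_space_axioms section_borel[OF r W(2,3) f x] f(2)])
    qed
    then have "(\<integral>\<^sup>+x. \<integral>\<^sup>+u. F (x(j := r (x i) u)) \<partial>unif \<partial>P) = (\<integral>\<^sup>+x. ennreal (leaf_integral r i j f x + c) \<partial>P)"
      by (rule nn_integral_cong)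
    also have "\<dots> = ennreal ((\<integral>x. leaf_integral r i j f x \<partial>P) + c)"
      by (rule nn_integral_shift(1)[OF P(1)])
         (use leaf_integral_borel[OF r W(2,3) f] leaf_integral_bound[OF r W(2,3) f] in
           \<open>auto simp: P(2) cong: measurable_cong_sets\<close>)
    finally show ?thesis .
  qed
  have pos: "0 \<le> (\<integral>x. leaf_integral r i j f x \<partial>P) + c"
    if r: "(\<lambda>(x, u). r x u) \<in> borel_measurable (borel \<Otimes>\<^sub>M borel)" for r
    by (rule nn_integral_shift(2)[OF P(1)])
       (use leaf_integral_borel[OF r W(2,3) f] leaf_integral_bound[OF r W(2,3) f] in
         \<open>auto simp: P(2) cong: measurable_cong_sets\<close>)
  note D = leaf_disintegration[OF dis P.prob_space_axioms sets_P marg(1) q(1) W F]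
    leaf_disintegration(1)[OF dis Q.prob_space_axioms sets_Q marg(2) q(2) W F]
  have "(\<integral>\<^sup>+x. \<integral>\<^sup>+u. F (x(j := q (x i) u)) \<partial>unif \<partial>P) \<le> (\<integral>\<^sup>+x. \<integral>\<^sup>+u. F (x(j := q' (x i) u)) \<partial>unif \<partial>P)"
    unfolding D(1,3)
  proof (rule nn_integral_mono)
    fix \<omega> assume \<omega>: "\<omega> \<in> space (Pi\<^sub>M W (\<lambda>_. unif))"
    define \<phi> where "\<phi> x y = f ((\<Psi> x \<omega>)(j := y))" for x y
    have \<Psi>_PiE: "\<Psi> x \<omega> \<in> (\<Pi>\<^sub>E l\<in>W. UNIV)" for x
      using measurable_space[OF \<Psi>(1), of "(x, \<omega>)"] \<omega> by (simp add: space_pair_measure space_PiM)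
    have "(\<lambda>z. F ((\<Psi> (fst z) \<omega>)(j := snd z))) \<in> borel_measurable (borel \<Otimes>\<^sub>M borel)"
    proof -
      have "(\<lambda>z. (z, \<omega>)) \<in> borel \<Otimes>\<^sub>M borel \<rightarrow>\<^sub>M ((borel :: real measure) \<Otimes>\<^sub>M (borel :: real measure)) \<Otimes>\<^sub>M Pi\<^sub>M W (\<lambda>_. unif)"
        using \<omega> by measurable
      from measurable_compose[OF this D(2)] show ?thesis by simp
    qed
    then have "(\<lambda>z. enn2real (F ((\<Psi> (fst z) \<omega>)(j := snd z))) - c) \<in> borel_measurable (borel \<Otimes>\<^sub>M borel)"
      by measurable
    moreover have "enn2real (F x) - c = f x" for x
    proof -
      have "0 \<le> f x + c" using f(2)[of x] by linarith
      then show ?thesis by (simp add: F_def)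
    qed
    ultimately have \<phi>_borel: "(\<lambda>z. \<phi> (fst z) (snd z)) \<in> borel_measurable borel"
      unfolding \<phi>_def by (simp add: borel_prod)
    have \<phi>_bound: "\<bar>\<phi> x y\<bar> \<le> c" for x y unfolding \<phi>_def by (rule f(2))
    have \<phi>_sm: "\<phi> x y' + \<phi> x' y \<le> \<phi> x y + \<phi> x' y'" if "x \<le> x'" "y \<le> y'" for x x' y y'
    proof -
      have "inf ((\<Psi> x \<omega>)(j := y')) ((\<Psi> x' \<omega>)(j := y)) = (\<Psi> x \<omega>)(j := y)"
           "sup ((\<Psi> x \<omega>)(j := y')) ((\<Psi> x' \<omega>)(j := y)) = (\<Psi> x' \<omega>)(j := y')"
        using \<Psi>(2)[OF that(1), of \<omega>] that(2)
        by (auto simp: fun_eq_iff le_fun_def inf_absorb1 inf_absorb2 sup_absorb1 sup_absorb2)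
      then show ?thesis
        using sm update_PiE[OF \<Psi>_PiE[of x], of j y']
          update_PiE[OF \<Psi>_PiE[of x'], of j y]
        unfolding supermodular_def \<phi>_def by metis
    qed
    have "(\<integral>z. \<phi> (fst z) (snd z) \<partial>\<nu>) \<le> (\<integral>z. \<phi> (fst z) (snd z) \<partial>\<nu>')"
      by (rule supermodular_le[OF \<phi>_borel \<phi>_bound \<phi>_sm])
    moreover have "(\<integral>\<^sup>+z. F ((\<Psi> (fst z) \<omega>)(j := snd z)) \<partial>\<nu>) = ennreal ((\<integral>z. \<phi> (fst z) (snd z) \<partial>\<nu>) + c)"
      "(\<integral>\<^sup>+z. F ((\<Psi> (fst z) \<omega>)(j := snd z)) \<partial>\<nu>') = ennreal ((\<integral>z. \<phi> (fst z) (snd z) \<partial>\<nu>') + c)"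
      unfolding F_def \<phi>_def[symmetric]
      by (rule nn_integral_shift(1)[OF P.prob_space_axioms]; use \<phi>_borel \<phi>_bound in simp)
         (rule nn_integral_shift(1)[OF Q.prob_space_axioms]; use \<phi>_borel \<phi>_bound in simp)
    ultimately show "(\<integral>\<^sup>+z. F ((\<Psi> (fst z) \<omega>)(j := snd z)) \<partial>\<nu>) \<le> (\<integral>\<^sup>+z. F ((\<Psi> (fst z) \<omega>)(j := snd z)) \<partial>\<nu>')"
      by (simp add: ennreal_leI)
  qed
  then show ?thesis
    unfolding eq[OF mono_kernel_facts(1)[OF q(1)]] eq[OF mono_kernel_facts(1)[OF q(2)]]
    using pos[OF mono_kernel_facts(1)[OF q(2)]] by (simp add: ennreal_le_iff)
qed

context tree_law
begin

lemma root_disintegration: "mono_disintegration {0} 0 (\<mu> 0) (P {0}) (\<lambda>x _. \<lambda>l\<in>{0}. x)"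
proof -
  note [measurable_cong] = \<mu>_sets
  interpret \<Omega>: prob_space "Pi\<^sub>M {0 :: nat} (\<lambda>_. unif)" by (rule prob_space_PiM) (rule unif.prob_space_axioms)
  have m: "(\<lambda>t. \<lambda>l\<in>{0}. t) \<in> \<mu> 0 \<rightarrow>\<^sub>M Pi\<^sub>M {0 :: nat} (\<lambda>_. borel :: real measure)"
    by (rule measurable_restrict) measurable
  have "(\<lambda>(x, \<omega>). \<lambda>l\<in>{0}. x) \<in> borel \<Otimes>\<^sub>M Pi\<^sub>M {0} (\<lambda>_. unif) \<rightarrow>\<^sub>M Pi\<^sub>M {0 :: nat} (\<lambda>_. borel :: real measure)"
    unfolding case_prod_beta by (rule measurable_restrict) measurable
  moreover have "(\<lambda>l\<in>{0 :: nat}. x) \<le> (\<lambda>l\<in>{0}. x')" if "x \<le> x'" for x x' :: real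
    using that by (auto simp: le_fun_def)
  moreover have "(\<integral>\<^sup>+x. f x \<partial>P {0}) = (\<integral>\<^sup>+x. (\<integral>\<^sup>+\<omega>. f (\<lambda>l\<in>{0}. x) \<partial>(Pi\<^sub>M {0 :: nat} (\<lambda>_. unif))) \<partial>\<mu> 0)"
    if "f \<in> borel_measurable (Pi\<^sub>M {0} (\<lambda>_. borel))" for f
    unfolding P_root using that by (subst nn_integral_distr[OF m]) (auto simp: \<Omega>.emeasure_space_1)
  ultimately show ?thesis unfolding mono_disintegration_def by auto
qed

context
  fixes W i j q
  assumes W: "subtree E W" "i \<in> W" "(i, j) \<in> E" "j \<notin> W" and q: "mono_kernel (\<nu> (i, j)) q"
begin

private lemma restrict_borel: "(\<lambda>w. restrict (snd w) W) \<in> (borel :: real measure) \<Otimes>\<^sub>M Pi\<^sub>M (insert j W) (\<lambda>_. unif) \<rightarrow>\<^sub>M Pi\<^sub>M W (\<lambda>_. unif)"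
  by (rule measurable_compose[OF measurable_snd measurable_restrict_subset]) auto

private lemma coord_borel: "(\<lambda>w. snd w j) \<in> (borel :: real measure) \<Otimes>\<^sub>M Pi\<^sub>M (insert j W) (\<lambda>_. unif) \<rightarrow>\<^sub>M unif"
  by (rule measurable_compose[OF measurable_snd measurable_component_singleton]) auto

private lemma restrict_update: "w \<in> space (Pi\<^sub>M W (\<lambda>_. unif)) \<Longrightarrow> restrict (w(j := u)) W = w"
  using W(4) by (auto simp: space_PiM PiE_iff extensional_def fun_eq_iff)

text \<open>When the conditioning node \<open>k\<close> is an old one, the new leaf is a composition
  of increasing maps of its value, driven by the fresh uniform variable
  \<open>\<omega> j\<close>.\<close>

lemma disintegration_insert:
  assumes dis: "mono_disintegration W k \<mu>' (P W) \<Psi>" and "k \<in> W" and \<mu>': "sets \<mu>' = sets borel"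
  shows "mono_disintegration (insert j W) k \<mu>' (P (insert j W))
    (\<lambda>x \<omega>. (\<Psi> x (restrict \<omega> W))(j := q (\<Psi> x (restrict \<omega> W) i) (\<omega> j)))" (is "mono_disintegration _ _ _ _ ?\<Psi>")
  unfolding mono_disintegration_def
proof (intro conjI allI impI ballI)
  note \<Psi> = mono_disintegration_facts[OF dis] and qf = mono_kernel_facts[OF q]
  have up: "(\<lambda>(x, u). x(j := q (x i) u)) \<in> Pi\<^sub>M W (\<lambda>_. borel) \<Otimes>\<^sub>M unif \<rightarrow>\<^sub>M Pi\<^sub>M (insert j W) (\<lambda>_. borel)"
    by (rule kernel_update_measurable[OF qf(1) W(2)])
  have 1: "(\<lambda>w. \<Psi> (fst w) (restrict (snd w) W)) \<in> borel \<Otimes>\<^sub>M Pi\<^sub>M (insert j W) (\<lambda>_. unif) \<rightarrow>\<^sub>M Pi\<^sub>M W (\<lambda>_. borel)"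
    using measurable_compose[OF measurable_Pair[OF measurable_fst restrict_borel] \<Psi>(1)] by simp
  show m: "(\<lambda>(x, \<omega>). ?\<Psi> x \<omega>) \<in> borel \<Otimes>\<^sub>M Pi\<^sub>M (insert j W) (\<lambda>_. unif) \<rightarrow>\<^sub>M Pi\<^sub>M (insert j W) (\<lambda>_. borel)"
    using measurable_compose[OF measurable_Pair[OF 1 coord_borel] up] by (simp add: case_prod_beta)
  show "?\<Psi> x \<omega> \<le> ?\<Psi> x' \<omega>" if "x \<le> x'" for \<omega> x x'
    using \<Psi>(2)[OF that, of "restrict \<omega> W"] qf(2) by (auto simp: le_fun_def)
  show "?\<Psi> x \<omega> k = x" for \<omega> x using \<Psi>(3) \<open>k \<in> W\<close> W(4) by auto
  fix f :: "(nat \<Rightarrow> real) \<Rightarrow> ennreal" assume f: "f \<in> borel_measurable (Pi\<^sub>M (insert j W) (\<lambda>_. borel))"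
  have F: "(\<lambda>x. \<integral>\<^sup>+u. f (x(j := q (x i) u)) \<partial>unif) \<in> borel_measurable (Pi\<^sub>M W (\<lambda>_. borel))"
    using measurable_compose[OF up f]
    by (intro unif.borel_measurable_nn_integral) (simp add: case_prod_beta)
  have "(\<integral>\<^sup>+x. f x \<partial>P (insert j W)) = (\<integral>\<^sup>+x. \<integral>\<^sup>+u. f (x(j := q (x i) u)) \<partial>unif \<partial>P W)"
    by (rule nn_integral_insert[OF W q f])
  also have "\<dots> = (\<integral>\<^sup>+x. (\<integral>\<^sup>+w. (\<integral>\<^sup>+u. f ((\<Psi> x w)(j := q (\<Psi> x w i) u)) \<partial>unif) \<partial>(Pi\<^sub>M W (\<lambda>_. unif))) \<partial>\<mu>')"
    by (rule \<Psi>(4)[OF F])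
  also have "\<dots> = (\<integral>\<^sup>+x. (\<integral>\<^sup>+w. f (?\<Psi> x w) \<partial>(Pi\<^sub>M (insert j W) (\<lambda>_. unif))) \<partial>\<mu>')"
  proof (rule nn_integral_cong)
    fix x
    have "(\<lambda>w. (x, w)) \<in> Pi\<^sub>M (insert j W) (\<lambda>_. unif) \<rightarrow>\<^sub>M (borel :: real measure) \<Otimes>\<^sub>M Pi\<^sub>M (insert j W) (\<lambda>_. unif)" by measurable
    from measurable_compose[OF measurable_compose[OF this m] f]
    have "(\<lambda>w. f (?\<Psi> x w)) \<in> borel_measurable (Pi\<^sub>M (insert j W) (\<lambda>_. unif))" by simp
    note Pi_unif_insert[OF subtree_finite[OF W(1)] W(4) this]
    then have "(\<integral>\<^sup>+w. f (?\<Psi> x w) \<partial>(Pi\<^sub>M (insert j W) (\<lambda>_. unif)))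
        = (\<integral>\<^sup>+w. (\<integral>\<^sup>+u. f (?\<Psi> x (w(j := u))) \<partial>unif) \<partial>(Pi\<^sub>M W (\<lambda>_. unif)))" .
    also have "\<dots> = (\<integral>\<^sup>+w. (\<integral>\<^sup>+u. f ((\<Psi> x w)(j := q (\<Psi> x w i) u)) \<partial>unif) \<partial>(Pi\<^sub>M W (\<lambda>_. unif)))"
      by (rule nn_integral_cong) (simp only: restrict_update fun_upd_same)
    finally show "(\<integral>\<^sup>+w. (\<integral>\<^sup>+u. f ((\<Psi> x w)(j := q (\<Psi> x w i) u)) \<partial>unif) \<partial>(Pi\<^sub>M W (\<lambda>_. unif)))
        = (\<integral>\<^sup>+w. f (?\<Psi> x w) \<partial>(Pi\<^sub>M (insert j W) (\<lambda>_. unif)))" by simp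
  qed
  finally show "(\<integral>\<^sup>+x. f x \<partial>P (insert j W)) = (\<integral>\<^sup>+x. (\<integral>\<^sup>+w. f (?\<Psi> x w) \<partial>(Pi\<^sub>M (insert j W) (\<lambda>_. unif))) \<partial>\<mu>')" .
qed

text \<open>When the new leaf itself is the conditioning node, coordinate \<open>i\<close> is
  resampled from the leaf value \<open>y\<close> as \<open>r y (\<omega> j)\<close>, and the old
  disintegration is evaluated there. The variable \<open>\<omega> j\<close> is free for this purpose
  because the leaf is now given.\<close>

lemma disintegration_reverse:
  assumes dis: "mono_disintegration W i (\<mu> i) (P W) \<Psi>" and r: "mono_kernel (distr (\<nu> (i, j)) borel prod.swap) r"
  shows "mono_disintegration (insert j W) j (\<mu> j) (P (insert j W))
    (\<lambda>y \<omega>. (\<Psi> (r y (\<omega> j)) (restrict \<omega> W))(j := y))" (is "mono_disintegration _ _ _ _ ?\<Psi>")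
  unfolding mono_disintegration_def
proof (intro conjI allI impI ballI)
  let ?\<Omega> = "Pi\<^sub>M W (\<lambda>_ :: nat. unif)"
  note \<Psi> = mono_disintegration_facts[OF dis] and qf = mono_kernel_facts[OF q] and rf = mono_kernel_facts[OF r]
  interpret \<nu>: prob_space "\<nu> (i, j)" by (rule \<nu>_prob[OF W(3)])
  note [measurable_cong] = \<nu>_sets[OF W(3)] \<mu>_sets
  interpret \<mu>j: prob_space "\<mu> j" by (rule \<mu>_prob)
  interpret \<Omega>: prob_space ?\<Omega> by (rule prob_space_PiM) (rule unif.prob_space_axioms)
  interpret \<mu>\<Omega>: pair_sigma_finite "\<mu> j" ?\<Omega> ..
  have r1: "(\<lambda>w. r (fst w) (snd w j)) \<in> borel_measurable (borel \<Otimes>\<^sub>M Pi\<^sub>M (insert j W) (\<lambda>_. unif))"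
  proof -
    have "(\<lambda>w. (fst w, snd w j)) \<in> borel \<Otimes>\<^sub>M Pi\<^sub>M (insert j W) (\<lambda>_. unif) \<rightarrow>\<^sub>M (borel :: real measure) \<Otimes>\<^sub>M (borel :: real measure)"
      using coord_borel by (intro measurable_Pair measurable_fst) (simp cong: measurable_cong_sets)
    from measurable_compose[OF this rf(1)] show ?thesis by simp
  qed
  have 1: "(\<lambda>w. \<Psi> (r (fst w) (snd w j)) (restrict (snd w) W)) \<in> borel \<Otimes>\<^sub>M Pi\<^sub>M (insert j W) (\<lambda>_. unif) \<rightarrow>\<^sub>M Pi\<^sub>M W (\<lambda>_. borel)"
    using measurable_compose[OF measurable_Pair[OF r1 restrict_borel] \<Psi>(1)] by simp
  show m: "(\<lambda>(x, \<omega>). ?\<Psi> x \<omega>) \<in> borel \<Otimes>\<^sub>M Pi\<^sub>M (insert j W) (\<lambda>_. unif) \<rightarrow>\<^sub>M Pi\<^sub>M (insert j W) (\<lambda>_. borel)"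
    unfolding case_prod_beta by (rule measurable_fun_upd[OF _ 1]) auto
  show "?\<Psi> x \<omega> \<le> ?\<Psi> x' \<omega>" if "x \<le> x'" for \<omega> x x'
    using \<Psi>(2)[OF rf(2)[OF that, of "\<omega> j"], of "restrict \<omega> W"] that by (auto simp: le_fun_def)
  show "?\<Psi> x \<omega> j = x" for \<omega> x by simp
  fix f :: "(nat \<Rightarrow> real) \<Rightarrow> ennreal" assume f: "f \<in> borel_measurable (Pi\<^sub>M (insert j W) (\<lambda>_. borel))"
  note D = leaf_disintegration[OF dis \<nu>_prob[OF W(3)] \<nu>_sets[OF W(3)] \<nu>_fst[OF W(3)] q subtree_finite[OF W(1)] W(2,4) f]
  have fst_swap: "distr (distr (\<nu> (i, j)) borel prod.swap) borel fst = \<mu> j"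
  proof -
    have [measurable]: "prod.swap \<in> \<nu> (i, j) \<rightarrow>\<^sub>M (borel :: (real \<times> real) measure)"
      unfolding prod.swap_def borel_prod[symmetric] by measurable
    show ?thesis
      unfolding \<nu>_snd[OF W(3), symmetric] by (subst distr_distr) (auto simp: comp_def)
  qed
  have sw: "prod.swap \<in> \<nu> (i, j) \<rightarrow>\<^sub>M (borel :: (real \<times> real) measure)"
    unfolding prod.swap_def borel_prod[symmetric] by measurable
  have mr: "(\<lambda>(y, u). (y, r y u)) \<in> \<mu> j \<Otimes>\<^sub>M unif \<rightarrow>\<^sub>M borel"
    using rf(1) unfolding borel_prod[symmetric] by measurable
  have "(\<integral>\<^sup>+x. f x \<partial>P (insert j W)) = (\<integral>\<^sup>+x. \<integral>\<^sup>+u. f (x(j := q (x i) u)) \<partial>unif \<partial>P W)"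
    by (rule nn_integral_insert[OF W q f])
  also have "\<dots> = (\<integral>\<^sup>+w. (\<integral>\<^sup>+z. f ((\<Psi> (fst z) w)(j := snd z)) \<partial>\<nu> (i, j)) \<partial>?\<Omega>)"
    by (rule D(1))
  also have "\<dots> = (\<integral>\<^sup>+w. (\<integral>\<^sup>+y. (\<integral>\<^sup>+u. f ((\<Psi> (r y u) w)(j := y)) \<partial>unif) \<partial>\<mu> j) \<partial>?\<Omega>)"
  proof (rule nn_integral_cong)
    fix w assume w: "w \<in> space ?\<Omega>"
    have "(\<lambda>z. (z, w)) \<in> borel \<Otimes>\<^sub>M borel \<rightarrow>\<^sub>M ((borel :: real measure) \<Otimes>\<^sub>M (borel :: real measure)) \<Otimes>\<^sub>M ?\<Omega>"
      using w by measurable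
    from measurable_compose[OF this D(2)]
    have s: "(\<lambda>z. f ((\<Psi> (fst z) w)(j := snd z))) \<in> borel_measurable borel" by (simp add: borel_prod)
    have s': "(\<lambda>z. f ((\<Psi> (snd z) w)(j := fst z))) \<in> borel_measurable borel"
    proof -
      have "prod.swap \<in> borel \<rightarrow>\<^sub>M (borel :: (real \<times> real) measure)"
        unfolding prod.swap_def borel_prod[symmetric] by measurable
      from measurable_compose[OF this s] show ?thesis by simp
    qed
    have "(\<integral>\<^sup>+z. f ((\<Psi> (fst z) w)(j := snd z)) \<partial>\<nu> (i, j))
        = (\<integral>\<^sup>+z. f ((\<Psi> (snd z) w)(j := fst z)) \<partial>distr (\<nu> (i, j)) borel prod.swap)"
      using s' by (subst nn_integral_distr[OF sw]) auto
    also have "\<dots> = (\<integral>\<^sup>+z. f ((\<Psi> (snd z) w)(j := fst z)) \<partial>distr (\<mu> j \<Otimes>\<^sub>M unif) borel (\<lambda>(y, u). (y, r y u)))"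
      using rf(4) unfolding fst_swap by simp
    also have "\<dots> = (\<integral>\<^sup>+z. f ((\<Psi> (r (fst z) (snd z)) w)(j := fst z)) \<partial>(\<mu> j \<Otimes>\<^sub>M unif))"
      using s' by (subst nn_integral_distr[OF mr]) (simp_all add: case_prod_beta)
    also have "\<dots> = (\<integral>\<^sup>+y. (\<integral>\<^sup>+u. f ((\<Psi> (r y u) w)(j := y)) \<partial>unif) \<partial>\<mu> j)"
      by (subst unif.nn_integral_fst[symmetric])
         (use measurable_compose[OF mr s'] in \<open>auto simp: case_prod_beta\<close>)
    finally show "(\<integral>\<^sup>+z. f ((\<Psi> (fst z) w)(j := snd z)) \<partial>\<nu> (i, j))
        = (\<integral>\<^sup>+y. (\<integral>\<^sup>+u. f ((\<Psi> (r y u) w)(j := y)) \<partial>unif) \<partial>\<mu> j)" .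
  qed
  also have "\<dots> = (\<integral>\<^sup>+y. (\<integral>\<^sup>+w. (\<integral>\<^sup>+u. f ((\<Psi> (r y u) w)(j := y)) \<partial>unif) \<partial>?\<Omega>) \<partial>\<mu> j)"
  proof (rule \<mu>\<Omega>.Fubini')
    have "(\<lambda>v. ((r (fst (fst v)) (snd v), fst (fst v)), snd (fst v)))
        \<in> (\<mu> j \<Otimes>\<^sub>M ?\<Omega>) \<Otimes>\<^sub>M unif \<rightarrow>\<^sub>M ((borel :: real measure) \<Otimes>\<^sub>M (borel :: real measure)) \<Otimes>\<^sub>M ?\<Omega>"
    proof -
      have "(\<lambda>v. (fst (fst v), snd v)) \<in> (\<mu> j \<Otimes>\<^sub>M ?\<Omega>) \<Otimes>\<^sub>M unif \<rightarrow>\<^sub>M (borel :: real measure) \<Otimes>\<^sub>M (borel :: real measure)"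
        by measurable
      from measurable_compose[OF this rf(1)]
      have [measurable]: "(\<lambda>v. r (fst (fst v)) (snd v)) \<in> borel_measurable ((\<mu> j \<Otimes>\<^sub>M ?\<Omega>) \<Otimes>\<^sub>M unif)" by simp
      show ?thesis by measurable
    qed
    from measurable_compose[OF this D(2)]
    show "(\<lambda>(y, w). \<integral>\<^sup>+u. f ((\<Psi> (r y u) w)(j := y)) \<partial>unif) \<in> borel_measurable (\<mu> j \<Otimes>\<^sub>M ?\<Omega>)"
      unfolding case_prod_beta by (intro unif.borel_measurable_nn_integral) (simp add: case_prod_beta)
  qed
  also have "\<dots> = (\<integral>\<^sup>+y. (\<integral>\<^sup>+w. f (?\<Psi> y w) \<partial>(Pi\<^sub>M (insert j W) (\<lambda>_. unif))) \<partial>\<mu> j)"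
  proof (rule nn_integral_cong)
    fix y
    have "(\<lambda>w. (y, w)) \<in> Pi\<^sub>M (insert j W) (\<lambda>_. unif) \<rightarrow>\<^sub>M (borel :: real measure) \<Otimes>\<^sub>M Pi\<^sub>M (insert j W) (\<lambda>_. unif)" by measurable
    from measurable_compose[OF measurable_compose[OF this m] f]
    have "(\<lambda>w. f (?\<Psi> y w)) \<in> borel_measurable (Pi\<^sub>M (insert j W) (\<lambda>_. unif))" by simp
    note Pi_unif_insert[OF subtree_finite[OF W(1)] W(4) this]
    then have "(\<integral>\<^sup>+w. f (?\<Psi> y w) \<partial>(Pi\<^sub>M (insert j W) (\<lambda>_. unif)))
        = (\<integral>\<^sup>+w. (\<integral>\<^sup>+u. f (?\<Psi> y (w(j := u))) \<partial>unif) \<partial>?\<Omega>)" .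
    also have "\<dots> = (\<integral>\<^sup>+w. (\<integral>\<^sup>+u. f ((\<Psi> (r y u) w)(j := y)) \<partial>unif) \<partial>?\<Omega>)"
      by (rule nn_integral_cong) (simp only: restrict_update fun_upd_same)
    finally show "(\<integral>\<^sup>+w. (\<integral>\<^sup>+u. f ((\<Psi> (r y u) w)(j := y)) \<partial>unif) \<partial>?\<Omega>)
        = (\<integral>\<^sup>+w. f (?\<Psi> y w) \<partial>(Pi\<^sub>M (insert j W) (\<lambda>_. unif)))" by simp
  qed
  finally show "(\<integral>\<^sup>+x. f x \<partial>P (insert j W)) = (\<integral>\<^sup>+y. (\<integral>\<^sup>+w. f (?\<Psi> y w) \<partial>(Pi\<^sub>M (insert j W) (\<lambda>_. unif))) \<partial>\<mu> j)" .
qed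

end

end

locale CI_tree_law = tree_law +
  assumes swap_kernel: "e \<in> E \<Longrightarrow> \<exists>q. mono_kernel (distr (\<nu> e) borel prod.swap) q"
begin

text \<open>The edges between \<open>k\<close> and the root use the reversed kernels, all others the
  forward ones. This is where monotonicity in both directions is needed.\<close>

lemma ex_mono_disintegration:
  assumes "subtree E W" "k \<in> W"
  shows "\<exists>\<Psi>. mono_disintegration W k (\<mu> k) (P W) \<Psi>"
  using assms
proof (induction arbitrary: k rule: subtree.induct)
  case root
  then show ?case using root_disintegration by auto
next
  case (leaf W i j)
  obtain q r where qr: "mono_kernel (\<nu> (i, j)) q" "mono_kernel (distr (\<nu> (i, j)) borel prod.swap) r"
    using kernel swap_kernel leaf(3) by blast
  show ?case
  proof (cases "k = j")
    case True
    then show ?thesis using leaf.IH[OF leaf(2)] disintegration_reverse[OF leaf(1-4) qr(1) _ qr(2)] by blast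
  next
    case False
    then show ?thesis
      using leaf.IH[of k] leaf.prems disintegration_insert[OF leaf(1-4) qr(1) _ _ \<mu>_sets] by blast
  qed
qed

end

section \<open>Comparison of the two tree laws\<close>

lemma tree_law_supermodular_le:
  assumes P: "tree_law E \<mu> \<nu> P" and Q: "CI_tree_law E \<mu> \<nu>' Q" and W: "subtree E W"
    and le: "\<And>e x y. e \<in> E \<Longrightarrow> measure (\<nu> e) ({..x} \<times> {..y}) \<le> measure (\<nu>' e) ({..x} \<times> {..y})"
    and f: "f \<in> borel_measurable (Pi\<^sub>M W (\<lambda>_. borel))" "\<And>x. \<bar>f x\<bar> \<le> c" "supermodular W f"
  shows "(\<integral>x. f x \<partial>P W) \<le> (\<integral>x. f x \<partial>Q W)"
proof -
  interpret P: tree_law E \<mu> \<nu> P by fact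
  interpret Q: CI_tree_law E \<mu> \<nu>' Q by fact
  show ?thesis using W f
  proof (induction arbitrary: f rule: subtree.induct)
    case root
    then show ?case by (simp add: P.integral_root Q.integral_root)
  next
    case (leaf W i j)
    obtain q q' where q: "mono_kernel (\<nu> (i, j)) q" "mono_kernel (\<nu>' (i, j)) q'"
      using P.kernel Q.kernel leaf(3) by blast
    note qf = mono_kernel_facts[OF q(1)]
    obtain \<Psi> where \<Psi>: "mono_disintegration W i (\<mu> i) (Q W) \<Psi>" using Q.ex_mono_disintegration leaf by blast
    have pair: "lo_ordered_pair (\<nu> (i, j)) (\<nu>' (i, j))"
      using leaf(3) le
      by (intro lo_ordered_pair.intro lo_ordered_pair_axioms.intro)
         (auto simp: P.\<nu>_prob Q.\<nu>_prob P.\<nu>_sets Q.\<nu>_sets P.\<nu>_fst Q.\<nu>_fst P.\<nu>_snd Q.\<nu>_snd)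
    have "(\<integral>x. f x \<partial>P (insert j W)) = (\<integral>x. leaf_integral q i j f x \<partial>P W)"
      by (rule P.integral_insert[OF leaf(1-4) q(1) leaf.prems(1,2)])
    also have "\<dots> \<le> (\<integral>x. leaf_integral q i j f x \<partial>Q W)"
      by (intro leaf.IH leaf_integral_borel[OF qf(1) leaf(2,4) leaf.prems(1,2)]
        leaf_integral_bound[OF qf(1) leaf(2,4) leaf.prems(1,2)]
        leaf_integral_supermodular[OF qf(1) leaf(2,4) leaf.prems(1,2,3) qf(2)])
    also have "\<dots> \<le> (\<integral>x. leaf_integral q' i j f x \<partial>Q W)"
      by (rule leaf_integral_le[OF \<Psi> Q.P_prob[OF leaf(1)] Q.P_sets[OF leaf(1)] pair P.\<nu>_fst[OF leaf(3)]
        Q.\<nu>_fst[OF leaf(3)] q subtree_finite[OF leaf(1)] leaf(2,4) leaf.prems(1,2,3)])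
    also have "\<dots> = (\<integral>x. f x \<partial>Q (insert j W))"
      by (rule Q.integral_insert[OF leaf(1-4) q(2) leaf.prems(1,2), symmetric])
    finally show ?case .
  qed
qed

text \<open>Compared with the previous lemma the copula of the new edge is exchanged first. The
  exchange thus again takes place under \<open>Q\<close>, and the function handed to the induction
  hypothesis is again formed with the kernel of \<open>\<nu>\<close>.\<close>

lemma tree_law_supermodular_ge:
  assumes P: "tree_law E \<mu> \<nu> P" and Q: "CI_tree_law E \<mu> \<nu>' Q" and W: "subtree E W"
    and le: "\<And>e x y. e \<in> E \<Longrightarrow> measure (\<nu>' e) ({..x} \<times> {..y}) \<le> measure (\<nu> e) ({..x} \<times> {..y})"
    and f: "f \<in> borel_measurable (Pi\<^sub>M W (\<lambda>_. borel))" "\<And>x. \<bar>f x\<bar> \<le> c" "supermodular W f"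
  shows "(\<integral>x. f x \<partial>Q W) \<le> (\<integral>x. f x \<partial>P W)"
proof -
  interpret P: tree_law E \<mu> \<nu> P by fact
  interpret Q: CI_tree_law E \<mu> \<nu>' Q by fact
  show ?thesis using W f
  proof (induction arbitrary: f rule: subtree.induct)
    case root
    then show ?case by (simp add: P.integral_root Q.integral_root)
  next
    case (leaf W i j)
    obtain q q' where q: "mono_kernel (\<nu> (i, j)) q" "mono_kernel (\<nu>' (i, j)) q'"
      using P.kernel Q.kernel leaf(3) by blast
    note qf = mono_kernel_facts[OF q(1)]
    obtain \<Psi> where \<Psi>: "mono_disintegration W i (\<mu> i) (Q W) \<Psi>" using Q.ex_mono_disintegration leaf by blast
    have pair: "lo_ordered_pair (\<nu>' (i, j)) (\<nu> (i, j))"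
      using leaf(3) le
      by (intro lo_ordered_pair.intro lo_ordered_pair_axioms.intro)
         (auto simp: P.\<nu>_prob Q.\<nu>_prob P.\<nu>_sets Q.\<nu>_sets P.\<nu>_fst Q.\<nu>_fst P.\<nu>_snd Q.\<nu>_snd)
    have "(\<integral>x. f x \<partial>Q (insert j W)) = (\<integral>x. leaf_integral q' i j f x \<partial>Q W)"
      by (rule Q.integral_insert[OF leaf(1-4) q(2) leaf.prems(1,2)])
    also have "\<dots> \<le> (\<integral>x. leaf_integral q i j f x \<partial>Q W)"
      by (rule leaf_integral_le[OF \<Psi> Q.P_prob[OF leaf(1)] Q.P_sets[OF leaf(1)] pair Q.\<nu>_fst[OF leaf(3)]
        P.\<nu>_fst[OF leaf(3)] q(2,1) subtree_finite[OF leaf(1)] leaf(2,4) leaf.prems(1,2,3)])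
    also have "\<dots> \<le> (\<integral>x. leaf_integral q i j f x \<partial>P W)"
      by (intro leaf.IH leaf_integral_borel[OF qf(1) leaf(2,4) leaf.prems(1,2)]
        leaf_integral_bound[OF qf(1) leaf(2,4) leaf.prems(1,2)]
        leaf_integral_supermodular[OF qf(1) leaf(2,4) leaf.prems(1,2,3) qf(2)])
    also have "\<dots> = (\<integral>x. f x \<partial>P (insert j W))"
      by (rule P.integral_insert[OF leaf(1-4) q(1) leaf.prems(1,2), symmetric])
    finally show ?case .
  qed
qed

section \<open>From bounded to integrable functions\<close>

text \<open>The exceptional points form a lower set, which is a countable union of closed rays; each
  ray ends at an exceptional point and is therefore null.\<close>

lemma AE_measure_atMost_pos:
  assumes "prob_space \<mu>" and sets [measurable_cong]: "sets \<mu> = sets borel"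
  shows "AE t in \<mu>. 0 < measure \<mu> {..t :: real}"
proof -
  interpret prob_space \<mu> by fact
  define Z where "Z = {t. measure \<mu> {..t} = 0}"
  have "Z \<in> null_sets \<mu>"
  proof (cases "Z = {}")
    case False
    have "y \<in> Z" if "x \<in> Z" "y \<le> x" for x y
    proof -
      have "measure \<mu> {..y} \<le> measure \<mu> {..x}" using that by (intro finite_measure_mono) auto
      then show ?thesis using that measure_nonneg[of \<mu> "{..y}"] unfolding Z_def mem_Collect_eq by linarith
    qed
    then have "\<exists>s. incseq s \<and> Z = (\<Union>n. {..s n :: real})" by (rule lower_set_seq) (use False in auto)
    then obtain s :: "nat \<Rightarrow> real" where s: "Z = (\<Union>n. {..s n})" by blast
    have "{..s n} \<in> null_sets \<mu>" for n
    proof -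
      have "s n \<in> Z" unfolding s by auto
      then show ?thesis by (auto simp: Z_def emeasure_eq_measure)
    qed
    then show ?thesis unfolding s by (intro null_sets_UN) auto
  qed auto
  from AE_not_in[OF this] show ?thesis
    by eventually_elim (simp add: Z_def order_less_le)
qed

lemma AE_measure_atLeast_pos:
  assumes "prob_space \<mu>" and sets [measurable_cong]: "sets \<mu> = sets borel"
  shows "AE t in \<mu>. 0 < measure \<mu> {t :: real..}"
proof -
  interpret prob_space \<mu> by fact
  let ?D = "distr \<mu> borel uminus"
  have m: "measure ?D {..- t} = measure \<mu> {t..}" for t
    using sets_eq_imp_space_eq[OF sets] by (subst measure_distr) (auto intro!: arg_cong[of _ _ "measure \<mu>"])
  have "AE t in ?D. 0 < measure ?D {..t}"
    by (rule AE_measure_atMost_pos) (auto intro: prob_space_distr)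
  then have "AE t in \<mu>. 0 < measure ?D {..- t}" by (rule AE_distrD[rotated]) measurable
  then show ?thesis unfolding m .
qed

text \<open>With coordinate \<open>i\<close> split off, Fubini gives integrable sections for almost
  all values of the remaining coordinates. The section overwrites coordinate \<open>i\<close>, so
  this lifts to almost every \<open>y\<close> of the full product.\<close>

lemma AE_section_integrable:
  fixes \<mu> :: "nat \<Rightarrow> real measure" and f :: "(nat \<Rightarrow> real) \<Rightarrow> real"
  assumes \<mu>: "\<And>n. prob_space (\<mu> n)" and fin: "finite I" and i: "i \<in> I"
    and f: "integrable (Pi\<^sub>M I \<mu>) f"
  shows "AE y in Pi\<^sub>M I \<mu>. integrable (\<mu> i) (\<lambda>t. f (y(i := t)))"
proof -
  interpret product_prob_space \<mu> UNIV using \<mu> by (simp add: product_prob_spaceI)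
  define J where "J = I - {i}"
  have I: "I = insert i J" "i \<notin> J" "finite J" using i fin by (auto simp: J_def)
  interpret J: prob_space "Pi\<^sub>M J \<mu>" by (rule prob_space_PiM) (rule \<mu>)
  interpret J\<mu>: pair_sigma_finite "Pi\<^sub>M J \<mu>" "\<mu> i" ..
  interpret \<mu>J: pair_sigma_finite "\<mu> i" "Pi\<^sub>M J \<mu>" ..
  have m: "(\<lambda>(x, X). X(i := x)) \<in> \<mu> i \<Otimes>\<^sub>M Pi\<^sub>M J \<mu> \<rightarrow>\<^sub>M Pi\<^sub>M (insert i J) \<mu>" by measurable
  have "distr (\<mu> i \<Otimes>\<^sub>M Pi\<^sub>M J \<mu>) (Pi\<^sub>M (insert i J) \<mu>) (\<lambda>(x, X). X(i := x)) = Pi\<^sub>M (insert i J) \<mu>"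
    by (rule distr_pair_PiM_eq_PiM) (use \<mu> in auto)
  then have "integrable (distr (\<mu> i \<Otimes>\<^sub>M Pi\<^sub>M J \<mu>) (Pi\<^sub>M (insert i J) \<mu>) (\<lambda>(x, X). X(i := x))) f"
    using f unfolding I(1)[symmetric] by simp
  from integrable_distr[OF m this]
  have "integrable (\<mu> i \<Otimes>\<^sub>M Pi\<^sub>M J \<mu>) (\<lambda>x. f ((snd x)(i := fst x)))" by (simp only: case_prod_beta)
  then have "integrable (\<mu> i \<Otimes>\<^sub>M Pi\<^sub>M J \<mu>) (\<lambda>(x, X). f (X(i := x)))" unfolding case_prod_beta .
  from pair_sigma_finite.integrable_product_swap[OF \<mu>J.pair_sigma_finite_axioms this]
  have "integrable (Pi\<^sub>M J \<mu> \<Otimes>\<^sub>M \<mu> i) (\<lambda>w. f ((fst w)(i := snd w)))" unfolding case_prod_beta fst_conv snd_conv .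
  from J\<mu>.AE_integrable_fst'[OF this]
  have "AE X in Pi\<^sub>M J \<mu>. integrable (\<mu> i) (\<lambda>t. f (X(i := t)))" by simp
  then have "AE X in distr (Pi\<^sub>M I \<mu>) (Pi\<^sub>M J \<mu>) (\<lambda>x. restrict x J). integrable (\<mu> i) (\<lambda>t. f (X(i := t)))"
    by (subst distr_restrict[symmetric]) (use fin in \<open>auto simp: J_def\<close>)
  then have "AE y in Pi\<^sub>M I \<mu>. integrable (\<mu> i) (\<lambda>t. f ((restrict y J)(i := t)))"
    by (rule AE_distrD[rotated]) (auto intro!: measurable_restrict_subset simp: J_def)
  then show ?thesis
    using AE_space
  proof eventually_elim
    case (elim y)
    then have "(restrict y J)(i := t) = y(i := t)" for t
      by (auto simp: space_PiM PiE_iff extensional_def J_def fun_eq_iff)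
    with elim show ?case by simp
  qed
qed

section \<open>Supermodular functions vanishing on the axes through a point\<close>

context
  fixes I :: "nat set" and h :: "(nat \<Rightarrow> real) \<Rightarrow> real" and \<theta> :: "nat \<Rightarrow> real"
  assumes fin: "finite I" and sm: "supermodular I h" and \<theta>: "\<theta> \<in> (\<Pi>\<^sub>E i\<in>I. UNIV)"
    and axes: "\<And>i t. i \<in> I \<Longrightarrow> h (\<theta>(i := t)) = 0"
    and center: "h \<theta> = 0"
begin

private lemma smD: "x \<in> (\<Pi>\<^sub>E i\<in>I. UNIV) \<Longrightarrow> y \<in> (\<Pi>\<^sub>E i\<in>I. UNIV) \<Longrightarrow> inf x y = a \<Longrightarrow> sup x y = b \<Longrightarrow> h x + h y \<le> h a + h b"
  using sm unfolding supermodular_def by blast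

private lemma upd: "x \<in> (\<Pi>\<^sub>E i\<in>I. UNIV) \<Longrightarrow> i \<in> I \<Longrightarrow> x(i := t) \<in> (\<Pi>\<^sub>E i\<in>I. (UNIV :: real set))"
  by (auto simp: PiE_iff extensional_def)

text \<open>The coordinates are raised one at a time. Supermodularity is applied to \<open>z\<close>
  and the axis point \<open>\<theta>(i := y i)\<close>, whose meet lies on an axis too; since
  \<open>h\<close> vanishes at both axis points, what remains is
  \<open>h z \<le> h (z(i := y i))\<close>.\<close>

lemma above_mono:
  assumes x: "x \<in> (\<Pi>\<^sub>E i\<in>I. UNIV)" "\<theta> \<le> x" and y: "y \<in> (\<Pi>\<^sub>E i\<in>I. UNIV)" "x \<le> y"
  shows "h x \<le> h y"
proof -
  have "h x \<le> h (\<lambda>l. if l \<in> J then y l else x l)" if "J \<subseteq> I" for J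
    using finite_subset[OF that fin] that
  proof (induction J rule: finite_induct)
    case (insert i J)
    define z where "z = (\<lambda>l. if l \<in> J then y l else x l)"
    have z: "z \<in> (\<Pi>\<^sub>E i\<in>I. UNIV)" using x y insert.prems by (auto simp: z_def PiE_iff extensional_def)
    have "\<theta> l \<le> z l" "z l \<le> y l" for l
      using x(2) y(2) by (auto simp: z_def le_fun_def intro: order_trans)
    then have "h z + h (\<theta>(i := y i)) \<le> h (\<theta>(i := z i)) + h (z(i := y i))"
      using insert.prems by (intro smD z upd \<theta>) (auto simp: fun_eq_iff inf_absorb1 inf_absorb2 sup_absorb1 sup_absorb2)
    then have "h z \<le> h (z(i := y i))" using axes[of i] insert.prems by simp
    moreover have "z(i := y i) = (\<lambda>l. if l \<in> insert i J then y l else x l)" by (auto simp: z_def)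
    ultimately show ?case using insert by (simp add: z_def)
  qed simp
  from this[of I] have "h x \<le> h (\<lambda>l. if l \<in> I then y l else x l)" by simp
  also have "(\<lambda>l. if l \<in> I then y l else x l) = y" using x y by (auto simp: PiE_iff extensional_def)
  finally show ?thesis .
qed

text \<open>The same exchange below \<open>\<theta>\<close>, where the join of \<open>z\<close> and
  the axis point lies on an axis and the meet is the lowered vector.\<close>

lemma below_antimono:
  assumes x: "x \<in> (\<Pi>\<^sub>E i\<in>I. UNIV)" "x \<le> \<theta>" and y: "y \<in> (\<Pi>\<^sub>E i\<in>I. UNIV)" "y \<le> x"
  shows "h x \<le> h y"
proof -
  have "h x \<le> h (\<lambda>l. if l \<in> J then y l else x l)" if "J \<subseteq> I" for J
    using finite_subset[OF that fin] that
  proof (induction J rule: finite_induct)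
    case (insert i J)
    define z where "z = (\<lambda>l. if l \<in> J then y l else x l)"
    have z: "z \<in> (\<Pi>\<^sub>E i\<in>I. UNIV)" using x y insert.prems by (auto simp: z_def PiE_iff extensional_def)
    have "z l \<le> \<theta> l" "y l \<le> z l" for l
      using x(2) y(2) by (auto simp: z_def le_fun_def intro: order_trans)
    then have "h z + h (\<theta>(i := y i)) \<le> h (z(i := y i)) + h (\<theta>(i := z i))"
      using insert.prems by (intro smD z upd \<theta>) (auto simp: fun_eq_iff inf_absorb1 inf_absorb2 sup_absorb1 sup_absorb2)
    then have "h z \<le> h (z(i := y i))" using axes[of i] insert.prems by simp
    moreover have "z(i := y i) = (\<lambda>l. if l \<in> insert i J then y l else x l)" by (auto simp: z_def)
    ultimately show ?case using insert by (simp add: z_def)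
  qed simp
  from this[of I] have "h x \<le> h (\<lambda>l. if l \<in> I then y l else x l)" by simp
  also have "(\<lambda>l. if l \<in> I then y l else x l) = y" using x y by (auto simp: PiE_iff extensional_def)
  finally show ?thesis .
qed

private lemma lat: "x \<in> (\<Pi>\<^sub>E i\<in>I. UNIV) \<Longrightarrow> y \<in> (\<Pi>\<^sub>E i\<in>I. UNIV) \<Longrightarrow> sup x y \<in> (\<Pi>\<^sub>E i\<in>I. (UNIV :: real set)) \<and> inf x y \<in> (\<Pi>\<^sub>E i\<in>I. (UNIV :: real set))"
  by (auto simp: PiE_iff extensional_def)

lemma above_nonneg: "x \<in> (\<Pi>\<^sub>E i\<in>I. UNIV) \<Longrightarrow> 0 \<le> h (sup x \<theta>)"
  using above_mono[OF \<theta> order_refl, of "sup x \<theta>"] lat[OF _ \<theta>] center by simp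

lemma below_nonneg: "x \<in> (\<Pi>\<^sub>E i\<in>I. UNIV) \<Longrightarrow> 0 \<le> h (inf x \<theta>)"
  using below_antimono[OF \<theta> order_refl, of "inf x \<theta>"] lat[OF _ \<theta>] center by simp

text \<open>
  The mixed difference \<open>h (x \<squnion> \<theta>) + h (x \<sqinter> \<theta>) - h x\<close> is nonnegative and decreases as \<open>x\<close> moves
  towards \<open>\<theta>\<close>, which bounds \<open>h\<close> on the box spanned by \<open>\<theta>\<close> and \<open>x\<close>.
\<close>

lemma abs_le_between:
  assumes x: "x \<in> (\<Pi>\<^sub>E i\<in>I. UNIV)" and c: "c \<in> (\<Pi>\<^sub>E i\<in>I. UNIV)"
    and between: "\<And>i. i \<in> I \<Longrightarrow> \<theta> i \<le> c i \<and> c i \<le> x i \<or> x i \<le> c i \<and> c i \<le> \<theta> i"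
  shows "\<bar>h c\<bar> \<le> (h (sup x \<theta>) + h (inf x \<theta>)) + (h (sup x \<theta>) + h (inf x \<theta>) - h x)"
proof -
  define D where "D x = h (sup x \<theta>) + h (inf x \<theta>) - h x" for x
  have D_nonneg: "0 \<le> D x"
    using smD[OF x \<theta> refl refl] center by (simp add: D_def)
  have bt: "\<theta> l \<le> c l \<and> c l \<le> x l \<or> x l \<le> c l \<and> c l \<le> \<theta> l" for l
    using between[of l] x c \<theta> by (cases "l \<in> I") (auto simp: PiE_iff extensional_def)
  \<comment> \<open>\<open>x'\<close> moves only the coordinates above \<open>\<theta>\<close> from
    \<open>x\<close> to \<open>c\<close>. This splits the passage from \<open>x\<close> to
    \<open>c\<close> into two instances of supermodularity, one with \<open>sup c \<theta>\<close>
    and one with \<open>inf c \<theta>\<close>.\<close>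
  define x' where "x' = (\<lambda>l. if \<theta> l \<le> x l then c l else x l)"
  have x': "x' \<in> (\<Pi>\<^sub>E i\<in>I. UNIV)" using x c by (auto simp: x'_def PiE_iff extensional_def)
  have "h x + h (sup c \<theta>) \<le> h x' + h (sup x \<theta>)"
  proof (rule smD[OF x conjunct1[OF lat[OF c \<theta>]]])
    show "inf x (sup c \<theta>) = x'"
    proof
      fix l show "inf x (sup c \<theta>) l = x' l"
        using bt[of l] by (cases "\<theta> l \<le> x l") (auto simp: x'_def inf_real_def sup_real_def min_def max_def)
    qed
    show "sup x (sup c \<theta>) = sup x \<theta>"
    proof
      fix l show "sup x (sup c \<theta>) l = sup x \<theta> l"
        using bt[of l] by (auto simp: sup_real_def max_def)
    qed
  qed
  moreover have "h x' + h (inf c \<theta>) \<le> h (inf x \<theta>) + h c"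
  proof (rule smD[OF x' conjunct2[OF lat[OF c \<theta>]]])
    show "inf x' (inf c \<theta>) = inf x \<theta>"
    proof
      fix l show "inf x' (inf c \<theta>) l = inf x \<theta> l"
        using bt[of l] by (auto simp: x'_def inf_real_def min_def)
    qed
    show "sup x' (inf c \<theta>) = c"
    proof
      fix l show "sup x' (inf c \<theta>) l = c l"
        using bt[of l] by (auto simp: x'_def inf_real_def sup_real_def min_def max_def)
    qed
  qed
  ultimately have D_le: "D c \<le> D x" unfolding D_def by linarith
  have "sup c \<theta> \<le> sup x \<theta>"
  proof (rule le_funI)
    fix l show "sup c \<theta> l \<le> sup x \<theta> l" using bt[of l] by (auto simp: sup_real_def max_def)
  qed
  then have "h (sup c \<theta>) \<le> h (sup x \<theta>)"
    using lat[OF x \<theta>] lat[OF c \<theta>] by (intro above_mono) auto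
  moreover have "inf x \<theta> \<le> inf c \<theta>"
  proof (rule le_funI)
    fix l show "inf x \<theta> l \<le> inf c \<theta> l" using bt[of l] by (auto simp: inf_real_def min_def)
  qed
  then have "h (inf c \<theta>) \<le> h (inf x \<theta>)"
    using lat[OF x \<theta>] lat[OF c \<theta>] by (intro below_antimono) auto
  moreover have "h c \<le> h (inf c \<theta>) + h (sup c \<theta>)"
    using smD[OF c \<theta> refl refl] center by simp
  \<comment> \<open>To be read with \<open>a\<close> and \<open>b\<close> the values of
    \<open>h\<close> at the join and meet of \<open>x\<close> with \<open>\<theta>\<close>,
    \<open>a'\<close> and \<open>b'\<close> the same for \<open>c\<close>, \<open>t = h c\<close>
    and \<open>r = h x\<close>.\<close>
  moreover have "\<bar>t\<bar> \<le> (a + b) + (a + b - r)"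
    if "a' \<le> a" "b' \<le> b" "t \<le> b' + a'" "a' + b' - t \<le> a + b - r" "0 \<le> a + b - r" "0 \<le> a'" "0 \<le> b'"
    for a a' b b' t r :: real
  proof (rule abs_leI)
    have G: "a' + b' \<le> a + b" using that by (intro add_mono)
    then have "t \<le> a + b" using that(3) by simp
    with that(5) show "t \<le> (a + b) + (a + b - r)" by (rule add_increasing2)
    have "- t \<le> (a + b - r) - (a' + b')" using that(4) by linarith
    also have "\<dots> \<le> (a + b) + (a + b - r)" using G that(6,7) by linarith
    finally show "- t \<le> (a + b) + (a + b - r)" .
  qed
  ultimately show ?thesis
    using D_le D_nonneg above_nonneg[OF c] below_nonneg[OF c] unfolding D_def by blast
qed

end

section \<open>Integrability from association\<close>

context
  fixes I :: "nat set" and P :: "(nat \<Rightarrow> real) measure"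
  assumes fin: "finite I" and P: "prob_space P" and sets: "sets P = sets (Pi\<^sub>M I (\<lambda>_. borel))"
    and assoc: "associated I P"
begin

interpretation P: prob_space P by (rule P)

private lemma space_eq: "space P = (\<Pi>\<^sub>E i\<in>I. UNIV)"
  using sets_eq_imp_space_eq[OF sets] by (simp add: space_PiM)

private lemma meas: "f \<in> borel_measurable (Pi\<^sub>M I (\<lambda>_. borel)) \<Longrightarrow> f \<in> borel_measurable P"
  by (simp add: sets cong: measurable_cong_sets)

text \<open>The sign \<open>s = 1\<close> gives increasing, \<open>s = -1\<close> decreasing functions.\<close>

lemma associated_sign:
  fixes s :: real and g h :: "(nat \<Rightarrow> real) \<Rightarrow> real"
  assumes s: "s = 1 \<or> s = - 1"
    and m: "g \<in> borel_measurable (Pi\<^sub>M I (\<lambda>_. borel))" "h \<in> borel_measurable (Pi\<^sub>M I (\<lambda>_. borel))"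
    and b: "\<And>x. \<bar>g x\<bar> \<le> c" "\<And>x. \<bar>h x\<bar> \<le> c"
    and mono: "mono_on (\<Pi>\<^sub>E i\<in>I. UNIV) (\<lambda>x. s * g x)" "mono_on (\<Pi>\<^sub>E i\<in>I. UNIV) (\<lambda>x. s * h x)"
  shows "(\<integral>x. g x \<partial>P) * (\<integral>x. h x \<partial>P) \<le> (\<integral>x. g x * h x \<partial>P)"
proof -
  have "(\<lambda>x. s * g x) \<in> borel_measurable (Pi\<^sub>M I (\<lambda>_. borel))" "(\<lambda>x. s * h x) \<in> borel_measurable (Pi\<^sub>M I (\<lambda>_. borel))"
    using m by auto
  moreover have "\<forall>x. \<bar>s * g x\<bar> \<le> c \<and> \<bar>s * h x\<bar> \<le> c" using s b by auto
  ultimately have "(\<integral>x. s * g x \<partial>P) * (\<integral>x. s * h x \<partial>P) \<le> (\<integral>x. s * g x * (s * h x) \<partial>P)"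
    using assoc mono unfolding associated_def by blast
  moreover have "s * g x * (s * h x) = g x * h x" for x using s by auto
  ultimately show ?thesis using s by auto
qed

context
  fixes s :: real and A :: "nat \<Rightarrow> real set"
  assumes s: "s = 1 \<or> s = - 1" and A: "\<And>i. i \<in> I \<Longrightarrow> A i \<in> sets borel"
    and A_mono: "\<And>i. i \<in> I \<Longrightarrow> mono (\<lambda>t. s * indicator (A i) t)"
begin

private definition B :: "nat set \<Rightarrow> (nat \<Rightarrow> real) set" where
  "B J = {x. \<forall>i\<in>J. x i \<in> A i}"

private lemma B_sets: "J \<subseteq> I \<Longrightarrow> B J \<inter> space P \<in> sets P"
proof -
  assume J: "J \<subseteq> I"
  have "{x \<in> space (Pi\<^sub>M I (\<lambda>_. borel :: real measure)). \<forall>i\<in>J. x i \<in> A i} \<in> sets (Pi\<^sub>M I (\<lambda>_. borel))"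
  proof (intro sets.sets_Collect_finite_All finite_subset[OF J fin])
    fix i assume "i \<in> J"
    then have i: "i \<in> I" using J by auto
    show "{x \<in> space (Pi\<^sub>M I (\<lambda>_. borel)). x i \<in> A i} \<in> sets (Pi\<^sub>M I (\<lambda>_. borel))"
      using measurable_sets[OF measurable_component_singleton[OF i, of "\<lambda>_. borel"] A[OF i]]
      by (simp add: vimage_def Int_def conj_commute)
  qed
  moreover have "{x \<in> space (Pi\<^sub>M I (\<lambda>_. borel :: real measure)). \<forall>i\<in>J. x i \<in> A i} = B J \<inter> space P"
    unfolding B_def sets_eq_imp_space_eq[OF sets] by auto
  ultimately show ?thesis unfolding sets by simp
qed

private lemma B_borel: "J \<subseteq> I \<Longrightarrow> (indicator (B J) :: _ \<Rightarrow> real) \<in> borel_measurable (Pi\<^sub>M I (\<lambda>_. borel))"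
  using B_sets[of J] sets sets_eq_imp_space_eq[OF sets]
  by (subst borel_measurable_indicator_iff) (simp add: Int_commute)

private lemma B_mono: "J \<subseteq> I \<Longrightarrow> mono_on (\<Pi>\<^sub>E i\<in>I. UNIV) (\<lambda>x. s * indicator (B J) x)"
proof (rule mono_onI)
  fix x y :: "nat \<Rightarrow> real" assume J: "J \<subseteq> I" and xy: "x \<le> y"
  have "s * indicator (A i) (x i) \<le> s * (indicator (A i) (y i) :: real)" if "i \<in> J" for i
    using A_mono[of i] J that xy by (auto simp: mono_def le_fun_def)
  then show "s * indicator (B J) x \<le> s * (indicator (B J) y :: real)"
    using s by (force simp: B_def indicator_def split: if_splits)
qed

private lemma integral_B: "J \<subseteq> I \<Longrightarrow> (\<integral>x. indicator (B J) x \<partial>P) = measure P (B J \<inter> space P)"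
proof -
  assume "J \<subseteq> I"
  have "(\<integral>x. indicator (B J) x \<partial>P) = (\<integral>x. indicator (B J \<inter> space P) x \<partial>P :: real)"
    by (intro Bochner_Integration.integral_cong) (auto simp: indicator_def)
  then show ?thesis using B_sets[OF \<open>J \<subseteq> I\<close>] by simp
qed

text \<open>The sides of the box all point in the same direction, so by association its mass is at
  least the product of the masses of its sides.\<close>

lemma associated_box_pos:
  assumes pos: "\<And>i. i \<in> I \<Longrightarrow> 0 < measure P {x \<in> space P. x i \<in> A i}"
  shows "0 < measure P {x \<in> space P. \<forall>i\<in>I. x i \<in> A i}"
proof -
  have "0 < measure P (B J \<inter> space P)" if "J \<subseteq> I" for J
    using finite_subset[OF that fin] that
  proof (induction J rule: finite_induct)
    case empty
    then show ?case using P.prob_space by (simp add: B_def)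
  next
    case (insert i J)
    have sub: "{i} \<subseteq> I" "J \<subseteq> I" "insert i J \<subseteq> I" using insert by auto
    have "0 < measure P (B {i} \<inter> space P) * measure P (B J \<inter> space P)"
      using pos[of i] insert by (intro mult_pos_pos) (auto simp: B_def Int_def conj_commute)
    also have "\<dots> \<le> (\<integral>x. indicator (B {i}) x * indicator (B J) x \<partial>P)"
      unfolding integral_B[OF sub(1), symmetric] integral_B[OF sub(2), symmetric]
      by (rule associated_sign[OF s B_borel[OF sub(1)] B_borel[OF sub(2)], of 1])
         (auto simp: indicator_def intro: B_mono[OF sub(1), unfolded indicator_def] B_mono[OF sub(2), unfolded indicator_def])
    also have "\<dots> = (\<integral>x. indicator (B (insert i J)) x \<partial>P)"
      by (intro Bochner_Integration.integral_cong) (auto simp: B_def indicator_def)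
    also have "\<dots> = measure P (B (insert i J) \<inter> space P)" by (rule integral_B[OF sub(3)])
    finally show ?case .
  qed
  from this[of I] show ?thesis by (simp add: B_def Int_def conj_commute)
qed

text \<open>\<open>g\<close> is known to agree with the integrable \<open>f\<close> only on the
  corner given by \<open>A\<close>. Association with the indicator of this corner, which is monotone
  in the same direction, bounds the mean of every truncation of \<open>g\<close> by E|f| divided by
  the mass of the corner; monotone convergence does the rest.\<close>

lemma integrable_of_corner:
  assumes pos: "\<And>i. i \<in> I \<Longrightarrow> 0 < measure P {x \<in> space P. x i \<in> A i}"
    and g: "g \<in> borel_measurable (Pi\<^sub>M I (\<lambda>_. borel))" and g0: "\<And>x. x \<in> (\<Pi>\<^sub>E i\<in>I. UNIV) \<Longrightarrow> 0 \<le> g x"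
    and mono: "mono_on (\<Pi>\<^sub>E i\<in>I. UNIV) (\<lambda>x. s * g x)"
    and f: "integrable P f" and eq: "\<And>x. x \<in> (\<Pi>\<^sub>E i\<in>I. UNIV) \<Longrightarrow> \<forall>i\<in>I. x i \<in> A i \<Longrightarrow> g x = (f x :: real)"
  shows "integrable P g"
proof -
  define p where "p = measure P (B I \<inter> space P)"
  have p: "0 < p" using associated_box_pos[OF pos] by (simp add: p_def B_def Int_def conj_commute)
  define G where "G k x = max 0 (min (real k) (g x))" for k x
  have G_borel: "G k \<in> borel_measurable (Pi\<^sub>M I (\<lambda>_. borel))" for k
    unfolding G_def using g by measurable
  have G_bound: "\<bar>G k x\<bar> \<le> real k" "0 \<le> G k x" for k x unfolding G_def by auto
  have G_mono: "mono_on (\<Pi>\<^sub>E i\<in>I. UNIV) (\<lambda>x. s * G k x)" for k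
  proof (rule mono_onI)
    fix x y :: "nat \<Rightarrow> real" assume "x \<in> (\<Pi>\<^sub>E i\<in>I. UNIV)" "y \<in> (\<Pi>\<^sub>E i\<in>I. UNIV)" "x \<le> y"
    then have "s * g x \<le> s * g y" by (rule mono_onD[OF mono])
    then show "s * G k x \<le> s * G k y" using s unfolding G_def by (auto simp: max_def min_def)
  qed
  have int_G: "integrable P (G k)" for k
    by (rule integral_bounded_const(1)[OF P G_bound(1) meas[OF G_borel]])
  have G_int: "(\<integral>x. G k x \<partial>P) \<le> (\<integral>x. \<bar>f x\<bar> \<partial>P) / p" for k
  proof -
    have ic: "integrable P (\<lambda>x. G k x * indicator (B I) x)"
    proof (rule integral_bounded_const(1)[OF P, of _ "real k"])
      show "\<bar>G k x * indicator (B I) x\<bar> \<le> real k" for x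
        using G_bound[of k x] by (auto simp: indicator_def)
      show "(\<lambda>x. G k x * indicator (B I) x) \<in> borel_measurable P"
        by (intro borel_measurable_times meas G_borel B_borel order_refl)
    qed
    \<comment> \<open>\<open>associated_sign\<close> takes one common bound for both functions;
      \<open>Suc k\<close> also covers the indicator when \<open>k = 0\<close>.\<close>
    have bI: "\<bar>indicator (B I) x :: real\<bar> \<le> real (Suc k)" and bG: "\<bar>G k x\<bar> \<le> real (Suc k)" for x
      using G_bound(1)[of k x] by (auto simp: indicator_def)
    have "(\<integral>x. G k x \<partial>P) * p = (\<integral>x. G k x \<partial>P) * (\<integral>x. indicator (B I) x \<partial>P)"
      by (simp only: integral_B[OF order_refl] p_def)
    also have "\<dots> \<le> (\<integral>x. G k x * indicator (B I) x \<partial>P)"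
      by (rule associated_sign[OF s G_borel B_borel[OF order_refl] bG bI G_mono B_mono[OF order_refl]])
    also have "\<dots> \<le> (\<integral>x. \<bar>f x\<bar> \<partial>P)"
    proof (rule integral_mono[OF ic])
      show "integrable P (\<lambda>x. \<bar>f x\<bar>)" using f by simp
      fix x assume "x \<in> space P"
      then show "G k x * indicator (B I) x \<le> \<bar>f x\<bar>"
        using eq[of x] unfolding space_eq G_def by (auto simp: B_def indicator_def)
    qed
    finally show ?thesis using p by (simp add: pos_le_divide_eq)
  qed
  have mono_k: "mono (\<lambda>k. G k x)" for x unfolding G_def mono_def by (auto simp: max_def min_def)
  have "incseq (\<lambda>k. \<integral>x. G k x \<partial>P)"
    unfolding incseq_def by (intro allI impI integral_mono int_G) (use mono_k in \<open>auto simp: mono_def\<close>)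
  then obtain L where L: "(\<lambda>k. \<integral>x. G k x \<partial>P) \<longlonglongrightarrow> L"
    using incseq_convergent[of "\<lambda>k. \<integral>x. G k x \<partial>P" "(\<integral>x. \<bar>f x\<bar> \<partial>P) / p"] G_int by blast
  have lim: "(\<lambda>k. G k x) \<longlonglongrightarrow> g x" if "x \<in> space P" for x
  proof (rule tendsto_eventually)
    obtain n :: nat where "g x \<le> real n" using real_arch_simple by blast
    then have "G k x = g x" if "k \<ge> n" for k
      using that g0[of x] \<open>x \<in> space P\<close> unfolding G_def space_eq by auto
    then show "\<forall>\<^sub>F k in sequentially. G k x = g x" unfolding eventually_sequentially by blast
  qed
  show ?thesis
    by (rule integrable_monotone_convergence[OF int_G _ _ L meas[OF g]]) (use mono_k lim in auto)
qed

end

end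

section \<open>Truncation by coordinatewise increasing maps\<close>

lemma coordinatewise_measurable:
  assumes "\<And>i. i \<in> I \<Longrightarrow> \<phi> i \<in> borel_measurable (borel :: real measure)" "I \<subseteq> W"
  shows "(\<lambda>x. \<lambda>i\<in>I. \<phi> i (x i)) \<in> Pi\<^sub>M W (\<lambda>_. borel) \<rightarrow>\<^sub>M Pi\<^sub>M I (\<lambda>_. borel :: real measure)"
proof (rule measurable_restrict)
  fix i assume i: "i \<in> I"
  then have "i \<in> W" using assms(2) by auto
  show "(\<lambda>x. \<phi> i (x i)) \<in> borel_measurable (Pi\<^sub>M W (\<lambda>_. borel))"
    by (rule measurable_compose[OF measurable_component_singleton[OF \<open>i \<in> W\<close>] assms(1)[OF i]])
qed

lemma coordinatewise_supermodular:
  assumes sm: "supermodular I f" and mono: "\<And>i s t. i \<in> I \<Longrightarrow> s \<le> t \<Longrightarrow> \<phi> i s \<le> \<phi> i (t :: real)"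
  shows "supermodular W (\<lambda>x. f (\<lambda>i\<in>I. \<phi> i (x i)))"
  unfolding supermodular_def
proof (intro ballI)
  fix x y :: "nat \<Rightarrow> real"
  have mm: "min (\<phi> i a) (\<phi> i b) = \<phi> i (min a b)" "max (\<phi> i a) (\<phi> i b) = \<phi> i (max a b)" if "i \<in> I" for i a b
    using mono[OF that, of a b] mono[OF that, of b a] by (auto simp: min_def max_def)
  have "inf (\<lambda>i\<in>I. \<phi> i (x i)) (\<lambda>i\<in>I. \<phi> i (y i)) = (\<lambda>i\<in>I. \<phi> i (inf x y i))"
    "sup (\<lambda>i\<in>I. \<phi> i (x i)) (\<lambda>i\<in>I. \<phi> i (y i)) = (\<lambda>i\<in>I. \<phi> i (sup x y i))"
    by (auto simp: fun_eq_iff restrict_def inf_real_def sup_real_def mm)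
  moreover have "f (\<lambda>i\<in>I. \<phi> i (x i)) + f (\<lambda>i\<in>I. \<phi> i (y i))
      \<le> f (inf (\<lambda>i\<in>I. \<phi> i (x i)) (\<lambda>i\<in>I. \<phi> i (y i))) + f (sup (\<lambda>i\<in>I. \<phi> i (x i)) (\<lambda>i\<in>I. \<phi> i (y i)))"
    using sm unfolding supermodular_def by (elim ballE) auto
  ultimately show "f (\<lambda>i\<in>I. \<phi> i (x i)) + f (\<lambda>i\<in>I. \<phi> i (y i))
      \<le> f (\<lambda>i\<in>I. \<phi> i (inf x y i)) + f (\<lambda>i\<in>I. \<phi> i (sup x y i))"
    by (simp only:)
qed

text \<open>
  Truncation turns an integrable supermodular function into bounded ones. After subtracting the
  univariate sections through a point \<open>\<theta>\<close>, which have the same mean under both laws, association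
  makes the truncations uniformly integrable. Fubini for the product law provides a \<open>\<theta>\<close> whose
  sections are integrable.
\<close>

lemma supermodular_le_of_bounded:
  fixes P Q :: "(nat \<Rightarrow> real) measure" and \<mu> :: "nat \<Rightarrow> real measure"
  assumes fin: "finite I"
    and P: "prob_space P" "sets P = sets (Pi\<^sub>M I (\<lambda>_. borel))" "associated I P"
      "\<And>i. i \<in> I \<Longrightarrow> distr P borel (\<lambda>x. x i) = \<mu> i"
    and Q: "prob_space Q" "sets Q = sets (Pi\<^sub>M I (\<lambda>_. borel))" "associated I Q"
      "\<And>i. i \<in> I \<Longrightarrow> distr Q borel (\<lambda>x. x i) = \<mu> i"
    and \<mu>: "\<And>n. prob_space (\<mu> n)" "\<And>n. sets (\<mu> n) = sets borel"
    and le: "\<And>g c. g \<in> borel_measurable (Pi\<^sub>M I (\<lambda>_. borel)) \<Longrightarrow> (\<And>x. \<bar>g x\<bar> \<le> c) \<Longrightarrow> supermodular I g \<Longrightarrow>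
      (\<integral>x. g x \<partial>P) \<le> (\<integral>x. g x \<partial>Q)"
    and f: "f \<in> borel_measurable (Pi\<^sub>M I (\<lambda>_. borel))" "supermodular I f"
    and int: "integrable P f" "integrable Q f" "integrable (Pi\<^sub>M I \<mu>) f"
  shows "(\<integral>x. f x \<partial>P) \<le> (\<integral>x. f x \<partial>Q)"
proof -
  let ?S = "\<Pi>\<^sub>E i\<in>I. (UNIV :: real set)"
  have \<mu>_space: "space (\<mu> n) = UNIV" for n using sets_eq_imp_space_eq[OF \<mu>(2)] by simp
  interpret \<Pi>: prob_space "Pi\<^sub>M I \<mu>" by (rule prob_space_PiM) (rule \<mu>)
  have "AE y in Pi\<^sub>M I \<mu>. \<forall>i\<in>I. integrable (\<mu> i) (\<lambda>t. f (y(i := t)))"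
    by (intro AE_finite_allI fin AE_section_integrable \<mu> int)
  \<comment> \<open>Mass on both sides of every \<open>\<theta> i\<close> is what later gives both
    corners at \<open>\<theta>\<close> positive probability.\<close>
  moreover have "AE y in Pi\<^sub>M I \<mu>. \<forall>i\<in>I. 0 < measure (\<mu> i) {..y i}"
    using \<mu> by (intro AE_finite_allI fin AE_PiM_component AE_measure_atMost_pos)
  moreover have "AE y in Pi\<^sub>M I \<mu>. \<forall>i\<in>I. 0 < measure (\<mu> i) {y i..}"
    using \<mu> by (intro AE_finite_allI fin AE_PiM_component AE_measure_atLeast_pos)
  moreover have "AE y in Pi\<^sub>M I \<mu>. y \<in> ?S"
    using AE_space by eventually_elim (simp add: space_PiM \<mu>_space)
  ultimately have "AE y in Pi\<^sub>M I \<mu>. y \<in> ?S \<and> (\<forall>i\<in>I. integrable (\<mu> i) (\<lambda>t. f (y(i := t)))) \<and>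
      (\<forall>i\<in>I. 0 < measure (\<mu> i) {..y i}) \<and> (\<forall>i\<in>I. 0 < measure (\<mu> i) {y i..})"
    by eventually_elim simp
  from eventually_happens'[OF \<Pi>.ae_filter_bot this]
  obtain \<theta> where \<theta>: "\<theta> \<in> ?S" and sect: "\<And>i. i \<in> I \<Longrightarrow> integrable (\<mu> i) (\<lambda>t. f (\<theta>(i := t)))"
    and low: "\<And>i. i \<in> I \<Longrightarrow> 0 < measure (\<mu> i) {..\<theta> i}" and high: "\<And>i. i \<in> I \<Longrightarrow> 0 < measure (\<mu> i) {\<theta> i..}"
    by blast
  have \<theta>_upd: "\<theta>(i := t) = (\<lambda>l\<in>I. if l = i then t else \<theta> l)" if "i \<in> I" for i t
    using \<theta> that by (auto simp: fun_eq_iff PiE_iff extensional_def)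
  \<comment> \<open>At a point on an axis through \<open>\<theta>\<close>, all but one of the
    subtracted sections take the value \<open>f \<theta>\<close>. Adding back
    \<open>card I - 1\<close> copies makes \<open>h\<close> vanish on the axes and at
    \<open>\<theta>\<close> itself.\<close>
  define m where "m = real (card I) - 1"
  define h where "h x = f x - (\<Sum>i\<in>I. f (\<theta>(i := x i))) + m * f \<theta>" for x
  have sect_borel: "(\<lambda>x. f (\<theta>(i := x i))) \<in> borel_measurable (Pi\<^sub>M I (\<lambda>_. borel))" if i: "i \<in> I" for i
  proof -
    have "(\<lambda>x. \<lambda>l\<in>I. if l = i then x l else \<theta> l) \<in> Pi\<^sub>M I (\<lambda>_. borel) \<rightarrow>\<^sub>M Pi\<^sub>M I (\<lambda>_. borel :: real measure)"
      by (rule coordinatewise_measurable[of I "\<lambda>l t. if l = i then t else \<theta> l" I]) auto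
    from measurable_compose[OF this f(1)] show ?thesis
      unfolding \<theta>_upd[OF i] by (simp cong: if_cong restrict_cong)
  qed
  have h_borel: "h \<in> borel_measurable (Pi\<^sub>M I (\<lambda>_. borel))"
    unfolding h_def using f(1) sect_borel by (intro borel_measurable_add borel_measurable_diff borel_measurable_sum) auto
  have h_sm: "supermodular I h"
    unfolding supermodular_def
  proof (intro ballI)
    fix x y assume xy: "x \<in> ?S" "y \<in> ?S"
    \<comment> \<open>A function of one coordinate satisfies the supermodular inequality with
      equality, so subtracting it is harmless.\<close>
    have "f (\<theta>(i := x i)) + f (\<theta>(i := y i)) = f (\<theta>(i := inf x y i)) + f (\<theta>(i := sup x y i))" for i
      by (cases "x i \<le> y i") (auto simp: inf_absorb1 inf_absorb2 sup_absorb1 sup_absorb2)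
    then have "(\<Sum>i\<in>I. f (\<theta>(i := x i))) + (\<Sum>i\<in>I. f (\<theta>(i := y i)))
        = (\<Sum>i\<in>I. f (\<theta>(i := inf x y i))) + (\<Sum>i\<in>I. f (\<theta>(i := sup x y i)))"
      by (simp only: sum.distrib[symmetric])
    moreover have "f x + f y \<le> f (inf x y) + f (sup x y)" using f(2) xy unfolding supermodular_def by blast
    ultimately show "h x + h y \<le> h (inf x y) + h (sup x y)" unfolding h_def by linarith
  qed
  have axes: "h (\<theta>(i := t)) = 0" if i: "i \<in> I" for i t
  proof -
    have "(\<Sum>l\<in>I. f (\<theta>(l := (\<theta>(i := t)) l))) = f (\<theta>(i := t)) + (\<Sum>l\<in>I - {i}. f \<theta>)"
      unfolding sum.remove[OF fin i] by (intro arg_cong2[where f = "(+)"] sum.cong) auto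
    also have "(\<Sum>l\<in>I - {i}. f \<theta>) = m * f \<theta>"
      using fin i by (simp add: m_def card_Diff_singleton of_nat_diff Suc_leI card_gt_0_iff)
        (metis One_nat_def Suc_leI card_gt_0_iff empty_iff of_nat_1 of_nat_diff)
    finally have S: "(\<Sum>l\<in>I. f (\<theta>(l := (\<theta>(i := t)) l))) = f (\<theta>(i := t)) + m * f \<theta>" .
    show ?thesis unfolding h_def S by simp
  qed
  have center: "h \<theta> = 0"
    by (simp add: h_def m_def algebra_simps)
  note ctx = fin h_sm \<theta> axes center
  \<comment> \<open>\<open>up\<close> and \<open>lo\<close> agree with the join and meet with
    \<open>\<theta>\<close> on \<open>?S\<close>, but their values stay in \<open>?S\<close> for
    every argument.\<close>
  define up where "up x = (\<lambda>i\<in>I. max (x i) (\<theta> i))" for x :: "nat \<Rightarrow> real"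
  define lo where "lo x = (\<lambda>i\<in>I. min (x i) (\<theta> i))" for x :: "nat \<Rightarrow> real"
  have up_sup: "up x = sup x \<theta>" and lo_inf: "lo x = inf x \<theta>" if "x \<in> ?S" for x
    using that \<theta> by (auto simp: up_def lo_def fun_eq_iff PiE_iff extensional_def sup_real_def inf_real_def)
  have up_S: "up x \<in> ?S" "lo x \<in> ?S" "\<theta> \<le> up x" "lo x \<le> \<theta>" for x
    using \<theta> by (auto simp: up_def lo_def le_fun_def PiE_iff extensional_def)
  have up_borel: "up \<in> Pi\<^sub>M I (\<lambda>_. borel) \<rightarrow>\<^sub>M Pi\<^sub>M I (\<lambda>_. borel)" "lo \<in> Pi\<^sub>M I (\<lambda>_. borel) \<rightarrow>\<^sub>M Pi\<^sub>M I (\<lambda>_. borel)"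
    unfolding up_def lo_def by (rule coordinatewise_measurable[OF _ order_refl]; simp)+
  define D where "D x = (h (up x) + h (lo x)) + (h (up x) + h (lo x) - h x)" for x
  define cl where "cl k x = (\<lambda>i\<in>I. clamp_to (\<theta> i - real k) (\<theta> i + real k) (x i))" for k and x :: "nat \<Rightarrow> real"
  have cl_S: "cl k x \<in> ?S" for k x by (auto simp: cl_def)
  have between: "\<theta> i \<le> cl k x i \<and> cl k x i \<le> x i \<or> x i \<le> cl k x i \<and> cl k x i \<le> \<theta> i" if "i \<in> I" for k x i
    using that by (auto simp: cl_def clamp_to_def)
  have dom: "\<bar>h (cl k x)\<bar> \<le> D x" if x: "x \<in> ?S" for k x
    unfolding D_def up_sup[OF x] lo_inf[OF x] by (rule abs_le_between[OF ctx x cl_S between])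
  \<comment> \<open>A clamped point lies between \<open>\<theta>\<close> and a vertex of the box
    around \<open>\<theta>\<close>. By \<open>abs_le_between\<close> the finitely many values of
    \<open>D\<close> at the vertices bound the truncated function, without any continuity of
    \<open>h\<close>.\<close>
  define c where "c k = Max (D ` (\<Pi>\<^sub>E i\<in>I. {\<theta> i - real k, \<theta> i + real k}))" for k
  have g_bound: "\<bar>h (cl k x)\<bar> \<le> c k" for k x
  proof -
    define y where "y = (\<lambda>i\<in>I. if \<theta> i \<le> x i then \<theta> i + real k else \<theta> i - real k)"
    have y: "y \<in> ?S" "y \<in> (\<Pi>\<^sub>E i\<in>I. {\<theta> i - real k, \<theta> i + real k})" by (auto simp: y_def)
    have "\<bar>h (cl k x)\<bar> \<le> D y"
      unfolding D_def up_sup[OF y(1)] lo_inf[OF y(1)]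
      by (rule abs_le_between[OF ctx y(1) cl_S]) (auto simp: y_def cl_def clamp_to_def)
    also have "D y \<le> c k"
      unfolding c_def using y(2) fin by (intro Max_ge finite_imageI finite_PiE) auto
    finally show ?thesis .
  qed
  have cl_borel: "(\<lambda>x. cl k x) \<in> Pi\<^sub>M I (\<lambda>_. borel) \<rightarrow>\<^sub>M Pi\<^sub>M I (\<lambda>_. borel)" for k
    unfolding cl_def by (rule coordinatewise_measurable[OF _ order_refl]) (rule clamp_to_borel)
  have g_borel: "(\<lambda>x. h (cl k x)) \<in> borel_measurable (Pi\<^sub>M I (\<lambda>_. borel))" for k
    by (rule measurable_compose[OF cl_borel h_borel])
  have g_sm: "supermodular I (\<lambda>x. h (cl k x))" for k
    unfolding cl_def by (rule coordinatewise_supermodular[OF h_sm]) (rule clamp_to_mono)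
  \<comment> \<open>The mean removed together with the sections. It depends on the marginals only,
    hence is the same under both laws.\<close>
  define K where "K = (\<Sum>i\<in>I. \<integral>t. f (\<theta>(i := t)) \<partial>\<mu> i) - m * f \<theta>"
  have main: "(\<lambda>k. \<integral>x. h (cl k x) \<partial>R) \<longlonglongrightarrow> (\<integral>x. h x \<partial>R) \<and> (\<integral>x. f x \<partial>R) = (\<integral>x. h x \<partial>R) + K"
    if R: "prob_space R" "sets R = sets (Pi\<^sub>M I (\<lambda>_. borel))" "associated I R"
      "\<And>i. i \<in> I \<Longrightarrow> distr R borel (\<lambda>x. x i) = \<mu> i" and f_int: "integrable R f"
    for R :: "(nat \<Rightarrow> real) measure"
  proof -
    interpret R: prob_space R by (rule R)
    have R_space: "space R = ?S" using sets_eq_imp_space_eq[OF R(2)] by (simp add: space_PiM)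
    have meas: "g \<in> borel_measurable (Pi\<^sub>M I (\<lambda>_. borel)) \<Longrightarrow> g \<in> borel_measurable R" for g :: "_ \<Rightarrow> real"
      by (simp add: R(2) cong: measurable_cong_sets)
    have coord: "(\<lambda>x. x i) \<in> R \<rightarrow>\<^sub>M borel" if "i \<in> I" for i
      using measurable_component_singleton[OF that, of "\<lambda>_. borel :: real measure"] by (simp add: R(2) cong: measurable_cong_sets)
    have sect_R: "integrable R (\<lambda>x. f (\<theta>(i := x i)))" "(\<integral>x. f (\<theta>(i := x i)) \<partial>R) = (\<integral>t. f (\<theta>(i := t)) \<partial>\<mu> i)"
      if i: "i \<in> I" for i
    proof -
      have "integrable (distr R borel (\<lambda>x. x i)) (\<lambda>t. f (\<theta>(i := t)))" using sect[OF i] R(4)[OF i] by simp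
      from integrable_distr[OF coord[OF i] this] show "integrable R (\<lambda>x. f (\<theta>(i := x i)))" .
      show "(\<integral>x. f (\<theta>(i := x i)) \<partial>R) = (\<integral>t. f (\<theta>(i := t)) \<partial>\<mu> i)"
        unfolding R(4)[OF i, symmetric]
        by (rule integral_distr[OF coord[OF i], symmetric])
           (use borel_measurable_integrable[OF sect[OF i]] in \<open>simp add: \<mu>(2) cong: measurable_cong_sets\<close>)
    qed
    have h_int: "integrable R h"
      unfolding h_def using f_int sect_R(1)
      by (intro Bochner_Integration.integrable_add Bochner_Integration.integrable_diff Bochner_Integration.integrable_sum) auto
    have "(\<integral>x. h x \<partial>R) = (\<integral>x. f x \<partial>R) - K"
      unfolding h_def K_def using f_int sect_R R.prob_space
      by (simp add: Bochner_Integration.integral_sum Bochner_Integration.integrable_sum)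
    have pos: "0 < measure R {x \<in> space R. x i \<in> A}" if "i \<in> I" "A \<in> sets borel" "0 < measure (\<mu> i) A" for i A
    proof -
      have "measure (\<mu> i) A = measure R ((\<lambda>x. x i) -` A \<inter> space R)"
        unfolding R(4)[OF that(1), symmetric] by (rule measure_distr[OF coord[OF that(1)] that(2)])
      then show ?thesis using that(3) by (simp add: vimage_def Int_def conj_commute)
    qed
    have up_int: "integrable R (\<lambda>x. h (up x))"
    proof (rule integrable_of_corner[OF fin R(1-3), of 1 "\<lambda>i. {\<theta> i..}"])
      show "mono_on ?S (\<lambda>x. 1 * h (up x))"
      proof (rule mono_onI)
        fix x y :: "nat \<Rightarrow> real" assume "x \<le> y"
        then have "up x \<le> up y" by (auto simp: up_def le_fun_def max.coboundedI1)
        then show "1 * h (up x) \<le> 1 * h (up y)" using above_mono[OF ctx up_S(1,3) up_S(1)] by simp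
      qed
      show "h (up x) = h x" if "x \<in> ?S" "\<forall>i\<in>I. x i \<in> {\<theta> i..}" for x
      proof -
        have "up x = x" using that by (auto simp: up_def fun_eq_iff PiE_iff extensional_def)
        then show ?thesis by simp
      qed
      show "0 \<le> h (up x)" if "x \<in> ?S" for x unfolding up_sup[OF that] by (rule above_nonneg[OF ctx that])
      show "0 < measure R {x \<in> space R. x i \<in> {\<theta> i..}}" if "i \<in> I" for i
        by (rule pos[OF that _ high[OF that]]) simp
    qed (use h_int measurable_compose[OF up_borel(1) h_borel] in \<open>auto simp: mono_def indicator_def\<close>)
    have lo_int: "integrable R (\<lambda>x. h (lo x))"
    proof (rule integrable_of_corner[OF fin R(1-3), of "- 1" "\<lambda>i. {..\<theta> i}"])
      show "mono_on ?S (\<lambda>x. - 1 * h (lo x))"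
      proof (rule mono_onI)
        fix x y :: "nat \<Rightarrow> real" assume "x \<le> y"
        then have "lo x \<le> lo y" by (auto simp: lo_def le_fun_def min.coboundedI1)
        then show "- 1 * h (lo x) \<le> - 1 * h (lo y)" using below_antimono[OF ctx up_S(2,4) up_S(2)] by simp
      qed
      show "h (lo x) = h x" if "x \<in> ?S" "\<forall>i\<in>I. x i \<in> {..\<theta> i}" for x
      proof -
        have "lo x = x" using that by (auto simp: lo_def fun_eq_iff PiE_iff extensional_def)
        then show ?thesis by simp
      qed
      show "0 \<le> h (lo x)" if "x \<in> ?S" for x unfolding lo_inf[OF that] by (rule below_nonneg[OF ctx that])
      show "0 < measure R {x \<in> space R. x i \<in> {..\<theta> i}}" if "i \<in> I" for i
        by (rule pos[OF that _ low[OF that]]) simp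
    qed (use h_int measurable_compose[OF up_borel(2) h_borel] in \<open>auto simp: mono_def indicator_def\<close>)
    have D_int: "integrable R D" unfolding D_def using h_int up_int lo_int by auto
    have "(\<lambda>k. \<integral>x. h (cl k x) \<partial>R) \<longlonglongrightarrow> (\<integral>x. h x \<partial>R)"
    proof (rule integral_dominated_convergence[OF meas[OF h_borel] meas[OF g_borel] D_int])
      show "AE x in R. (\<lambda>k. h (cl k x)) \<longlonglongrightarrow> h x"
      proof (rule AE_I2)
        fix x assume "x \<in> space R"
        then have x: "x \<in> ?S" by (simp add: R_space)
        obtain n :: nat where n: "(\<Sum>i\<in>I. \<bar>x i - \<theta> i\<bar>) \<le> real n" using real_arch_simple by blast
        have "cl k x = x" if "k \<ge> n" for k
        proof -
          have "\<bar>x i - \<theta> i\<bar> \<le> real k" if "i \<in> I" for i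
            using member_le_sum[OF that, of "\<lambda>i. \<bar>x i - \<theta> i\<bar>"] fin n \<open>k \<ge> n\<close> by simp
          then have "clamp_to (\<theta> i - real k) (\<theta> i + real k) (x i) = x i" if "i \<in> I" for i
            using that by (intro clamp_to_id) (auto simp: abs_le_iff algebra_simps)
          then show ?thesis using x by (auto simp: cl_def fun_eq_iff PiE_iff extensional_def)
        qed
        then have "\<forall>\<^sub>F k in sequentially. h (cl k x) = h x" unfolding eventually_sequentially by (intro exI[of _ n]) auto
        then show "(\<lambda>k. h (cl k x)) \<longlonglongrightarrow> h x" by (rule tendsto_eventually)
      qed
      show "AE x in R. norm (h (cl k x)) \<le> D x" for k
        by (rule AE_I2) (simp add: R_space dom)
    qed
    then show ?thesis using \<open>(\<integral>x. h x \<partial>R) = (\<integral>x. f x \<partial>R) - K\<close> by simp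
  qed
  have "(\<integral>x. h (cl k x) \<partial>P) \<le> (\<integral>x. h (cl k x) \<partial>Q)" for k
    by (rule le[OF g_borel g_bound g_sm])
  then have "(\<integral>x. h x \<partial>P) \<le> (\<integral>x. h x \<partial>Q)"
    using LIMSEQ_le[OF conjunct1[OF main[OF P int(1)]] conjunct1[OF main[OF Q int(2)]]] by blast
  then show ?thesis using conjunct2[OF main[OF P int(1)]] conjunct2[OF main[OF Q int(2)]] by linarith
qed

section \<open>Paths in the tree\<close>

lemma directed_tree_edges: "directed_tree N E \<Longrightarrow> (i, j) \<in> E \<Longrightarrow> i \<in> N \<and> j \<in> N"
  unfolding directed_tree_def by auto

lemma subtree_subset: "index_set N \<Longrightarrow> directed_tree N E \<Longrightarrow> subtree E W \<Longrightarrow> W \<subseteq> N"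
  by (erule subtree.induct) (auto simp: index_set_def dest: directed_tree_edges)

lemma subtree_root: "subtree E W \<Longrightarrow> 0 \<in> W"
  by (induction rule: subtree.induct) auto

text \<open>That the path stays in \<open>W\<close> is what keeps it free of repetitions when the
  new leaf is appended.\<close>

lemma subtree_connected:
  assumes "subtree E W" "a \<in> W" "c \<in> W"
  shows "\<exists>p. undirected_path E a c p \<and> set p \<subseteq> W"
  using assms
proof (induction arbitrary: a c rule: subtree.induct)
  case root
  then show ?case by (intro exI[of _ "[0]"]) (simp add: undirected_path_def)
next
  case (leaf W i j)
  consider "a \<in> W" "c \<in> W" | "a = j" "c = j" | "a = j" "c \<in> W" | "a \<in> W" "c = j"
    using leaf.prems by auto
  then show ?case
  proof cases
    case 1
    then show ?thesis using leaf.IH by blast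
  next
    case 2
    then show ?thesis by (intro exI[of _ "[j]"]) (simp add: undirected_path_def)
  next
    case 3
    obtain p where "undirected_path E i c p" "set p \<subseteq> W" using leaf.IH[OF leaf(2) 3(2)] by blast
    then show ?thesis using leaf 3
      by (intro exI[of _ "j # p"]) (auto simp: undirected_path_def successively_Cons)
  next
    case 4
    obtain p where "undirected_path E a i p" "set p \<subseteq> W" using leaf.IH[OF 4(1) leaf(2)] by blast
    then show ?thesis using leaf 4
      by (intro exI[of _ "p @ [j]"]) (auto simp: undirected_path_def successively_append_iff)
  qed
qed

text \<open>A path inside \<open>W\<close> to \<open>i\<close>, followed by the edge to
  \<open>j\<close>, passes through \<open>i\<close>. As \<open>between\<close> is a union over all
  undirected paths, exhibiting this one is enough.\<close>

lemma subtree_separates: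
  assumes "subtree E W" "i \<in> W" "(i, j) \<in> E" "j \<notin> W"
  shows "separates E i (W - {i}) {j}"
  unfolding separates_def
proof (intro ballI)
  fix a c assume "a \<in> W - {i}" "c \<in> {j}"
  then have a: "a \<in> W" "a \<noteq> i" "c = j" by auto
  obtain p where p: "undirected_path E a i p" "set p \<subseteq> W" using subtree_connected[OF assms(1) a(1) assms(2)] by blast
  then have "undirected_path E a j (p @ [j])"
    using assms by (auto simp: undirected_path_def successively_append_iff)
  moreover have "i \<in> set (p @ [j]) - {a, j}"
    using p a assms by (auto simp: undirected_path_def)
  ultimately show "i \<in> between E a c" unfolding between_def a(3) by blast
qed

text \<open>A leaf is added only at nodes not yet present, so the path may run inside the subtree or
  reenter it.\<close>

lemma subtree_along_path:
  assumes "subtree E W" "p \<noteq> []" "hd p \<in> W" "successively (\<lambda>u v. (u, v) \<in> E) p"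
  shows "\<exists>W'. subtree E W' \<and> W \<union> set p \<subseteq> W'"
  using assms
proof (induction p arbitrary: W)
  case (Cons x p)
  show ?case
  proof (cases p)
    case Nil
    then show ?thesis using Cons.prems by (intro exI[of _ W]) auto
  next
    case (Cons y ps)
    have e: "(x, y) \<in> E" "successively (\<lambda>u v. (u, v) \<in> E) p" using Cons.prems Cons by auto
    obtain W1 where W1: "subtree E W1" "W \<subseteq> W1" "y \<in> W1"
    proof (cases "y \<in> W")
      case True
      then show ?thesis using that Cons.prems by blast
    next
      case False
      show ?thesis using that[OF subtree.leaf[OF _ _ e(1) False]] Cons.prems by auto
    qed
    obtain W' where "subtree E W'" "W1 \<union> set p \<subseteq> W'"
      using Cons.IH[OF W1(1)] Cons e(2) W1(3) by auto
    then show ?thesis using W1 Cons.prems by (intro exI[of _ W']) auto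
  qed
qed simp

lemma ex_subtree_superset:
  assumes "directed_tree N E" "finite I" "I \<subseteq> N"
  shows "\<exists>W. subtree E W \<and> I \<subseteq> W"
  using assms(2,3)
proof (induction I rule: finite_induct)
  case empty
  show ?case using subtree.root by blast
next
  case (insert i I)
  then obtain W where W: "subtree E W" "I \<subseteq> W" by auto
  show ?case
  proof (cases "i = 0")
    case True
    then show ?thesis using W subtree_root[OF W(1)] by blast
  next
    case False
    then obtain p where p: "directed_path E 0 i p"
      using assms(1) insert.prems unfolding directed_tree_def by blast
    then obtain W' where "subtree E W'" "W \<union> set p \<subseteq> W'"
      using subtree_along_path[OF W(1), of p] subtree_root[OF W(1)] unfolding directed_path_def by auto
    moreover have "i \<in> set p" using p unfolding directed_path_def by auto
    ultimately show ?thesis using W by blast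
  qed
qed

section \<open>Reduction to bounded state spaces\<close>

text \<open>
  The kernels of \<open>mono_kernel\<close> need bounded state spaces, so the processes are compared after the
  transformation \<open>arctan\<close>; \<open>R\<close> is the law of the original vector on \<open>I\<close>, \<open>P\<close> that of the
  transformed one on \<open>W\<close>.
\<close>

definition arctan_related :: "nat set \<Rightarrow> nat set \<Rightarrow> (nat \<Rightarrow> real) measure \<Rightarrow> (nat \<Rightarrow> real) measure \<Rightarrow> bool" where
  "arctan_related I W R P \<longleftrightarrow>
     distr R (Pi\<^sub>M I (\<lambda>_. borel)) (\<lambda>x. \<lambda>i\<in>I. arctan (x i)) = distr P (Pi\<^sub>M I (\<lambda>_. borel)) (\<lambda>x. restrict x I)"

text \<open>\<open>tan\<close> is not monotone on the whole line. Clamping its argument first gives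
  an increasing map defined everywhere that inverts \<open>arctan\<close> up to truncation at
  \<open>k\<close>.\<close>

definition tan_clamp :: "nat \<Rightarrow> real \<Rightarrow> real" where
  "tan_clamp k z = tan (clamp_to (- arctan (real k)) (arctan (real k)) z)"

lemma tan_clamp_mono: "z \<le> z' \<Longrightarrow> tan_clamp k z \<le> tan_clamp k z'"
  unfolding tan_clamp_def
proof (rule tan_mono_le)
  have a: "- (pi / 2) < - arctan (real k)" "arctan (real k) < pi / 2" "- arctan (real k) \<le> arctan (real k)"
    using arctan_bounded[of "real k"] by auto
  have "- arctan (real k) \<le> clamp_to (- arctan (real k)) (arctan (real k)) z"
    "clamp_to (- arctan (real k)) (arctan (real k)) z' \<le> arctan (real k)"
    using a(3) unfolding clamp_to_def by simp_all
  with a show "- (pi / 2) < clamp_to (- arctan (real k)) (arctan (real k)) z"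
    "clamp_to (- arctan (real k)) (arctan (real k)) z' < pi / 2"
    by (blast intro: less_le_trans le_less_trans)+
qed (rule clamp_to_mono)

lemma tan_clamp_borel [measurable]: "tan_clamp k \<in> borel_measurable borel"
  by (rule borel_measurable_mono) (simp add: mono_def tan_clamp_mono)

lemma tan_clamp_arctan: "tan_clamp k (arctan x) = clamp_to (- real k) (real k) x"
proof -
  have "clamp_to (- arctan (real k)) (arctan (real k)) (arctan x) = arctan (clamp_to (- real k) (real k) x)"
    unfolding clamp_to_def arctan_minus[symmetric] max_def min_def by (simp add: arctan_le_iff)
  then show ?thesis by (simp add: tan_clamp_def tan_arctan)
qed

lemma arctan_borel: "arctan \<in> borel_measurable borel"
  by (rule borel_measurable_mono) (simp add: mono_def arctan_monotone')

text \<open>Applied to the transformed vector, \<open>tan_clamp k\<close> returns the original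
  coordinates clamped to \<open>[-k, k]\<close>. Statements about bounded test functions under
  \<open>P\<close> therefore carry over to \<open>R\<close> in the limit.\<close>

lemma arctan_related_limit:
  fixes f :: "(nat \<Rightarrow> real) \<Rightarrow> real"
  assumes fin: "finite I" and IW: "I \<subseteq> W" and R: "prob_space R" "sets R = sets (Pi\<^sub>M I (\<lambda>_. borel))"
    and P: "sets P = sets (Pi\<^sub>M W (\<lambda>_. borel))" and rel: "arctan_related I W R P"
    and f: "f \<in> borel_measurable (Pi\<^sub>M I (\<lambda>_. borel))" "\<And>x. \<bar>f x\<bar> \<le> c"
  shows "(\<lambda>k. \<integral>x. f (\<lambda>i\<in>I. tan_clamp k (x i)) \<partial>P) \<longlonglongrightarrow> (\<integral>x. f x \<partial>R)"
proof -
  interpret R: prob_space R by (rule R)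
  have R_space: "space R = (\<Pi>\<^sub>E i\<in>I. UNIV)" using sets_eq_imp_space_eq[OF R(2)] by (simp add: space_PiM)
  have fk: "(\<lambda>x. f (\<lambda>i\<in>I. tan_clamp k (x i))) \<in> borel_measurable (Pi\<^sub>M I (\<lambda>_. borel))" for k
    by (rule measurable_compose[OF coordinatewise_measurable[OF tan_clamp_borel order_refl] f(1)])
  have aR: "(\<lambda>x. \<lambda>i\<in>I. arctan (x i)) \<in> R \<rightarrow>\<^sub>M Pi\<^sub>M I (\<lambda>_. borel)"
    using coordinatewise_measurable[OF arctan_borel order_refl, of I] by (simp add: R(2) cong: measurable_cong_sets)
  have rP: "(\<lambda>x. restrict x I) \<in> P \<rightarrow>\<^sub>M Pi\<^sub>M I (\<lambda>_. borel)"
    using measurable_restrict_subset[OF IW, of "\<lambda>_. borel :: real measure"] by (simp add: P cong: measurable_cong_sets)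
  have eq: "(\<integral>x. f (\<lambda>i\<in>I. tan_clamp k (x i)) \<partial>P) = (\<integral>x. f (\<lambda>i\<in>I. clamp_to (- real k) (real k) (x i)) \<partial>R)" for k
  proof -
    have "(\<integral>x. f (\<lambda>i\<in>I. tan_clamp k (x i)) \<partial>P) = (\<integral>x. f (\<lambda>i\<in>I. tan_clamp k (restrict x I i)) \<partial>P)"
      by (simp cong: restrict_cong)
    also have "\<dots> = (\<integral>x. f (\<lambda>i\<in>I. tan_clamp k (x i)) \<partial>distr P (Pi\<^sub>M I (\<lambda>_. borel)) (\<lambda>x. restrict x I))"
      by (rule integral_distr[OF rP fk, symmetric])
    also have "\<dots> = (\<integral>x. f (\<lambda>i\<in>I. tan_clamp k (x i)) \<partial>distr R (Pi\<^sub>M I (\<lambda>_. borel)) (\<lambda>x. \<lambda>i\<in>I. arctan (x i)))"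
      using rel by (simp add: arctan_related_def)
    also have "\<dots> = (\<integral>x. f (\<lambda>i\<in>I. tan_clamp k ((\<lambda>i\<in>I. arctan (x i)) i)) \<partial>R)"
      by (rule integral_distr[OF aR fk])
    also have "\<dots> = (\<integral>x. f (\<lambda>i\<in>I. clamp_to (- real k) (real k) (x i)) \<partial>R)"
      by (simp add: tan_clamp_arctan cong: restrict_cong)
    finally show ?thesis .
  qed
  have meas: "g \<in> borel_measurable (Pi\<^sub>M I (\<lambda>_. borel)) \<Longrightarrow> g \<in> borel_measurable R" for g :: "_ \<Rightarrow> real"
    by (simp add: R(2) cong: measurable_cong_sets)
  have "(\<lambda>k. \<integral>x. f (\<lambda>i\<in>I. clamp_to (- real k) (real k) (x i)) \<partial>R) \<longlonglongrightarrow> (\<integral>x. f x \<partial>R)"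
  proof (rule integral_dominated_convergence[where w = "\<lambda>_. c"])
    show "f \<in> borel_measurable R" by (rule meas[OF f(1)])
    show "(\<lambda>x. f (\<lambda>i\<in>I. clamp_to (- real k) (real k) (x i))) \<in> borel_measurable R" for k
      by (rule meas, rule measurable_compose[OF coordinatewise_measurable[OF clamp_to_borel order_refl] f(1)])
    show "AE x in R. (\<lambda>k. f (\<lambda>i\<in>I. clamp_to (- real k) (real k) (x i))) \<longlonglongrightarrow> f x"
    proof (rule AE_I2, rule tendsto_eventually)
      fix x assume "x \<in> space R"
      then have x: "x \<in> (\<Pi>\<^sub>E i\<in>I. UNIV)" by (simp add: R_space)
      obtain n :: nat where n: "(\<Sum>i\<in>I. \<bar>x i\<bar>) \<le> real n" using real_arch_simple by blast
      have "(\<lambda>i\<in>I. clamp_to (- real k) (real k) (x i)) = x" if "k \<ge> n" for k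
      proof -
        have "\<bar>x i\<bar> \<le> real k" if "i \<in> I" for i
          using member_le_sum[OF that, of "\<lambda>i. \<bar>x i\<bar>"] fin n \<open>k \<ge> n\<close> by simp
        then have "clamp_to (- real k) (real k) (x i) = x i" if "i \<in> I" for i
          using that by (intro clamp_to_id) (simp_all only: abs_le_iff minus_le_iff)
        then show ?thesis using x by (auto simp: fun_eq_iff PiE_iff extensional_def)
      qed
      then show "\<forall>\<^sub>F k in sequentially. f (\<lambda>i\<in>I. clamp_to (- real k) (real k) (x i)) = f x"
        unfolding eventually_sequentially by (intro exI[of _ n]) auto
    qed
  qed (use f in auto)
  then show ?thesis unfolding eq .
qed

lemma arctan_related_associated:
  assumes fin: "finite I" and IW: "I \<subseteq> W" and R: "prob_space R" "sets R = sets (Pi\<^sub>M I (\<lambda>_. borel))"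
    and P: "sets P = sets (Pi\<^sub>M W (\<lambda>_. borel))" and rel: "arctan_related I W R P"
    and assoc: "associated W P"
  shows "associated I R"
  unfolding associated_def
proof (intro allI impI)
  fix g h :: "(nat \<Rightarrow> real) \<Rightarrow> real" and c
  assume m: "g \<in> borel_measurable (Pi\<^sub>M I (\<lambda>_. borel))" "h \<in> borel_measurable (Pi\<^sub>M I (\<lambda>_. borel))"
    and b: "\<forall>x. \<bar>g x\<bar> \<le> c \<and> \<bar>h x\<bar> \<le> c"
    and mono: "mono_on (\<Pi>\<^sub>E i\<in>I. UNIV) g" "mono_on (\<Pi>\<^sub>E i\<in>I. UNIV) h"
  have bg: "\<bar>g x\<bar> \<le> c" and bh: "\<bar>h x\<bar> \<le> c" for x using b by auto
  have bgh: "\<bar>g x * h x\<bar> \<le> c * c" for x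
    unfolding abs_mult using bg[of x] bh[of x] by (intro mult_mono) auto
  let ?T = "\<lambda>k x. \<lambda>i\<in>I. tan_clamp k (x i)"
  note lim = arctan_related_limit[OF fin IW R P rel]
  have T: "(\<lambda>x. f (?T k x)) \<in> borel_measurable (Pi\<^sub>M W (\<lambda>_. borel))"
    if "f \<in> borel_measurable (Pi\<^sub>M I (\<lambda>_. borel))" for f :: "_ \<Rightarrow> real" and k
    by (rule measurable_compose[OF coordinatewise_measurable[OF tan_clamp_borel IW] that])
  have T_mono: "mono_on (\<Pi>\<^sub>E i\<in>W. UNIV) (\<lambda>x. f (?T k x))" if "mono_on (\<Pi>\<^sub>E i\<in>I. UNIV) f" for f :: "_ \<Rightarrow> real" and k
  proof (rule mono_onI)
    fix x y :: "nat \<Rightarrow> real" assume "x \<le> y"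
    then have "?T k x \<le> ?T k y" by (auto simp: le_fun_def tan_clamp_mono)
    then show "f (?T k x) \<le> f (?T k y)" by (intro mono_onD[OF that]) auto
  qed
  have "(\<integral>x. g (?T k x) \<partial>P) * (\<integral>x. h (?T k x) \<partial>P) \<le> (\<integral>x. g (?T k x) * h (?T k x) \<partial>P)" for k
  proof -
    have "\<forall>x. \<bar>g (?T k x)\<bar> \<le> c \<and> \<bar>h (?T k x)\<bar> \<le> c" using bg bh by blast
    then show ?thesis
      using assoc T[OF m(1)] T[OF m(2)] T_mono[OF mono(1)] T_mono[OF mono(2)] unfolding associated_def by blast
  qed
  then show "(\<integral>x. g x \<partial>R) * (\<integral>x. h x \<partial>R) \<le> (\<integral>x. g x * h x \<partial>R)"
    by (intro LIMSEQ_le[OF tendsto_mult[OF lim[OF m(1) bg] lim[OF m(2) bh]]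
      lim[OF borel_measurable_times[OF m] bgh]]) auto
qed

lemma arctan_related_supermodular_le:
  assumes fin: "finite I" and IW: "I \<subseteq> W"
    and R: "prob_space R" "sets R = sets (Pi\<^sub>M I (\<lambda>_. borel))" "sets P = sets (Pi\<^sub>M W (\<lambda>_. borel))" "arctan_related I W R P"
    and R': "prob_space R'" "sets R' = sets (Pi\<^sub>M I (\<lambda>_. borel))" "sets P' = sets (Pi\<^sub>M W (\<lambda>_. borel))" "arctan_related I W R' P'"
    and le: "\<And>F c. F \<in> borel_measurable (Pi\<^sub>M W (\<lambda>_. borel)) \<Longrightarrow> (\<And>x. \<bar>F x\<bar> \<le> c) \<Longrightarrow> supermodular W F \<Longrightarrow>
      (\<integral>x. F x \<partial>P) \<le> (\<integral>x. F x \<partial>P')"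
    and f: "f \<in> borel_measurable (Pi\<^sub>M I (\<lambda>_. borel))" "\<And>x. \<bar>f x\<bar> \<le> c" "supermodular I f"
  shows "(\<integral>x. f x \<partial>R) \<le> (\<integral>x. f x \<partial>R')"
proof -
  have "(\<integral>x. f (\<lambda>i\<in>I. tan_clamp k (x i)) \<partial>P) \<le> (\<integral>x. f (\<lambda>i\<in>I. tan_clamp k (x i)) \<partial>P')" for k
    by (rule le[OF measurable_compose[OF coordinatewise_measurable[OF tan_clamp_borel IW] f(1)] f(2)
      coordinatewise_supermodular[OF f(3) tan_clamp_mono]])
  then show ?thesis
    by (intro LIMSEQ_le[OF arctan_related_limit[OF fin IW R f(1,2)] arctan_related_limit[OF fin IW R' f(1,2)]]) auto
qed

text \<open>For thresholds outside the range of \<open>arctan\<close> the events are empty or the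
  whole space, and the boundary values of the copula take the place of \<open>joint\<close>.\<close>

lemma joint_arctan_cdf:
  assumes "prob_space M" and [measurable]: "U \<in> borel_measurable M" "V \<in> borel_measurable M"
    and C: "copula C"
    and joint: "\<And>x y. measure M {\<omega> \<in> space M. U \<omega> \<le> x \<and> V \<omega> \<le> y}
      = C (measure M {\<omega> \<in> space M. U \<omega> \<le> x}) (measure M {\<omega> \<in> space M. V \<omega> \<le> y})"
  shows "measure M {\<omega> \<in> space M. arctan (U \<omega>) \<le> x \<and> arctan (V \<omega>) \<le> y}
      = C (measure M {\<omega> \<in> space M. arctan (U \<omega>) \<le> x}) (measure M {\<omega> \<in> space M. arctan (V \<omega>) \<le> y})"
proof -
  interpret prob_space M by fact
  have C01: "C u 0 = 0" "C 0 u = 0" "C u 1 = u" "C 1 u = u" if "0 \<le> u" "u \<le> 1" for u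
    using C that unfolding copula_def by auto
  have tan: "arctan t \<le> z \<longleftrightarrow> t \<le> tan z" if "- (pi / 2) < z" "z < pi / 2" for t z
    using arctan_le_iff[of t "tan z"] arctan_tan[OF that] by simp
  have lo: "\<not> arctan t \<le> z" if "z \<le> - (pi / 2)" for t z using arctan_bounded[of t] that by linarith
  have hi: "arctan t \<le> z" if "pi / 2 \<le> z" for t z using arctan_bounded[of t] that by linarith
  consider "x \<le> - (pi / 2)" | "y \<le> - (pi / 2)" | "pi / 2 \<le> x" | "pi / 2 \<le> y"
    | "- (pi / 2) < x" "x < pi / 2" "- (pi / 2) < y" "y < pi / 2" by linarith
  then show ?thesis
  proof cases
    case 1
    then show ?thesis by (simp add: lo C01)
  next
    case 2
    then show ?thesis by (simp add: lo C01)
  next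
    case 3
    then show ?thesis by (simp add: hi C01 prob_space)
  next
    case 4
    then show ?thesis by (simp add: hi C01 prob_space)
  next
    case 5
    then show ?thesis by (simp add: tan joint)
  qed
qed

definition arctan_pair :: "'a measure \<Rightarrow> ('a \<Rightarrow> real) \<Rightarrow> ('a \<Rightarrow> real) \<Rightarrow> (real \<times> real) measure" where
  "arctan_pair M U V = distr M borel (\<lambda>\<omega>. (arctan (U \<omega>), arctan (V \<omega>)))"

context
  fixes M :: "'a measure" and U V :: "'a \<Rightarrow> real" and C :: "real \<Rightarrow> real \<Rightarrow> real"
  assumes M: "prob_space M" and U [measurable]: "U \<in> borel_measurable M" and V [measurable]: "V \<in> borel_measurable M"
    and C: "copula C"
    and joint: "\<And>x y. measure M {\<omega> \<in> space M. U \<omega> \<le> x \<and> V \<omega> \<le> y}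
      = C (measure M {\<omega> \<in> space M. U \<omega> \<le> x}) (measure M {\<omega> \<in> space M. V \<omega> \<le> y})"
begin

private lemma pair_borel [measurable]: "(\<lambda>\<omega>. (arctan (U \<omega>), arctan (V \<omega>))) \<in> M \<rightarrow>\<^sub>M (borel :: (real \<times> real) measure)"
proof -
  note [measurable] = arctan_borel
  show ?thesis unfolding borel_prod[symmetric] by measurable
qed

lemma arctan_pair_fst: "distr (arctan_pair M U V) borel fst = distr M borel (\<lambda>\<omega>. arctan (U \<omega>))"
  and arctan_pair_snd: "distr (arctan_pair M U V) borel snd = distr M borel (\<lambda>\<omega>. arctan (V \<omega>))"
  unfolding arctan_pair_def by (subst distr_distr; simp add: comp_def)+

lemma arctan_pair_joint:
  "measure (arctan_pair M U V) ({..x} \<times> {..y})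
    = C (cdf (distr (arctan_pair M U V) borel fst) x) (cdf (distr (arctan_pair M U V) borel snd) y)"
proof -
  note [measurable] = arctan_borel
  have "measure (arctan_pair M U V) ({..x} \<times> {..y}) = measure M {\<omega> \<in> space M. arctan (U \<omega>) \<le> x \<and> arctan (V \<omega>) \<le> y}"
    unfolding arctan_pair_def
    by (subst measure_distr) (auto intro!: times_sets_borel arg_cong[of _ _ "measure M"])
  moreover have "cdf (distr (arctan_pair M U V) borel fst) x = measure M {\<omega> \<in> space M. arctan (U \<omega>) \<le> x}"
    unfolding arctan_pair_fst cdf_def by (subst measure_distr) (auto intro!: arg_cong[of _ _ "measure M"])
  moreover have "cdf (distr (arctan_pair M U V) borel snd) y = measure M {\<omega> \<in> space M. arctan (V \<omega>) \<le> y}"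
    unfolding arctan_pair_snd cdf_def by (subst measure_distr) (auto intro!: arg_cong[of _ _ "measure M"])
  ultimately show ?thesis using joint_arctan_cdf[OF M U V C joint] by simp
qed

lemma arctan_pair_kernel:
  assumes "concave_in_fst C"
  shows "\<exists>q. mono_kernel (arctan_pair M U V) q"
proof (rule ex_mono_kernel[OF _ _ C assms arctan_pair_joint])
  interpret prob_space M by (rule M)
  show "prob_space (arctan_pair M U V)" unfolding arctan_pair_def by (rule prob_space_distr) measurable
  show "sets (arctan_pair M U V) = sets borel" by (simp add: arctan_pair_def)
  note [measurable] = arctan_borel
  have cdf: "cdf (distr (arctan_pair M U V) borel snd) y = measure M {\<omega> \<in> space M. arctan (V \<omega>) \<le> y}" for y
    unfolding arctan_pair_snd cdf_def by (subst measure_distr) (auto intro!: arg_cong[of _ _ "measure M"])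
  \<comment> \<open>The strict bound pi/2 < 2 is the origin of the constant in
    \<open>ex_mono_kernel\<close>.\<close>
  have b: "- 2 < arctan t" "arctan t < 2" for t
    using arctan_bounded[of t] pi_less_4 by linarith+
  show "cdf (distr (arctan_pair M U V) borel snd) y = 0" if "y < - 2" for y
  proof -
    have "\<not> arctan t \<le> y" for t using b(1)[of t] that by linarith
    then show ?thesis by (simp add: cdf)
  qed
  have "arctan t \<le> 2" for t using b(2)[of t] by linarith
  then show "cdf (distr (arctan_pair M U V) borel snd) 2 = 1" by (simp add: cdf prob_space)
qed

end

lemma copula_swap: "copula C \<Longrightarrow> copula (\<lambda>u v. C v u)"
  unfolding copula_def by (simp add: algebra_simps)

text \<open>A concave section lies above its chord from 0 to 1, and for a copula this chord is the
  section of the product copula.\<close>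

lemma concave_in_fst_pqd:
  assumes "copula C" "concave_in_fst C" "u \<in> {0..1}" "v \<in> {0..1}"
  shows "u * v \<le> C u v"
proof -
  have C01: "C 0 v = 0" "C 1 v = v" using assms unfolding copula_def by auto
  consider "u = 0" | "u = 1" | "0 < u" "u < 1" using assms(3) by force
  then show ?thesis
  proof cases
    case 3
    then have "(C 1 v - C u v) * (u - 0) \<le> (C u v - C 0 v) * (1 - u)"
      using assms(2,4) unfolding concave_in_fst_def by (meson order_refl)
    then show ?thesis using C01 by (simp add: algebra_simps)
  qed (use C01 in auto)
qed

section \<open>Product laws\<close>

definition indep_copula :: "real \<Rightarrow> real \<Rightarrow> real" where
  "indep_copula u v = u * v"

lemma copula_indep: "copula indep_copula"
proof -
  have "0 \<le> u' * v' - u' * v - u * v' + u * v" if "u \<le> u'" "v \<le> v'" for u u' v v' :: real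
    using mult_nonneg_nonneg[of "u' - u" "v' - v"] that by (simp add: algebra_simps)
  then show ?thesis unfolding copula_def indep_copula_def by simp
qed

lemma concave_indep: "concave_in_fst indep_copula"
  unfolding concave_in_fst_def indep_copula_def by (simp add: algebra_simps)

lemma pair_measure_cdf:
  fixes \<mu> \<mu>' :: "real measure"
  assumes "prob_space \<mu>" "prob_space \<mu>'" "sets \<mu> = sets borel" "sets \<mu>' = sets borel"
  shows "measure (\<mu> \<Otimes>\<^sub>M \<mu>') ({..x} \<times> {..y}) = cdf \<mu> x * cdf \<mu>' y"
    and "distr (\<mu> \<Otimes>\<^sub>M \<mu>') borel fst = \<mu>" and "distr (\<mu> \<Otimes>\<^sub>M \<mu>') borel snd = \<mu>'"
    and "prob_space (\<mu> \<Otimes>\<^sub>M \<mu>')" and "sets (\<mu> \<Otimes>\<^sub>M \<mu>') = sets borel"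
    and "distr (\<mu> \<Otimes>\<^sub>M \<mu>') borel prod.swap = \<mu>' \<Otimes>\<^sub>M \<mu>"
proof -
  note [simp, measurable_cong] = assms(3,4)
  interpret \<mu>: prob_space \<mu> by fact
  interpret \<mu>': prob_space \<mu>' by fact
  interpret pair_prob_space \<mu> \<mu>' ..
  have sp: "space \<mu> = UNIV" "space \<mu>' = UNIV" using assms(3,4)[THEN sets_eq_imp_space_eq] by auto
  have T: "emeasure (\<mu> \<Otimes>\<^sub>M \<mu>') (A \<times> B) = emeasure \<mu> A * emeasure \<mu>' B" if "A \<in> sets borel" "B \<in> sets borel" for A B
    using that by (intro \<mu>'.emeasure_pair_measure_Times) auto
  show "measure (\<mu> \<Otimes>\<^sub>M \<mu>') ({..x} \<times> {..y}) = cdf \<mu> x * cdf \<mu>' y"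
    using T[of "{..x}" "{..y}"] by (simp add: measure_def cdf_def enn2real_mult)
  show "sets (\<mu> \<Otimes>\<^sub>M \<mu>') = sets borel"
    unfolding borel_prod[symmetric] by (rule sets_pair_measure_cong) auto
  show "prob_space (\<mu> \<Otimes>\<^sub>M \<mu>')" by (rule P.prob_space_axioms)
  show "distr (\<mu> \<Otimes>\<^sub>M \<mu>') borel fst = \<mu>"
  proof (rule measure_eqI)
    fix A assume A: "A \<in> sets (distr (\<mu> \<Otimes>\<^sub>M \<mu>') borel fst)"
    then have "fst -` A \<inter> space (\<mu> \<Otimes>\<^sub>M \<mu>') = A \<times> UNIV" by (auto simp: space_pair_measure sp)
    then show "emeasure (distr (\<mu> \<Otimes>\<^sub>M \<mu>') borel fst) A = emeasure \<mu> A"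
      using A T[of A UNIV] \<mu>'.emeasure_space_1 by (subst emeasure_distr) (auto simp: sp)
  qed simp
  show "distr (\<mu> \<Otimes>\<^sub>M \<mu>') borel snd = \<mu>'"
  proof (rule measure_eqI)
    fix A assume A: "A \<in> sets (distr (\<mu> \<Otimes>\<^sub>M \<mu>') borel snd)"
    then have "snd -` A \<inter> space (\<mu> \<Otimes>\<^sub>M \<mu>') = UNIV \<times> A" by (auto simp: space_pair_measure sp)
    then show "emeasure (distr (\<mu> \<Otimes>\<^sub>M \<mu>') borel snd) A = emeasure \<mu>' A"
      using A T[of UNIV A] \<mu>.emeasure_space_1 by (subst emeasure_distr) (auto simp: sp)
  qed simp
  interpret swapped: pair_sigma_finite \<mu>' \<mu> ..
  have "\<mu>' \<Otimes>\<^sub>M \<mu> = distr (\<mu> \<Otimes>\<^sub>M \<mu>') (\<mu>' \<Otimes>\<^sub>M \<mu>) (\<lambda>(x, y). (y, x))"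
    by (rule swapped.distr_pair_swap)
  also have "\<dots> = distr (\<mu> \<Otimes>\<^sub>M \<mu>') borel prod.swap"
  proof (rule distr_cong)
    show "sets (\<mu>' \<Otimes>\<^sub>M \<mu>) = sets borel"
      unfolding borel_prod[symmetric] by (rule sets_pair_measure_cong) auto
  qed auto
  finally show "distr (\<mu> \<Otimes>\<^sub>M \<mu>') borel prod.swap = \<mu>' \<Otimes>\<^sub>M \<mu>" by simp
qed

lemma product_kernel:
  fixes \<mu> \<mu>' :: "real measure"
  assumes "prob_space \<mu>" "prob_space \<mu>'" "sets \<mu> = sets borel" "sets \<mu>' = sets borel"
    and "\<And>y. y < - 2 \<Longrightarrow> cdf \<mu>' y = 0" "cdf \<mu>' 2 = 1"
  shows "\<exists>q. mono_kernel (\<mu> \<Otimes>\<^sub>M \<mu>') q"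
  using pair_measure_cdf[OF assms(1-4)] assms(5,6)
  by (intro ex_mono_kernel[OF _ _ copula_indep concave_indep]) (auto simp: indep_copula_def)

text \<open>Independent coordinates form a tree law for every edge set, which turns PSMD into an
  instance of the comparison of tree laws.\<close>

lemma product_CI_tree_law:
  fixes \<mu> :: "nat \<Rightarrow> real measure"
  assumes \<mu>: "\<And>n. prob_space (\<mu> n)" "\<And>n. sets (\<mu> n) = sets borel"
    and bnd: "\<And>n y. y < - 2 \<Longrightarrow> cdf (\<mu> n) y = 0" "\<And>n. cdf (\<mu> n) 2 = 1"
  shows "CI_tree_law E \<mu> (\<lambda>(i, j). \<mu> i \<Otimes>\<^sub>M \<mu> j) (\<lambda>W. Pi\<^sub>M W \<mu>)"
proof -
  interpret product_prob_space \<mu> UNIV using \<mu>(1) by (simp add: product_prob_spaceI)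
  note pm = pair_measure_cdf[OF \<mu>(1) \<mu>(1) \<mu>(2) \<mu>(2)]
  have space: "space (\<mu> n) = UNIV" for n using sets_eq_imp_space_eq[OF \<mu>(2)[of n]] by simp
  have setsP: "sets (Pi\<^sub>M W \<mu>) = sets (Pi\<^sub>M W (\<lambda>_. borel))" for W
    by (rule sets_PiM_cong) (auto simp: \<mu>(2))
  have root: "Pi\<^sub>M {0} \<mu> = distr (\<mu> 0) (Pi\<^sub>M {0} (\<lambda>_. borel)) (\<lambda>t. \<lambda>l\<in>{0}. t)"
  proof -
    have m: "(\<lambda>t. \<lambda>l\<in>{0}. t) \<in> \<mu> 0 \<rightarrow>\<^sub>M Pi\<^sub>M {0 :: nat} (\<lambda>_. borel :: real measure)"
      by (rule measurable_restrict) (simp add: measurable_ident_sets \<mu>(2))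
    have "distr (\<mu> 0) (Pi\<^sub>M {0 :: nat} (\<lambda>_. borel)) (\<lambda>t. \<lambda>l\<in>{0}. t)
        = distr (distr (Pi\<^sub>M {0} \<mu>) (\<mu> 0) (\<lambda>x. x 0)) (Pi\<^sub>M {0} (\<lambda>_. borel)) (\<lambda>t. \<lambda>l\<in>{0}. t)"
      by (simp add: distr_singleton)
    also have "\<dots> = distr (Pi\<^sub>M {0} \<mu>) (Pi\<^sub>M {0} (\<lambda>_. borel)) (\<lambda>x. \<lambda>l\<in>{0}. x 0)"
      using m by (subst distr_distr) (auto simp: comp_def)
    also have "\<dots> = distr (Pi\<^sub>M {0} \<mu>) (Pi\<^sub>M {0} \<mu>) (\<lambda>x. x)"
      by (rule distr_cong) (auto simp: setsP space_PiM PiE_iff extensional_def fun_eq_iff)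
    finally show ?thesis by simp
  qed
  have leaf: "leaf_extension W i j (\<mu> i \<Otimes>\<^sub>M \<mu> j) (Pi\<^sub>M W \<mu>) (Pi\<^sub>M (insert j W) \<mu>)"
    if W: "finite W" "i \<in> W" "j \<notin> W" for W i j
    unfolding leaf_extension_def
  proof (intro allI impI)
    fix A :: "nat \<Rightarrow> real set" and T :: "real set" and k :: "real \<Rightarrow> real"
    assume A: "\<forall>l\<in>W. A l \<in> sets borel" and T: "T \<in> sets borel" and k: "k \<in> borel_measurable borel" "\<forall>x. 0 \<le> k x \<and> k x \<le> 1"
      and kT: "\<forall>B\<in>sets borel. measure (\<mu> i \<Otimes>\<^sub>M \<mu> j) (B \<times> T) = (\<integral>x. indicator B x * k x \<partial>distr (\<mu> i \<Otimes>\<^sub>M \<mu> j) borel fst)"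
    \<comment> \<open>The weight \<open>k\<close> is absorbed into the factor of coordinate
      \<open>i\<close>, so the integrand stays a product of functions of single coordinates.\<close>
    define g where "g l = (if l = i then (\<lambda>t. indicator (A i) t * k t) else indicator (A l))" for l
    have g_int: "integrable (\<mu> l) (g l)" if "l \<in> W" for l
    proof (rule integral_bounded_const(1)[OF \<mu>(1), of _ 1])
      show "\<bar>g l x\<bar> \<le> 1" for x using k(2) by (auto simp: g_def indicator_def)
      have "g l \<in> borel_measurable borel"
        using A k(1) W(2) that by (cases "l = i") (auto simp: g_def intro!: borel_measurable_times)
      then show "g l \<in> borel_measurable (\<mu> l)" by (simp add: \<mu>(2) cong: measurable_cong_sets)
    qed
    have gi: "(\<integral>t. g i t \<partial>\<mu> i) = measure (\<mu> i) (A i) * measure (\<mu> j) T"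
    proof -
      have "(\<integral>t. g i t \<partial>\<mu> i) = measure (\<mu> i \<Otimes>\<^sub>M \<mu> j) (A i \<times> T)"
        using kT A W(2) by (simp add: g_def pm(2))
      also have "\<dots> = measure (\<mu> i) (A i) * measure (\<mu> j) T"
        using M.emeasure_pair_measure_Times[of "A i" "\<mu> i" T j] A W(2) T
        by (simp add: measure_def \<mu>(2) enn2real_mult)
      finally show ?thesis .
    qed
    have gl: "(\<integral>t. g l t \<partial>\<mu> l) = measure (\<mu> l) (A l)" if "l \<in> W - {i}" for l
      using that A by (simp add: g_def \<mu>(2) space)
    have "(\<integral>x. indicator (Pi\<^sub>E W A) x * k (x i) \<partial>Pi\<^sub>M W \<mu>) = (\<integral>x. (\<Prod>l\<in>W. g l (x l)) \<partial>Pi\<^sub>M W \<mu>)"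
    proof (rule Bochner_Integration.integral_cong[OF refl])
      fix x assume "x \<in> space (Pi\<^sub>M W \<mu>)"
      then have "(\<Prod>l\<in>W. indicator (A l) (x l)) = (indicator (Pi\<^sub>E W A) x :: real)"
        using W(1) by (auto simp: indicator_def space_PiM PiE_iff prod_zero_iff)
      moreover have "(\<Prod>l\<in>W. g l (x l)) = (\<Prod>l\<in>W. indicator (A l) (x l)) * k (x i)"
        unfolding prod.remove[OF W(1,2)] by (simp add: g_def)
      ultimately show "indicator (Pi\<^sub>E W A) x * k (x i) = (\<Prod>l\<in>W. g l (x l))" by simp
    qed
    also have "\<dots> = (\<Prod>l\<in>W. \<integral>t. g l t \<partial>\<mu> l)"
      by (rule product_integral_prod[OF W(1) g_int])
    also have "\<dots> = measure (\<mu> j) T * (\<Prod>l\<in>W. measure (\<mu> l) (A l))"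
      unfolding prod.remove[OF W(1,2)] gi by (simp add: gl)
    also have "\<dots> = (\<Prod>l\<in>insert j W. measure (\<mu> l) ((A(j := T)) l))"
      using W by (simp add: prod.insert) (intro disjI2 prod.cong; auto)
    also have "\<dots> = measure (Pi\<^sub>M (insert j W) \<mu>) (Pi\<^sub>E (insert j W) (A(j := T)))"
    proof -
      have "emeasure (Pi\<^sub>M (insert j W) \<mu>) (Pi\<^sub>E (insert j W) (A(j := T)))
          = (\<Prod>l\<in>insert j W. emeasure (\<mu> l) ((A(j := T)) l))"
        using W A T by (intro emeasure_PiM) (auto simp: \<mu>(2))
      also have "\<dots> = ennreal (\<Prod>l\<in>insert j W. measure (\<mu> l) ((A(j := T)) l))"
        by (simp add: prod_ennreal M.emeasure_eq_measure)
      finally show ?thesis by (simp add: measure_def prod_nonneg)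
    qed
    finally show "measure (Pi\<^sub>M (insert j W) \<mu>) (Pi\<^sub>E (insert j W) (A(j := T)))
        = (\<integral>x. indicator (Pi\<^sub>E W A) x * k (x i) \<partial>Pi\<^sub>M W \<mu>)" by simp
  qed
  have kernel: "\<exists>q. mono_kernel (\<mu> i \<Otimes>\<^sub>M \<mu> j) q" for i j
    by (rule product_kernel[OF \<mu>(1) \<mu>(1) \<mu>(2) \<mu>(2) bnd])
  show ?thesis
  proof (intro CI_tree_law.intro tree_law.intro CI_tree_law_axioms.intro)
    show "prob_space (Pi\<^sub>M W \<mu>)" for W by (rule prob_space_PiM) (rule \<mu>)
    show "leaf_extension W i j (case (i, j) of (i, j) \<Rightarrow> \<mu> i \<Otimes>\<^sub>M \<mu> j) (Pi\<^sub>M W \<mu>) (Pi\<^sub>M (insert j W) \<mu>)"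
      if "subtree E W" "i \<in> W" "(i, j) \<in> E" "j \<notin> W" for W i j
      using leaf[OF subtree_finite[OF that(1)] that(2,4)] by simp
  qed (use \<mu> pm root setsP kernel in \<open>auto split: prod.split\<close>)
qed

section \<open>Markov tree processes\<close>

text \<open>The point mass outside \<open>N\<close> supplies a probability measure at every natural
  number, as \<open>tree_law\<close> and the product measures ask for.\<close>

definition marginals :: "'a measure \<Rightarrow> (nat \<Rightarrow> 'a \<Rightarrow> real) \<Rightarrow> nat set \<Rightarrow> nat \<Rightarrow> real measure" where
  "marginals M X N n = (if n \<in> N then distr M borel (X n) else return borel 0)"

definition arctan_law :: "real measure \<Rightarrow> real measure" where
  "arctan_law \<mu> = distr \<mu> borel arctan"

lemma arctan_law_facts:
  assumes "prob_space \<mu>" and sets: "sets \<mu> = sets borel"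
  shows "prob_space (arctan_law \<mu>)" "sets (arctan_law \<mu>) = sets borel"
    "y < - 2 \<Longrightarrow> cdf (arctan_law \<mu>) y = 0" "cdf (arctan_law \<mu>) 2 = 1"
proof -
  interpret prob_space \<mu> by fact
  have a: "arctan \<in> \<mu> \<rightarrow>\<^sub>M borel" using arctan_borel by (simp add: sets cong: measurable_cong_sets)
  have sp: "space \<mu> = UNIV" using sets_eq_imp_space_eq[OF sets] by simp
  show "prob_space (arctan_law \<mu>)" unfolding arctan_law_def by (rule prob_space_distr[OF a])
  show "sets (arctan_law \<mu>) = sets borel" by (simp add: arctan_law_def)
  have cdf: "cdf (arctan_law \<mu>) y = measure \<mu> {t. arctan t \<le> y}" for y
    unfolding arctan_law_def cdf_def by (subst measure_distr[OF a]) (auto simp: sp vimage_def)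
  have b: "- 2 < arctan t" "arctan t < 2" for t
    using arctan_bounded[of t] pi_less_4 by linarith+
  show "cdf (arctan_law \<mu>) y = 0" if "y < - 2"
  proof -
    have "\<not> arctan t \<le> y" for t using b(1)[of t] that by linarith
    then show ?thesis by (simp add: cdf)
  qed
  have "arctan t \<le> 2" for t using b(2)[of t] by linarith
  then show "cdf (arctan_law \<mu>) 2 = 1" using prob_space by (simp add: cdf sp)
qed

locale markov_process =
  fixes N :: "nat set" and E :: "(nat \<times> nat) set" and F :: "nat \<Rightarrow> real \<Rightarrow> real"
    and B :: "nat \<times> nat \<Rightarrow> real \<Rightarrow> real \<Rightarrow> real" and M :: "'a measure" and X :: "nat \<Rightarrow> 'a \<Rightarrow> real"
  assumes index: "index_set N" and tree: "directed_tree N E" and cop: "e \<in> E \<Longrightarrow> copula (B e)"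
    and dist: "has_markov_tree_dist M X F N E B" and concave: "e \<in> E \<Longrightarrow> concave_in_fst (B e)"
begin

definition \<mu> :: "nat \<Rightarrow> real measure" where "\<mu> = marginals M X N"
definition Z :: "nat \<Rightarrow> 'a \<Rightarrow> real" where "Z n \<omega> = arctan (X n \<omega>)"
definition \<nu> :: "nat \<times> nat \<Rightarrow> (real \<times> real) measure" where
  "\<nu> e = arctan_pair M (X (fst e)) (X (snd e))"

lemma M_prob: "prob_space M" and X_borel: "n \<in> N \<Longrightarrow> X n \<in> borel_measurable M"
  and F_eq: "n \<in> N \<Longrightarrow> cdf (distr M borel (X n)) = F n"
  and joint_F: "(i, j) \<in> E \<Longrightarrow> measure M {\<omega> \<in> space M. X i \<omega> \<le> x \<and> X j \<omega> \<le> y} = B (i, j) (F i x) (F j y)"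
  using dist unfolding has_markov_tree_dist_def by auto

sublocale M: prob_space M by (rule M_prob)

lemma edge: "(i, j) \<in> E \<Longrightarrow> i \<in> N" "(i, j) \<in> E \<Longrightarrow> j \<in> N"
  using directed_tree_edges[OF tree] by auto

lemma Z_borel: "n \<in> N \<Longrightarrow> Z n \<in> borel_measurable M"
  unfolding Z_def by (rule measurable_compose[OF X_borel arctan_borel])

lemma \<mu>_facts: "prob_space (\<mu> n)" "sets (\<mu> n) = sets borel"
  unfolding \<mu>_def marginals_def using X_borel
  by (auto intro!: M.prob_space_distr prob_space_return)

lemma joint: "(i, j) \<in> E \<Longrightarrow> measure M {\<omega> \<in> space M. X i \<omega> \<le> x \<and> X j \<omega> \<le> y}
    = B (i, j) (measure M {\<omega> \<in> space M. X i \<omega> \<le> x}) (measure M {\<omega> \<in> space M. X j \<omega> \<le> y})"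
proof -
  assume e: "(i, j) \<in> E"
  have "F n x = measure M {\<omega> \<in> space M. X n \<omega> \<le> x}" if "n \<in> N" for n x
    unfolding F_eq[OF that, symmetric] cdf_def
    by (subst measure_distr[OF X_borel[OF that]]) (auto intro!: arg_cong[of _ _ "measure M"])
  then show ?thesis using joint_F[OF e] edge[OF e] by simp
qed

lemma arctan_marginal: "n \<in> N \<Longrightarrow> arctan_law (\<mu> n) = distr M borel (Z n)"
  unfolding arctan_law_def \<mu>_def marginals_def Z_def
  using distr_distr[OF arctan_borel X_borel] by (simp add: comp_def)

lemma \<nu>_marginals:
  assumes e: "(i, j) \<in> E"
  shows "distr (\<nu> (i, j)) borel fst = arctan_law (\<mu> i)" "distr (\<nu> (i, j)) borel snd = arctan_law (\<mu> j)"
proof -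
  note X = X_borel[OF edge(1)[OF e]] X_borel[OF edge(2)[OF e]]
  show "distr (\<nu> (i, j)) borel fst = arctan_law (\<mu> i)"
    using arctan_pair_fst[OF M_prob X cop[OF e] joint[OF e]] arctan_marginal[OF edge(1)[OF e]]
    by (simp add: \<nu>_def Z_def[abs_def])
  show "distr (\<nu> (i, j)) borel snd = arctan_law (\<mu> j)"
    using arctan_pair_snd[OF M_prob X cop[OF e] joint[OF e]] arctan_marginal[OF edge(2)[OF e]]
    by (simp add: \<nu>_def Z_def[abs_def])
qed

lemma \<nu>_joint:
  assumes e: "(i, j) \<in> E"
  shows "measure (\<nu> (i, j)) ({..x} \<times> {..y}) = B (i, j) (cdf (arctan_law (\<mu> i)) x) (cdf (arctan_law (\<mu> j)) y)"
  using arctan_pair_joint[OF M_prob X_borel[OF edge(1)[OF e]] X_borel[OF edge(2)[OF e]] cop[OF e] joint[OF e], of x y]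
    \<nu>_marginals[OF e] by (simp add: \<nu>_def)

text \<open>The Markov property is given for \<open>X\<close>, the extension is claimed for
  \<open>Z\<close>. Test sets are pulled back along \<open>arctan\<close>, and the weight becomes
  \<open>k\<close> composed with \<open>arctan\<close>.\<close>

lemma leaf_law:
  assumes W: "subtree E W" "i \<in> W" "(i, j) \<in> E" "j \<notin> W"
  shows "leaf_extension W i j (\<nu> (i, j)) (law M Z W) (law M Z (insert j W))"
  unfolding leaf_extension_def
proof (intro allI impI)
  fix A :: "nat \<Rightarrow> real set" and T :: "real set" and k :: "real \<Rightarrow> real"
  assume A: "\<forall>l\<in>W. A l \<in> sets borel" and T: "T \<in> sets borel" and k: "k \<in> borel_measurable borel" "\<forall>x. 0 \<le> k x \<and> k x \<le> 1"
    and kT: "\<forall>B\<in>sets borel. measure (\<nu> (i, j)) (B \<times> T) = (\<integral>x. indicator B x * k x \<partial>distr (\<nu> (i, j)) borel fst)"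
  note [measurable] = T k(1)
  have WN: "insert j W \<subseteq> N" by (rule subtree_subset[OF index tree subtree.leaf[OF W]])
  then have iN: "i \<in> N" "j \<in> N" using W by auto
  note [measurable] = X_borel[OF iN(1)] X_borel[OF iN(2)] Z_borel[OF iN(1)] Z_borel[OF iN(2)] arctan_borel
  have Zb: "n \<in> insert j W \<Longrightarrow> Z n \<in> borel_measurable M" for n using WN Z_borel by auto
  have sub: "subvector I Z \<in> M \<rightarrow>\<^sub>M Pi\<^sub>M I (\<lambda>_. borel)" if "I \<subseteq> insert j W" for I
    by (rule subvector_measurable) (use that Zb in auto)
  have fin: "finite W" by (rule subtree_finite[OF W(1)])
  let ?k = "\<lambda>x. k (arctan x)"
  have ci: "cond_indep_given M X (W - {i}) {j} i"
  proof -
    have "markov_tree M X N E" using dist by (simp add: has_markov_tree_dist_def)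
    then show ?thesis
      unfolding markov_tree_def
      by (elim allE[of _ "W - {i}"] allE[of _ "{j}"] allE[of _ i])
         (use subtree_separates[OF W] fin WN W(4) iN in auto)
  qed
  have kX: "measure M {\<omega> \<in> space M. X i \<omega> \<in> B' \<and> X j \<omega> \<in> arctan -` T} = (\<integral>\<omega>. indicator B' (X i \<omega>) * ?k (X i \<omega>) \<partial>M)"
    if B': "B' \<in> sets borel" for B'
  proof -
    \<comment> \<open>\<open>kT\<close> speaks of events of the transformed variable. Since
      \<open>tan\<close> inverts \<open>arctan\<close>, every event of \<open>X i\<close> is of this
      form, so the two variables generate the same sigma-algebra.\<close>
    define B0 where "B0 = (tan :: real \<Rightarrow> real) -` B'"
    have "(tan :: real \<Rightarrow> real) \<in> borel_measurable borel"
      unfolding tan_def by measurable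
    from measurable_sets[OF this B'] have B0 [measurable]: "B0 \<in> sets borel" by (simp add: B0_def)
    have B0_iff: "arctan x \<in> B0 \<longleftrightarrow> x \<in> B'" for x by (simp add: B0_def tan_arctan)
    have p: "(\<lambda>\<omega>. (arctan (X i \<omega>), arctan (X j \<omega>))) \<in> M \<rightarrow>\<^sub>M (borel :: (real \<times> real) measure)"
      unfolding borel_prod[symmetric] by measurable
    have "measure (\<nu> (i, j)) (B0 \<times> T) = measure M {\<omega> \<in> space M. X i \<omega> \<in> B' \<and> X j \<omega> \<in> arctan -` T}"
      unfolding \<nu>_def arctan_pair_def using B0_iff
      by (subst measure_distr) (auto intro!: p times_sets_borel arg_cong[of _ _ "measure M"])
    moreover have "(\<integral>x. indicator B0 x * k x \<partial>distr (\<nu> (i, j)) borel fst) = (\<integral>\<omega>. indicator B' (X i \<omega>) * ?k (X i \<omega>) \<partial>M)"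
      unfolding \<nu>_marginals[OF W(3)] arctan_marginal[OF iN(1)]
      by (subst integral_distr) (auto simp: Z_def B0_iff indicator_def)
    ultimately show ?thesis using kT B0 by auto
  qed
  have "measure (law M Z (insert j W)) (Pi\<^sub>E (insert j W) (A(j := T)))
      = measure M {\<omega> \<in> space M. (\<forall>l\<in>W. X l \<omega> \<in> arctan -` A l) \<and> X j \<omega> \<in> arctan -` T}"
  proof -
    have "Pi\<^sub>E (insert j W) (A(j := T)) \<in> sets (Pi\<^sub>M (insert j W) (\<lambda>_. borel))"
      using fin A T by (intro sets_PiM_I_finite) auto
    then have "measure (law M Z (insert j W)) (Pi\<^sub>E (insert j W) (A(j := T)))
      = measure M (subvector (insert j W) Z -` Pi\<^sub>E (insert j W) (A(j := T)) \<inter> space M)"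
      unfolding law_def by (intro measure_distr sub) auto
    also have "subvector (insert j W) Z -` Pi\<^sub>E (insert j W) (A(j := T)) \<inter> space M
      = {\<omega> \<in> space M. (\<forall>l\<in>W. X l \<omega> \<in> arctan -` A l) \<and> X j \<omega> \<in> arctan -` T}"
      unfolding subvector_def vimage_def restrict_PiE_iff using W(4) by (auto simp: Z_def)
    finally show ?thesis .
  qed
  also have "\<dots> = (\<integral>\<omega>. indicator {\<omega> \<in> space M. \<forall>l\<in>W. X l \<omega> \<in> arctan -` A l} \<omega> * ?k (X i \<omega>) \<partial>M)"
  proof (rule cond_indep_box[OF M_prob fin W(2,4) _ ci])
    show "arctan -` A l \<in> sets borel" if "l \<in> W" for l
      using measurable_sets[OF arctan_borel, of "A l"] A that by simp
    show "arctan -` T \<in> sets borel" using measurable_sets[OF arctan_borel T] by simp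
    show "?k \<in> borel_measurable borel" by (rule measurable_compose[OF arctan_borel k(1)])
  qed (use k(2) kX X_borel WN in auto)
  also have "\<dots> = (\<integral>x. indicator (Pi\<^sub>E W A) x * k (x i) \<partial>law M Z W)"
  proof -
    have "Pi\<^sub>E W A \<in> sets (Pi\<^sub>M W (\<lambda>_. borel))" using fin A by (intro sets_PiM_I_finite) auto
    then have "(\<lambda>x. indicator (Pi\<^sub>E W A) x * k (x i)) \<in> borel_measurable (Pi\<^sub>M W (\<lambda>_. borel))"
      by (intro borel_measurable_times borel_measurable_indicator
        measurable_compose[OF measurable_component_singleton[OF W(2)] k(1)])
    then have "(\<integral>x. indicator (Pi\<^sub>E W A) x * k (x i) \<partial>law M Z W)
        = (\<integral>\<omega>. indicator (Pi\<^sub>E W A) (subvector W Z \<omega>) * k (subvector W Z \<omega> i) \<partial>M)"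
      unfolding law_def by (intro integral_distr sub) auto
    also have "\<dots> = (\<integral>\<omega>. indicator {\<omega> \<in> space M. \<forall>l\<in>W. X l \<omega> \<in> arctan -` A l} \<omega> * ?k (X i \<omega>) \<partial>M)"
      using W(2) by (intro Bochner_Integration.integral_cong)
        (auto simp: indicator_def subvector_def restrict_PiE_iff Z_def)
    finally show ?thesis by simp
  qed
  finally show "measure (law M Z (insert j W)) (Pi\<^sub>E (insert j W) (A(j := T)))
      = (\<integral>x. indicator (Pi\<^sub>E W A) x * k (x i) \<partial>law M Z W)" .
qed

lemma tree_law_Z: "tree_law E (\<lambda>n. arctan_law (\<mu> n)) \<nu> (law M Z)"
proof (rule tree_law.intro)
  note af = arctan_law_facts[OF \<mu>_facts]
  show "prob_space (arctan_law (\<mu> n))" "sets (arctan_law (\<mu> n)) = sets borel" for n by (rule af)+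
  show "sets (\<nu> e) = sets borel" for e by (simp add: \<nu>_def arctan_pair_def)
  show "distr (\<nu> (i, j)) borel fst = arctan_law (\<mu> i)" "distr (\<nu> (i, j)) borel snd = arctan_law (\<mu> j)"
    if "(i, j) \<in> E" for i j using that by (rule \<nu>_marginals)+
  show "prob_space (\<nu> e)" if "e \<in> E" for e
  proof -
    obtain i j where e: "e = (i, j)" by (cases e)
    note [measurable] = X_borel[OF edge(1)] X_borel[OF edge(2)] arctan_borel
    show ?thesis unfolding \<nu>_def e arctan_pair_def
      by (rule M.prob_space_distr) (use that e in \<open>simp add: borel_prod[symmetric]\<close>)
  qed
  have sub: "subvector W Z \<in> M \<rightarrow>\<^sub>M Pi\<^sub>M W (\<lambda>_. borel)" if "subtree E W" for W
    by (rule subvector_measurable) (use subtree_subset[OF index tree that] Z_borel in auto)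
  show "prob_space (law M Z W)" if "subtree E W" for W
    unfolding law_def by (rule M.prob_space_distr[OF sub[OF that]])
  show "sets (law M Z W) = sets (Pi\<^sub>M W (\<lambda>_. borel))" for W by (simp add: law_def)
  have 0: "0 \<in> N" using index by (auto simp: index_set_def)
  have "(\<lambda>t. \<lambda>l\<in>{0}. t) \<in> borel \<rightarrow>\<^sub>M Pi\<^sub>M {0 :: nat} (\<lambda>_. borel :: real measure)"
    by (rule measurable_restrict) simp
  from distr_distr[OF this Z_borel[OF 0]]
  show "law M Z {0} = distr (arctan_law (\<mu> 0)) (Pi\<^sub>M {0} (\<lambda>_. borel)) (\<lambda>t. \<lambda>l\<in>{0}. t)"
    unfolding arctan_marginal[OF 0] law_def subvector_def comp_def
    by (auto intro!: distr_cong simp: fun_eq_iff)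
  show "leaf_extension W i j (\<nu> (i, j)) (law M Z W) (law M Z (insert j W))"
    if "subtree E W" "i \<in> W" "(i, j) \<in> E" "j \<notin> W" for W i j by (rule leaf_law[OF that])
  show "\<exists>q. mono_kernel (\<nu> e) q" if "e \<in> E" for e
  proof -
    obtain i j where e: "e = (i, j)" by (cases e)
    then show ?thesis
      using arctan_pair_kernel[OF M_prob X_borel X_borel cop joint concave, of i j] that edge by (simp add: \<nu>_def)
  qed
qed

lemma swap_kernel:
  assumes e: "(i, j) \<in> E" and conc: "concave_in_fst (\<lambda>u v. B (i, j) v u)"
  shows "\<exists>q. mono_kernel (distr (\<nu> (i, j)) borel prod.swap) q"
proof -
  note X = X_borel[OF edge(1)[OF e]] X_borel[OF edge(2)[OF e]]
  note [measurable] = X arctan_borel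
  have "prod.swap \<in> borel \<rightarrow>\<^sub>M (borel :: (real \<times> real) measure)"
    unfolding prod.swap_def borel_prod[symmetric] by measurable
  moreover have "(\<lambda>\<omega>. (arctan (X i \<omega>), arctan (X j \<omega>))) \<in> M \<rightarrow>\<^sub>M (borel :: (real \<times> real) measure)"
    unfolding borel_prod[symmetric] by measurable
  ultimately have "distr (\<nu> (i, j)) borel prod.swap = arctan_pair M (X j) (X i)"
    unfolding \<nu>_def arctan_pair_def by (simp add: distr_distr comp_def)
  moreover have "measure M {\<omega> \<in> space M. X j \<omega> \<le> x \<and> X i \<omega> \<le> y}
      = B (i, j) (measure M {\<omega> \<in> space M. X i \<omega> \<le> y}) (measure M {\<omega> \<in> space M. X j \<omega> \<le> x})" for x y
    using joint[OF e, of y x] by (simp add: conj_commute)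
  ultimately show ?thesis
    using arctan_pair_kernel[OF M_prob X(2,1) copula_swap[OF cop[OF e]] _ conc] by simp
qed

lemma vector_facts:
  assumes "I \<subseteq> N"
  shows "prob_space (law M X I)" "sets (law M X I) = sets (Pi\<^sub>M I (\<lambda>_. borel))"
    "\<And>i. i \<in> I \<Longrightarrow> distr (law M X I) borel (\<lambda>x. x i) = \<mu> i"
    "I \<subseteq> W \<Longrightarrow> W \<subseteq> N \<Longrightarrow> arctan_related I W (law M X I) (law M Z W)"
proof -
  have sX: "subvector I X \<in> M \<rightarrow>\<^sub>M Pi\<^sub>M I (\<lambda>_. borel)"
    by (rule subvector_measurable) (use assms X_borel in auto)
  show "prob_space (law M X I)" unfolding law_def by (rule M.prob_space_distr[OF sX])
  show "sets (law M X I) = sets (Pi\<^sub>M I (\<lambda>_. borel))" by (simp add: law_def)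
  show "distr (law M X I) borel (\<lambda>x. x i) = \<mu> i" if "i \<in> I" for i
    unfolding law_def
    by (subst distr_distr[OF measurable_component_singleton[OF that] sX])
       (use that assms in \<open>auto simp: comp_def subvector_def \<mu>_def marginals_def\<close>)
  show "arctan_related I W (law M X I) (law M Z W)" if "I \<subseteq> W" "W \<subseteq> N"
  proof -
    have sZ: "subvector W Z \<in> M \<rightarrow>\<^sub>M Pi\<^sub>M W (\<lambda>_. borel)"
      by (rule subvector_measurable) (use that Z_borel in auto)
    show ?thesis
      unfolding arctan_related_def law_def
        distr_distr[OF coordinatewise_measurable[OF arctan_borel order_refl] sX]
        distr_distr[OF measurable_restrict_subset[OF that(1)] sZ]
      using that(1) by (intro distr_cong refl) (auto simp: comp_def subvector_def Z_def restrict_def fun_eq_iff)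
  qed
qed

lemma indep_law_eq: "I \<subseteq> N \<Longrightarrow> indep_law M X I = Pi\<^sub>M I \<mu>"
  unfolding indep_law_def by (rule PiM_cong) (auto simp: \<mu>_def marginals_def)

end

text \<open>Returns from bounded functions on \<open>W\<close> to \<open>b\<close>-bounded ones on
  \<open>I\<close>. Integrability of the weight makes the test function integrable under
  \<open>R\<close>, \<open>R'\<close> and the product law, the last being needed for the base point
  in \<open>supermodular_le_of_bounded\<close>.\<close>

lemma le_sm_vec_of_tree_laws:
  fixes R R' P P' :: "(nat \<Rightarrow> real) measure" and \<mu> :: "nat \<Rightarrow> real measure"
  assumes fin: "finite I" and IW: "I \<subseteq> W"
    and R: "prob_space R" "sets R = sets (Pi\<^sub>M I (\<lambda>_. borel))" "\<And>i. i \<in> I \<Longrightarrow> distr R borel (\<lambda>x. x i) = \<mu> i"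
    and P: "arctan_related I W R P" "sets P = sets (Pi\<^sub>M W (\<lambda>_. borel))" "associated W P"
    and R': "prob_space R'" "sets R' = sets (Pi\<^sub>M I (\<lambda>_. borel))" "\<And>i. i \<in> I \<Longrightarrow> distr R' borel (\<lambda>x. x i) = \<mu> i"
    and P': "arctan_related I W R' P'" "sets P' = sets (Pi\<^sub>M W (\<lambda>_. borel))" "associated W P'"
    and \<mu>: "\<And>n. prob_space (\<mu> n)" "\<And>n. sets (\<mu> n) = sets borel"
    and le: "\<And>F c. F \<in> borel_measurable (Pi\<^sub>M W (\<lambda>_. borel)) \<Longrightarrow> (\<And>x. \<bar>F x\<bar> \<le> c) \<Longrightarrow> supermodular W F \<Longrightarrow>
      (\<integral>x. F x \<partial>P) \<le> (\<integral>x. F x \<partial>P')"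
    and b: "weight_function I b" "integrable R b" "integrable R' b" "integrable (Pi\<^sub>M I \<mu>) b"
  shows "le_sm_vec I b R R'"
  unfolding le_sm_vec_def
proof (intro ballI impI)
  fix f :: "(nat \<Rightarrow> real) \<Rightarrow> real"
  assume f: "f \<in> borel_measurable (Pi\<^sub>M I (\<lambda>_. borel))" and fb: "b_bounded I b f" and sm: "supermodular I f"
  obtain K where K: "\<And>x. x \<in> (\<Pi>\<^sub>E i\<in>I. UNIV) \<Longrightarrow> \<bar>f x\<bar> / b x \<le> K"
    using fb unfolding b_bounded_def bdd_above_def by auto
  have f_int: "integrable S f" if "integrable S b" "sets S = sets (Pi\<^sub>M I (\<lambda>_. borel))" for S
  proof (rule Bochner_Integration.integrable_bound)
    show "integrable S (\<lambda>x. K * b x)" using that(1) by simp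
    show "f \<in> borel_measurable S" using f by (simp add: that(2) cong: measurable_cong_sets)
    show "AE x in S. norm (f x) \<le> norm (K * b x)"
    proof (rule AE_I2)
      fix x assume "x \<in> space S"
      then have x: "x \<in> (\<Pi>\<^sub>E i\<in>I. UNIV)" using sets_eq_imp_space_eq[OF that(2)] by (simp add: space_PiM)
      have "1 \<le> b x" using b(1) x unfolding weight_function_def by blast
      then have "\<bar>f x\<bar> \<le> K * b x" using K[OF x] by (simp add: pos_divide_le_eq)
      then show "norm (f x) \<le> norm (K * b x)" by simp
    qed
  qed
  have sets\<Pi>: "sets (Pi\<^sub>M I \<mu>) = sets (Pi\<^sub>M I (\<lambda>_. borel))" by (rule sets_PiM_cong) (auto simp: \<mu>(2))
  show "(\<integral>x. f x \<partial>R) \<le> (\<integral>x. f x \<partial>R')"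
  proof (rule supermodular_le_of_bounded[OF fin R(1,2) _ R(3) R'(1,2) _ R'(3) \<mu> _ f sm])
    show "associated I R" by (rule arctan_related_associated[OF fin IW R(1,2) P(2,1,3)])
    show "associated I R'" by (rule arctan_related_associated[OF fin IW R'(1,2) P'(2,1,3)])
    show "(\<integral>x. g x \<partial>R) \<le> (\<integral>x. g x \<partial>R')"
      if "g \<in> borel_measurable (Pi\<^sub>M I (\<lambda>_. borel))" "\<And>x. \<bar>g x\<bar> \<le> c" "supermodular I g" for g c
      by (rule arctan_related_supermodular_le[OF fin IW R(1,2) P(2,1) R'(1,2) P'(2,1) le that])
  qed (use f_int b R(2) R'(2) sets\<Pi> in auto)
qed

lemma product_arctan_related:
  fixes \<mu> :: "nat \<Rightarrow> real measure"
  assumes \<mu>: "\<And>n. prob_space (\<mu> n)" "\<And>n. sets (\<mu> n) = sets borel" and W: "finite W" "I \<subseteq> W"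
  shows "arctan_related I W (Pi\<^sub>M I \<mu>) (Pi\<^sub>M W (\<lambda>n. arctan_law (\<mu> n)))"
proof -
  note af = arctan_law_facts[OF \<mu>]
  interpret product_prob_space "\<lambda>n. arctan_law (\<mu> n)" UNIV using af(1) by (simp add: product_prob_spaceI)
  have fin: "finite I" using W finite_subset by blast
  have a: "arctan \<in> \<mu> n \<rightarrow>\<^sub>M borel" for n using arctan_borel by (simp add: \<mu>(2) cong: measurable_cong_sets)
  have s: "sets (Pi\<^sub>M I (\<lambda>_. borel)) = sets (Pi\<^sub>M I (\<lambda>n. arctan_law (\<mu> n)))"
    by (rule sets_PiM_cong) (auto simp: af(2))
  have "distr (Pi\<^sub>M I \<mu>) (Pi\<^sub>M I (\<lambda>_. borel)) (\<lambda>x. \<lambda>i\<in>I. arctan (x i))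
      = distr (Pi\<^sub>M I \<mu>) (Pi\<^sub>M I (\<lambda>n. arctan_law (\<mu> n))) (compose I arctan)"
    using s by (intro distr_cong) (auto simp: compose_def)
  also have "\<dots> = Pi\<^sub>M I (\<lambda>n. distr (\<mu> n) (arctan_law (\<mu> n)) arctan)"
    using \<mu> af(1) a by (intro distr_PiM_finite_prob_space' fin) (auto simp: af(2) cong: measurable_cong_sets)
  also have "\<dots> = Pi\<^sub>M I (\<lambda>n. arctan_law (\<mu> n))"
    unfolding arctan_law_def by (intro PiM_cong refl distr_cong) auto
  also have "\<dots> = distr (Pi\<^sub>M W (\<lambda>n. arctan_law (\<mu> n))) (Pi\<^sub>M I (\<lambda>n. arctan_law (\<mu> n))) (\<lambda>x. restrict x I)"
    by (rule distr_restrict[OF W(2,1)])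
  also have "\<dots> = distr (Pi\<^sub>M W (\<lambda>n. arctan_law (\<mu> n))) (Pi\<^sub>M I (\<lambda>_. borel)) (\<lambda>x. restrict x I)"
    using s by (intro distr_cong) auto
  finally show ?thesis unfolding arctan_related_def .
qed

section \<open>Positive dependence and the comparison of processes\<close>

context markov_process
begin

lemma arctan_\<mu>_facts: "prob_space (arctan_law (\<mu> n))" "sets (arctan_law (\<mu> n)) = sets borel"
    "y < - 2 \<Longrightarrow> cdf (arctan_law (\<mu> n)) y = 0" "cdf (arctan_law (\<mu> n)) 2 = 1"
  by (rule arctan_law_facts[OF \<mu>_facts], assumption?)+

lemma cdf_bounds: "cdf (arctan_law (\<mu> n)) x \<in> {0..1}"
proof -
  interpret prob_space "arctan_law (\<mu> n)" by (rule arctan_\<mu>_facts)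
  show ?thesis by (simp add: cdf_def)
qed

lemma product_law: "CI_tree_law E (\<lambda>n. arctan_law (\<mu> n)) (\<lambda>(i, j). arctan_law (\<mu> i) \<Otimes>\<^sub>M arctan_law (\<mu> j))
    (\<lambda>W. Pi\<^sub>M W (\<lambda>n. arctan_law (\<mu> n)))"
  by (rule product_CI_tree_law) (use arctan_\<mu>_facts in auto)

lemma vector_indices_facts:
  assumes "I \<in> vector_indices N"
  shows "finite I" "I \<subseteq> N"
  using assms by (auto simp: vector_indices_def split: if_splits)

text \<open>The reversed comparison is used: the process itself has the role of the SI side and the
  independent vector that of the CI side, the edges being ordered by
  \<open>concave_in_fst_pqd\<close>.\<close>

lemma PSMD_process:
  assumes b: "\<forall>I\<in>vector_indices N. weight_function I (b I)"
    and int: "b_integrable N b (law M X)" "b_integrable N b (indep_law M X)"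
  shows "PSMD N b M X"
  unfolding PSMD_def le_sm_def
proof
  fix I assume I: "I \<in> vector_indices N"
  note IN = vector_indices_facts[OF I]
  obtain W where W: "subtree E W" "I \<subseteq> W" using ex_subtree_superset[OF tree IN] by blast
  note WN = subtree_subset[OF index tree W(1)] and finW = subtree_finite[OF W(1)]
  interpret T: tree_law E "\<lambda>n. arctan_law (\<mu> n)" \<nu> "law M Z" by (rule tree_law_Z)
  interpret \<Pi>: CI_tree_law E "\<lambda>n. arctan_law (\<mu> n)" "\<lambda>(i, j). arctan_law (\<mu> i) \<Otimes>\<^sub>M arctan_law (\<mu> j)"
    "\<lambda>W. Pi\<^sub>M W (\<lambda>n. arctan_law (\<mu> n))" by (rule product_law)
  interpret prod: product_prob_space \<mu> UNIV using \<mu>_facts(1) by (simp add: product_prob_spaceI)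
  note V = vector_facts[OF IN(2)]
  have sets\<Pi>: "sets (Pi\<^sub>M I \<mu>) = sets (Pi\<^sub>M I (\<lambda>_. borel))" by (rule sets_PiM_cong) (auto simp: \<mu>_facts(2))
  have "le_sm_vec I (b I) (Pi\<^sub>M I \<mu>) (law M X I)"
  proof (rule le_sm_vec_of_tree_laws[OF IN(1) W(2) _ sets\<Pi> _ product_arctan_related[OF \<mu>_facts finW W(2)]
        \<Pi>.P_sets[OF W(1)] \<Pi>.associated_P[OF W(1)] V(1,2) V(3) V(4)[OF W(2) WN] T.P_sets[OF W(1)]
        T.associated_P[OF W(1)] \<mu>_facts])
    show "prob_space (Pi\<^sub>M I \<mu>)" by (rule prob_space_PiM) (rule \<mu>_facts)
    show "distr (Pi\<^sub>M I \<mu>) borel (\<lambda>x. x i) = \<mu> i" if "i \<in> I" for i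
    proof -
      interpret I: product_prob_space \<mu> I using \<mu>_facts(1) by (simp add: product_prob_spaceI)
      have "distr (Pi\<^sub>M I \<mu>) borel (\<lambda>x. x i) = distr (Pi\<^sub>M I \<mu>) (\<mu> i) (\<lambda>x. x i)"
        by (rule distr_cong) (auto simp: \<mu>_facts(2))
      then show ?thesis using I.PiM_component[OF that] by simp
    qed
    show "(\<integral>x. F x \<partial>Pi\<^sub>M W (\<lambda>n. arctan_law (\<mu> n))) \<le> (\<integral>x. F x \<partial>law M Z W)"
      if "F \<in> borel_measurable (Pi\<^sub>M W (\<lambda>_. borel))" "\<And>x. \<bar>F x\<bar> \<le> c" "supermodular W F" for F c
    proof (rule tree_law_supermodular_ge[OF tree_law_Z product_law W(1) _ that])
      fix e x y assume e: "e \<in> E"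
      obtain i j where ij: "e = (i, j)" by (cases e)
      show "measure (case e of (i, j) \<Rightarrow> arctan_law (\<mu> i) \<Otimes>\<^sub>M arctan_law (\<mu> j)) ({..x} \<times> {..y}) \<le> measure (\<nu> e) ({..x} \<times> {..y})"
        using pair_measure_cdf(1)[OF arctan_\<mu>_facts(1) arctan_\<mu>_facts(1) arctan_\<mu>_facts(2) arctan_\<mu>_facts(2), of i j x y]
          \<nu>_joint[of i j x y] concave_in_fst_pqd[OF cop concave cdf_bounds cdf_bounds, of e i x j y] e ij
        by simp
    qed
    show "weight_function I (b I)" using b I by blast
    show "integrable (Pi\<^sub>M I \<mu>) (b I)" "integrable (Pi\<^sub>M I \<mu>) (b I)"
      using int(2) I indep_law_eq[OF IN(2)] unfolding b_integrable_def by auto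
    show "integrable (law M X I) (b I)" using int(1) I unfolding b_integrable_def by blast
  qed
  then show "le_sm_vec I (b I) (indep_law M X I) (law M X I)" by (simp add: indep_law_eq[OF IN(2)])
qed

end

theorem corollary1p4:
  fixes N :: "nat set" and E :: "(nat \<times> nat) set"
    and F :: "nat \<Rightarrow> real \<Rightarrow> real"
    and B C :: "nat \<times> nat \<Rightarrow> real \<Rightarrow> real \<Rightarrow> real"
    and b :: weights
    and M :: "'a measure" and X :: "nat \<Rightarrow> 'a \<Rightarrow> real"
    and M' :: "'b measure" and Y :: "nat \<Rightarrow> 'b \<Rightarrow> real"
  assumes "index_set N" and "directed_tree N E"
    and "\<forall>n\<in>N. distribution_function (F n)"
    and "\<forall>e\<in>E. copula (B e)" and "\<forall>e\<in>E. copula (C e)"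
    and "has_markov_tree_dist M X F N E B"
    and "has_markov_tree_dist M' Y F N E C"
    and "\<forall>I\<in>vector_indices N. weight_function I (b I)"
    and "b_integrable N b (law M X)" and "b_integrable N b (law M' Y)"
    and "b_integrable N b (indep_law M X)" and "b_integrable N b (indep_law M' Y)"
    and "\<forall>e\<in>E. SI (B e)"
    and "\<forall>e\<in>E. CI (C e)"
  shows "((\<forall>e\<in>E. le_lo (B e) (C e)) \<longrightarrow>
            le_sm N b (law M X) (law M' Y) \<and> PSMD N b M X \<and> PSMD N b M' Y) \<and>
         ((\<forall>e\<in>E. le_lo (C e) (B e)) \<longrightarrow>
            le_sm N b (law M' Y) (law M X) \<and> PSMD N b M X \<and> PSMD N b M' Y)"
proof -
  interpret X: markov_process N E F B M X
    by (rule markov_process.intro) (use assms SI_concave in auto)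
  interpret Y: markov_process N E F C M' Y
    by (rule markov_process.intro) (use assms CI_concave in auto)
  have X_PSMD: "PSMD N b M X" by (rule X.PSMD_process[OF assms(8,9,11)])
  have Y_PSMD: "PSMD N b M' Y" by (rule Y.PSMD_process[OF assms(8,10,12)])
  \<comment> \<open>The distribution functions determine the marginal laws, so both processes become
    tree laws over one common family of marginals.\<close>
  have \<mu>_eq: "Y.\<mu> n = X.\<mu> n" for n
  proof (cases "n \<in> N")
    case True
    have "real_distribution (distr M' borel (Y n))" "real_distribution (distr M borel (X n))"
      using X.X_borel[OF True] Y.X_borel[OF True]
      by (auto intro!: real_distribution.intro real_distribution_axioms.intro X.M.prob_space_distr Y.M.prob_space_distr)
    from cdf_unique[OF this] show ?thesis
      using X.F_eq[OF True] Y.F_eq[OF True] True by (simp add: X.\<mu>_def Y.\<mu>_def marginals_def)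
  qed (simp add: X.\<mu>_def Y.\<mu>_def marginals_def)
  have YT: "CI_tree_law E (\<lambda>n. arctan_law (X.\<mu> n)) Y.\<nu> (law M' Y.Z)"
  proof (rule CI_tree_law.intro)
    show "tree_law E (\<lambda>n. arctan_law (X.\<mu> n)) Y.\<nu> (law M' Y.Z)" using Y.tree_law_Z by (simp add: \<mu>_eq)
    show "CI_tree_law_axioms E Y.\<nu>"
    proof
      fix e assume e: "e \<in> E"
      obtain i j where ij: "e = (i, j)" by (cases e)
      show "\<exists>q. mono_kernel (distr (Y.\<nu> e) borel prod.swap) q"
        unfolding ij by (rule Y.swap_kernel) (use e ij assms(5,14) CI_concave in auto)
    qed
  qed
  interpret XT: tree_law E "\<lambda>n. arctan_law (X.\<mu> n)" X.\<nu> "law M X.Z" by (rule X.tree_law_Z)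
  interpret YT: CI_tree_law E "\<lambda>n. arctan_law (X.\<mu> n)" Y.\<nu> "law M' Y.Z" by (rule YT)
  have edge_le: "measure (X.\<nu> e) ({..x} \<times> {..y}) \<le> measure (Y.\<nu> e) ({..x} \<times> {..y})"
    if "\<forall>e\<in>E. le_lo (B e) (C e)" "e \<in> E" for e x y
  proof -
    obtain i j where ij: "e = (i, j)" by (cases e)
    show ?thesis
      using X.\<nu>_joint[of i j x y] Y.\<nu>_joint[of i j x y] that X.cdf_bounds unfolding ij le_lo_def by (auto simp: \<mu>_eq)
  qed
  have edge_ge: "measure (Y.\<nu> e) ({..x} \<times> {..y}) \<le> measure (X.\<nu> e) ({..x} \<times> {..y})"
    if "\<forall>e\<in>E. le_lo (C e) (B e)" "e \<in> E" for e x y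
  proof -
    obtain i j where ij: "e = (i, j)" by (cases e)
    show ?thesis
      using X.\<nu>_joint[of i j x y] Y.\<nu>_joint[of i j x y] that X.cdf_bounds unfolding ij le_lo_def by (auto simp: \<mu>_eq)
  qed
  have main: "(\<forall>e\<in>E. le_lo (B e) (C e)) \<Longrightarrow> le_sm_vec I (b I) (law M X I) (law M' Y I)"
    "(\<forall>e\<in>E. le_lo (C e) (B e)) \<Longrightarrow> le_sm_vec I (b I) (law M' Y I) (law M X I)"
    if I: "I \<in> vector_indices N" for I
  proof -
    note IN = X.vector_indices_facts[OF I]
    obtain W where W: "subtree E W" "I \<subseteq> W" using ex_subtree_superset[OF assms(2) IN] by blast
    note WN = subtree_subset[OF assms(1,2) W(1)]
    note VX = X.vector_facts[OF IN(2)] and VY = Y.vector_facts[OF IN(2), unfolded \<mu>_eq]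
    have int: "integrable (law M X I) (b I)" "integrable (law M' Y I) (b I)" "integrable (Pi\<^sub>M I X.\<mu>) (b I)"
      using assms(9-11) I X.indep_law_eq[OF IN(2)] unfolding b_integrable_def by auto
    have wf: "weight_function I (b I)" using assms(8) I by blast
    show "le_sm_vec I (b I) (law M X I) (law M' Y I)" if le: "\<forall>e\<in>E. le_lo (B e) (C e)"
      by (rule le_sm_vec_of_tree_laws[OF IN(1) W(2) VX(1-3) VX(4)[OF W(2) WN] XT.P_sets[OF W(1)] XT.associated_P[OF W(1)]
            VY(1-3) VY(4)[OF W(2) WN] YT.P_sets[OF W(1)] YT.associated_P[OF W(1)] X.\<mu>_facts
            tree_law_supermodular_le[OF X.tree_law_Z YT W(1) edge_le[OF le]] wf int])
    show "le_sm_vec I (b I) (law M' Y I) (law M X I)" if le: "\<forall>e\<in>E. le_lo (C e) (B e)"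
      by (rule le_sm_vec_of_tree_laws[OF IN(1) W(2) VY(1-3) VY(4)[OF W(2) WN] YT.P_sets[OF W(1)] YT.associated_P[OF W(1)]
            VX(1-3) VX(4)[OF W(2) WN] XT.P_sets[OF W(1)] XT.associated_P[OF W(1)] X.\<mu>_facts
            tree_law_supermodular_ge[OF X.tree_law_Z YT W(1) edge_ge[OF le]] wf int(2,1,3)])
  qed
  show ?thesis using main X_PSMD Y_PSMD unfolding le_sm_def by blast
qed

end
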